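(* Let $R$ be a Noetherian ring containing $\mathbb{Q}$ and let $A$ be an $R$-algebra such that $A^{[n]} = A[\underline{T}] = R[\underline{X}] = R^{[n+2]}$, where $\underline{X} = (X_1, X_2, \ldots, X_{n+2})$ and $\underline{T} = (T_1, T_2, \ldots, T_n)$ are two sequences of indeterminates (over $R$ and over $A$ respectively). Let $F \in A$ be such that $A \otimes_R \operatorname{Qt}(R/P) = \operatorname{Qt}(R/P)[F]^{[1]}$ for each minimal prime ideal $P$ of $R$. Then the following are equivalent. (I) $(F_{X_1}, F_{X_2}, \ldots, F_{X_{n+2}})A[\underline{T}] = A[\underline{T}]$. (II) $F$ is a residual coordinate of $A$ over $R$. (III) $A = R[F]^{[1]} = R^{[2]}$. (IV) The Jacobian derivation $\mathcal{JD}_{(\underline{X})}(F, \underline{T}, -)$ of $A[\underline{T}]$ is an $R$-LND with a slice. (V) The Jacobian derivation $\mathcal{JD}_{(\underline{X})}(F, \underline{T}, -)$ of $A[\underline{T}]$ is a fixed point free $R$-LND. (VI) $I = A[\underline{T}]$, where $I$ is the ideal of $A[\underline{T}]$ generated by the $(n+1) \times (n+1)$ minors of the Jacobian matrix $\mathcal{J}_{(\underline{X})}(F, \underline{T})$.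
   Context: All rings are commutative with unity. For a ring $S$, $S^{[n]}$ denotes a polynomial ring in $n$ variables over $S$; for an $S$-algebra $C$, $C = S^{[n]}$ means $C$ is isomorphic to such a polynomial ring as an $S$-algebra. $\operatorname{Qt}(D)$ is the quotient field of a domain $D$, and for a prime ideal $P$ of $R$, $k(P) = R_P/PR_P$. The equality $A[\underline{T}] = R[\underline{X}]$ means that the polynomial ring $A[T_1,\ldots,T_n]$ is, as an $R$-algebra, identified with the polynomial ring $R[X_1,\ldots,X_{n+2}]$; thus $A$ is an $R$-subalgebra of $R[\underline{X}]$, and $F_{X_i} = \partial F/\partial X_i$ is computed in $R[\underline{X}] = A[\underline{T}]$. For a field $L$ that is an $R$-algebra, $A \otimes_R L = L[F]^{[1]}$ means that $A \otimes_R L$ is a polynomial ring in one variable over its subring $L[\overline{F}]$ generated over $L$ by the image $\overline{F}$ of $F$. $A = R[F]^{[1]} = R^{[2]}$ means that $A = R[F,G]$ for some $G \in A$ with $F, G$ algebraically independent over $R$. An $R$-algebra $A$ is an $\mathbb{A}^2$-fibration over $R$ if $A$ is finitely generated and flat over $R$ and $A \otimes_R k(P) = k(P)^{[2]}$ for all $P \in \operatorname{Spec}(R)$. (An algebra $A$ as in the claim is known to be an $\mathbb{A}^2$-fibration over $R$.) An element $F$ of an $\mathbb{A}^2$-fibration $A$ over $R$ is a residual coordinate of $A$ if $F$ is algebraically independent over $R$ and $A \otimes_R k(P) = (R[F] \otimes_R k(P))^{[1]}$ for each $P \in \operatorname{Spec}(R)$. $\mathcal{J}_{(\underline{X})}(F,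 \underline{T})$ is the $(n+1)\times(n+2)$ Jacobian matrix of $(F, T_1, \ldots, T_n)$, elements of $R[\underline{X}]$, with respect to $X_1, \ldots, X_{n+2}$. The Jacobian derivation $\mathcal{JD}_{(\underline{X})}(F, \underline{T}, -)$ is the $R$-derivation of $R[\underline{X}] = A[\underline{T}]$ sending $g$ to the determinant of the $(n+2)\times(n+2)$ Jacobian matrix of $(F, T_1, \ldots, T_n, g)$ with respect to $X_1, \ldots, X_{n+2}$. An $R$-derivation $D$ of an $R$-algebra $C$ is a locally nilpotent $R$-derivation ($R$-LND) if for each $x \in C$ there is $m \in \mathbb{N}$ with $D^m(x) = 0$; it is fixed point free if $D(C)C = C$, i.e. the ideal generated by the image of $D$ is $C$; a slice of $D$ is an element $s \in C$ with $D(s) = 1$. *)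

theory Defs
  imports
    "HOL-Library.Poly_Mapping"
    "HOL-Algebra.QuotRing"
    "HOL-Algebra.Generated_Rings"
    "HOL-Algebra.Ring_Divisibility"
    "Jordan_Normal_Form.Determinant"
    "Jordan_Normal_Form.DL_Submatrix"
    "Jordan_Normal_Form.VS_Connect"
begin

text \<open>
  The base ring is a type of class \<^class>\<open>comm_ring_1\<close>. Quotients, localizations, subalgebras and tensor
  products of it are ring records in the sense of HOL-Algebra; \<^term>\<open>class_ring\<close> is the record of a
  whole type. An algebra over a ring record \<open>R\<close> is a ring record \<open>C\<close> together with a structure
  homomorphism \<open>R \<rightarrow> C\<close>.
\<close>

section \<open>The ring of polynomials in n variables over a type\<close>

text \<open>A polynomial maps exponent vectors to coefficients; the variables are numbered from 0, so
  the variable that is usually called \<open>X\<^sub>1\<close> has index 0.\<close>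

type_synonym 'a mpol = "(nat \<Rightarrow>\<^sub>0 nat) \<Rightarrow>\<^sub>0 'a"

definition mpol_ring :: "nat \<Rightarrow> 'a::comm_ring_1 mpol ring" where
  "mpol_ring N = class_ring
     \<lparr>carrier := {p. \<forall>m \<in> Poly_Mapping.keys p. Poly_Mapping.keys m \<subseteq> {..<N}}\<rparr>"

definition mpol_const :: "'a::comm_ring_1 \<Rightarrow> 'a mpol" where
  "mpol_const a = Poly_Mapping.single 0 a"

text \<open>If the exponent of the variable \<open>i\<close> in \<open>m\<close> is 0, then the truncated subtraction in the
  exponent is harmless, because the coefficient of that term vanishes.\<close>

definition pderivative :: "nat \<Rightarrow> 'a::comm_ring_1 mpol \<Rightarrow> 'a mpol" where
  "pderivative i p = (\<Sum>m \<in> Poly_Mapping.keys p.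
     Poly_Mapping.single (m - Poly_Mapping.single i 1)
       (of_nat (Poly_Mapping.lookup m i) * Poly_Mapping.lookup p m))"

definition jacobian :: "nat \<Rightarrow> 'a::comm_ring_1 mpol list \<Rightarrow> 'a mpol mat" where
  "jacobian N fs = mat (length fs) N (\<lambda>(i, j). pderivative j (fs ! i))"

definition minors :: "nat \<Rightarrow> 'b::comm_ring_1 mat \<Rightarrow> 'b set" where
  "minors k M = {det (submatrix M I J) | I J.
     I \<subseteq> {..<dim_row M} \<and> J \<subseteq> {..<dim_col M} \<and> card I = k \<and> card J = k}"

text \<open>\<open>jacobian_derivation N fs\<close> is meant for \<open>N - 1\<close> polynomials \<open>fs\<close>.\<close>

definition jacobian_derivation ::
    "nat \<Rightarrow> 'a::comm_ring_1 mpol list \<Rightarrow> 'a mpol \<Rightarrow> 'a mpol" where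
  "jacobian_derivation N fs g = det (jacobian N (fs @ [g]))"

section \<open>Polynomial algebras over a ring record\<close>

text \<open>\<open>poly_coeffs S n\<close> is the set of coefficient families of the polynomials in \<open>n\<close> variables over
  \<open>S\<close>, and \<open>poly_eval S h C G\<close> is the substitution \<open>S[Y\<^sub>0, \<dots>, Y\<^sub>n\<^sub>-\<^sub>1] \<rightarrow> C\<close> with \<open>Y\<^sub>i \<mapsto> G i\<close> on the
  \<open>S\<close>-algebra \<open>C\<close> with structure map \<open>h\<close>.\<close>

definition poly_coeffs :: "('s, 'm) ring_scheme \<Rightarrow> nat \<Rightarrow> ((nat \<Rightarrow>\<^sub>0 nat) \<Rightarrow> 's) set" where
  "poly_coeffs S n = {c. (\<forall>m. c m \<in> carrier S) \<and> finite {m. c m \<noteq> \<zero>\<^bsub>S\<^esub>} \<and>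
     (\<forall>m. c m \<noteq> \<zero>\<^bsub>S\<^esub> \<longrightarrow> Poly_Mapping.keys m \<subseteq> {..<n})}"

definition poly_eval :: "('s, 'm) ring_scheme \<Rightarrow> ('s \<Rightarrow> 'c) \<Rightarrow> ('c, 'k) ring_scheme \<Rightarrow>
    (nat \<Rightarrow> 'c) \<Rightarrow> ((nat \<Rightarrow>\<^sub>0 nat) \<Rightarrow> 's) \<Rightarrow> 'c" where
  "poly_eval S h C G c = finsum C
     (\<lambda>m. h (c m) \<otimes>\<^bsub>C\<^esub>
       finprod C (\<lambda>i. G i [^]\<^bsub>C\<^esub> Poly_Mapping.lookup m i) (Poly_Mapping.keys m))
     {m. c m \<noteq> \<zero>\<^bsub>S\<^esub>}"

definition alg_independent :: "('s, 'm) ring_scheme \<Rightarrow> ('s \<Rightarrow> 'c) \<Rightarrow> ('c, 'k) ring_scheme \<Rightarrow>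
    nat \<Rightarrow> (nat \<Rightarrow> 'c) \<Rightarrow> bool" where
  "alg_independent S h C n G \<longleftrightarrow> inj_on (poly_eval S h C G) (poly_coeffs S n)"

text \<open>\<open>C\<close> is the polynomial ring over \<open>S\<close> in the \<open>n\<close> variables \<open>G 0, \<dots>, G (n - 1)\<close>.\<close>

definition poly_algebra_in :: "('s, 'm) ring_scheme \<Rightarrow> ('s \<Rightarrow> 'c) \<Rightarrow> ('c, 'k) ring_scheme \<Rightarrow>
    nat \<Rightarrow> (nat \<Rightarrow> 'c) \<Rightarrow> bool" where
  "poly_algebra_in S h C n G \<longleftrightarrow> h \<in> Ring.ring_hom S C \<and> G \<in> {..<n} \<rightarrow> carrier C \<and>
     bij_betw (poly_eval S h C G) (poly_coeffs S n) (carrier C)"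

text \<open>\<open>C = S\<^bsup>[n]\<^esup>\<close>\<close>

definition poly_algebra :: "('s, 'm) ring_scheme \<Rightarrow> ('s \<Rightarrow> 'c) \<Rightarrow> ('c, 'k) ring_scheme \<Rightarrow>
    nat \<Rightarrow> bool" where
  "poly_algebra S h C n \<longleftrightarrow> (\<exists>G. poly_algebra_in S h C n G)"

section \<open>Localization, quotient fields and residue fields\<close>

definition loc_rel :: "('a, 'm) ring_scheme \<Rightarrow> 'a set \<Rightarrow> (('a \<times> 'a) \<times> ('a \<times> 'a)) set" where
  "loc_rel D S = {((a, s), (b, t)). a \<in> carrier D \<and> b \<in> carrier D \<and> s \<in> S \<and> t \<in> S \<and>
     (\<exists>u \<in> S. u \<otimes>\<^bsub>D\<^esub> (a \<otimes>\<^bsub>D\<^esub> t) = u \<otimes>\<^bsub>D\<^esub> (b \<otimes>\<^bsub>D\<^esub> s))}"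

definition loc_frac :: "('a, 'm) ring_scheme \<Rightarrow> 'a set \<Rightarrow> 'a \<Rightarrow> 'a \<Rightarrow> ('a \<times> 'a) set" where
  "loc_frac D S a s = loc_rel D S `` {(a, s)}"

definition localization :: "('a, 'm) ring_scheme \<Rightarrow> 'a set \<Rightarrow> ('a \<times> 'a) set ring" where
  "localization D S = \<lparr>
     carrier = (carrier D \<times> S) // loc_rel D S,
     monoid.mult = (\<lambda>x y. \<Union>(a, s) \<in> x. \<Union>(b, t) \<in> y. loc_frac D S (a \<otimes>\<^bsub>D\<^esub> b) (s \<otimes>\<^bsub>D\<^esub> t)),
     one = loc_frac D S \<one>\<^bsub>D\<^esub> \<one>\<^bsub>D\<^esub>,
     zero = loc_frac D S \<zero>\<^bsub>D\<^esub> \<one>\<^bsub>D\<^esub>,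
     add = (\<lambda>x y. \<Union>(a, s) \<in> x. \<Union>(b, t) \<in> y.
       loc_frac D S ((a \<otimes>\<^bsub>D\<^esub> t) \<oplus>\<^bsub>D\<^esub> (b \<otimes>\<^bsub>D\<^esub> s)) (s \<otimes>\<^bsub>D\<^esub> t))\<rparr>"

definition quotient_field :: "('a, 'm) ring_scheme \<Rightarrow> ('a \<times> 'a) set ring" where
  "quotient_field D = localization D (carrier D - {\<zero>\<^bsub>D\<^esub>})"

text \<open>The canonical map from \<open>R\<close> to the quotient field of \<open>R/P\<close>.\<close>

definition to_quotient_field ::
    "('a, 'm) ring_scheme \<Rightarrow> 'a set \<Rightarrow> 'a \<Rightarrow> ('a set \<times> 'a set) set" where
  "to_quotient_field R P r =
     loc_frac (R Quot P) (carrier (R Quot P) - {\<zero>\<^bsub>R Quot P\<^esub>}) (P +>\<^bsub>R\<^esub> r) \<one>\<^bsub>R Quot P\<^esub>"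

text \<open>\<open>k(P)\<close> is the quotient of the local ring at \<open>P\<close> by the extension of \<open>P\<close>.\<close>

definition local_max :: "('a, 'm) ring_scheme \<Rightarrow> 'a set \<Rightarrow> ('a \<times> 'a) set set" where
  "local_max R P = genideal (localization R (carrier R - P))
     ((\<lambda>r. loc_frac R (carrier R - P) r \<one>\<^bsub>R\<^esub>) ` P)"

definition residue_field :: "('a, 'm) ring_scheme \<Rightarrow> 'a set \<Rightarrow> ('a \<times> 'a) set set ring" where
  "residue_field R P = localization R (carrier R - P) Quot local_max R P"

definition to_residue_field ::
    "('a, 'm) ring_scheme \<Rightarrow> 'a set \<Rightarrow> 'a \<Rightarrow> ('a \<times> 'a) set set" where
  "to_residue_field R P r =
     local_max R P +>\<^bsub>localization R (carrier R - P)\<^esub> loc_frac R (carrier R - P) r \<one>\<^bsub>R\<^esub>"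

definition minimal_prime :: "('a, 'm) ring_scheme \<Rightarrow> 'a set \<Rightarrow> bool" where
  "minimal_prime R P \<longleftrightarrow> primeideal P R \<and> (\<forall>Q. primeideal Q R \<longrightarrow> Q \<subseteq> P \<longrightarrow> Q = P)"

section \<open>Tensor products of algebras\<close>

text \<open>The tensor product over \<open>R\<close> of the \<open>R\<close>-algebras \<open>B\<close> and \<open>C\<close> (with structure maps \<open>f\<close> and \<open>g\<close>)
  is the free abelian group on \<open>B \<times> C\<close>, with the multiplication extending
  \<open>(b, c) (b', c') = (b b', c c')\<close> bilinearly, modulo the bilinearity relations. The set of these
  relations is stable under multiplication by pairs, so the ideal it generates is also the
  subgroup it generates.\<close>

definition pair_ring ::
    "('b, 'm) ring_scheme \<Rightarrow> ('c, 'k) ring_scheme \<Rightarrow> ('b \<times> 'c \<Rightarrow>\<^sub>0 int) ring" where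
  "pair_ring B C = \<lparr>
     carrier = {x. Poly_Mapping.keys x \<subseteq> carrier B \<times> carrier C},
     monoid.mult = (\<lambda>x y. frag_extend (\<lambda>(b, c). frag_extend
       (\<lambda>(b', c'). frag_of (b \<otimes>\<^bsub>B\<^esub> b', c \<otimes>\<^bsub>C\<^esub> c')) y) x),
     one = frag_of (\<one>\<^bsub>B\<^esub>, \<one>\<^bsub>C\<^esub>),
     zero = 0,
     add = (+)\<rparr>"

definition tensor_ideal :: "('r, 'l) ring_scheme \<Rightarrow> ('r \<Rightarrow> 'b) \<Rightarrow> ('b, 'm) ring_scheme \<Rightarrow>
    ('r \<Rightarrow> 'c) \<Rightarrow> ('c, 'k) ring_scheme \<Rightarrow> ('b \<times> 'c \<Rightarrow>\<^sub>0 int) set" where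
  "tensor_ideal R f B g C = genideal (pair_ring B C)
     ({frag_of (b \<oplus>\<^bsub>B\<^esub> b', c) - frag_of (b, c) - frag_of (b', c) | b b' c.
         b \<in> carrier B \<and> b' \<in> carrier B \<and> c \<in> carrier C} \<union>
      {frag_of (b, c \<oplus>\<^bsub>C\<^esub> c') - frag_of (b, c) - frag_of (b, c') | b c c'.
         b \<in> carrier B \<and> c \<in> carrier C \<and> c' \<in> carrier C} \<union>
      {frag_of (f r \<otimes>\<^bsub>B\<^esub> b, c) - frag_of (b, g r \<otimes>\<^bsub>C\<^esub> c) | r b c.
         r \<in> carrier R \<and> b \<in> carrier B \<and> c \<in> carrier C})"

definition tensor :: "('r, 'l) ring_scheme \<Rightarrow> ('r \<Rightarrow> 'b) \<Rightarrow> ('b, 'm) ring_scheme \<Rightarrow>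
    ('r \<Rightarrow> 'c) \<Rightarrow> ('c, 'k) ring_scheme \<Rightarrow> ('b \<times> 'c \<Rightarrow>\<^sub>0 int) set ring" where
  "tensor R f B g C = pair_ring B C Quot tensor_ideal R f B g C"

definition pure_tensor :: "('r, 'l) ring_scheme \<Rightarrow> ('r \<Rightarrow> 'b) \<Rightarrow> ('b, 'm) ring_scheme \<Rightarrow>
    ('r \<Rightarrow> 'c) \<Rightarrow> ('c, 'k) ring_scheme \<Rightarrow> 'b \<Rightarrow> 'c \<Rightarrow> ('b \<times> 'c \<Rightarrow>\<^sub>0 int) set" where
  "pure_tensor R f B g C b c = tensor_ideal R f B g C +>\<^bsub>pair_ring B C\<^esub> frag_of (b, c)"

text \<open>For a subalgebra \<open>B'\<close> of \<open>B\<close>, this is the homomorphism from the tensor product of \<open>B'\<close> and \<open>C\<close>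
  to that of \<open>B\<close> and \<open>C\<close> induced by the inclusion (it need not be injective). It sends a coset of
  the smaller relation ideal to the coset of the larger one that contains it.\<close>

definition tensor_incl :: "('r, 'l) ring_scheme \<Rightarrow> ('r \<Rightarrow> 'b) \<Rightarrow> ('b, 'm) ring_scheme \<Rightarrow>
    ('r \<Rightarrow> 'c) \<Rightarrow> ('c, 'k) ring_scheme \<Rightarrow> ('b \<times> 'c \<Rightarrow>\<^sub>0 int) set \<Rightarrow> ('b \<times> 'c \<Rightarrow>\<^sub>0 int) set" where
  "tensor_incl R f B g C x = (\<Union>z \<in> x. tensor_ideal R f B g C +>\<^bsub>pair_ring B C\<^esub> z)"

section \<open>Conditions on an element of an algebra\<close>

text \<open>For an \<open>R\<close>-algebra \<open>L\<close> with structure map \<open>g\<close>: the tensor product of \<open>A\<close> and \<open>L\<close> is a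
  polynomial ring in one variable over its subring generated by the images of \<open>L\<close> and \<open>F\<close>.\<close>

definition poly_over_adjoined :: "('r, 'l) ring_scheme \<Rightarrow> ('r \<Rightarrow> 'b) \<Rightarrow> ('b, 'm) ring_scheme \<Rightarrow>
    ('r \<Rightarrow> 'c) \<Rightarrow> ('c, 'k) ring_scheme \<Rightarrow> 'b \<Rightarrow> bool" where
  "poly_over_adjoined R f A g L F \<longleftrightarrow>
     (let AL = tensor R f A g L;
          S = generate_ring AL
            (insert (pure_tensor R f A g L F \<one>\<^bsub>L\<^esub>) (pure_tensor R f A g L \<one>\<^bsub>A\<^esub> ` carrier L))
      in poly_algebra (AL\<lparr>carrier := S\<rparr>) id AL 1)"

text \<open>\<open>R[F]\<close> as a subalgebra of \<open>A\<close>\<close>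

definition adjoin :: "('r, 'l) ring_scheme \<Rightarrow> ('r \<Rightarrow> 'b) \<Rightarrow> ('b, 'm) ring_scheme \<Rightarrow> 'b \<Rightarrow>
    ('b, 'm) ring_scheme" where
  "adjoin R f A F = A\<lparr>carrier := generate_ring A (insert F (f ` carrier R))\<rparr>"

text \<open>\<open>A\<close> is meant to be an affine plane fibration over \<open>R\<close>. The fibre at \<open>P\<close> is an algebra over the fibre
  of \<open>R[F]\<close> through the map induced by the inclusion \<open>R[F] \<subseteq> A\<close>.\<close>

definition residual_coordinate :: "('r, 'l) ring_scheme \<Rightarrow> ('r \<Rightarrow> 'b) \<Rightarrow> ('b, 'm) ring_scheme \<Rightarrow>
    'b \<Rightarrow> bool" where
  "residual_coordinate R f A F \<longleftrightarrow> alg_independent R f A 1 (\<lambda>_. F) \<and>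
     (\<forall>P. primeideal P R \<longrightarrow>
       poly_algebra
         (tensor R f (adjoin R f A F) (to_residue_field R P) (residue_field R P))
         (tensor_incl R f A (to_residue_field R P) (residue_field R P))
         (tensor R f A (to_residue_field R P) (residue_field R P)) 1)"

section \<open>Locally nilpotent derivations\<close>

definition R_derivation ::
    "('r, 'l) ring_scheme \<Rightarrow> ('r \<Rightarrow> 'c) \<Rightarrow> ('c, 'k) ring_scheme \<Rightarrow> ('c \<Rightarrow> 'c) \<Rightarrow> bool" where
  "R_derivation R f C D \<longleftrightarrow> D \<in> carrier C \<rightarrow> carrier C \<and>
     (\<forall>x \<in> carrier C. \<forall>y \<in> carrier C. D (x \<oplus>\<^bsub>C\<^esub> y) = D x \<oplus>\<^bsub>C\<^esub> D y) \<and>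
     (\<forall>r \<in> carrier R. \<forall>x \<in> carrier C. D (f r \<otimes>\<^bsub>C\<^esub> x) = f r \<otimes>\<^bsub>C\<^esub> D x) \<and>
     (\<forall>x \<in> carrier C. \<forall>y \<in> carrier C.
       D (x \<otimes>\<^bsub>C\<^esub> y) = (x \<otimes>\<^bsub>C\<^esub> D y) \<oplus>\<^bsub>C\<^esub> (y \<otimes>\<^bsub>C\<^esub> D x))"

definition R_LND ::
    "('r, 'l) ring_scheme \<Rightarrow> ('r \<Rightarrow> 'c) \<Rightarrow> ('c, 'k) ring_scheme \<Rightarrow> ('c \<Rightarrow> 'c) \<Rightarrow> bool" where
  "R_LND R f C D \<longleftrightarrow> R_derivation R f C D \<and>
     (\<forall>x \<in> carrier C. \<exists>m. (D ^^ m) x = \<zero>\<^bsub>C\<^esub>)"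

definition fixed_point_free :: "('c, 'k) ring_scheme \<Rightarrow> ('c \<Rightarrow> 'c) \<Rightarrow> bool" where
  "fixed_point_free C D \<longleftrightarrow> genideal C (D ` carrier C) = carrier C"

definition has_slice :: "('c, 'k) ring_scheme \<Rightarrow> ('c \<Rightarrow> 'c) \<Rightarrow> bool" where
  "has_slice C D \<longleftrightarrow> (\<exists>s \<in> carrier C. D s = \<one>\<^bsub>C\<^esub>)"

end

theory Submission
  imports Defs
begin

text \<open>
  Write \<open>B = A[T] = R[X]\<close>, and \<open>D\<close> for the Jacobian derivation. Every condition is compared with (I).

  If the gradient of \<open>F\<close> is unimodular, the rows of the Jacobian matrix of \<open>(F, T)\<close> have a right inverse
  (the columns are a derivation \<open>\<delta>\<close> with \<open>\<delta>(F) = 1\<close>, \<open>\<delta>(T) = 0\<close> and the derivations \<open>\<partial>/\<partial>T\<^sub>i\<close>), so its maximal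
  minors generate the unit ideal, and for \<open>h \<in> A\<close> the gradient of \<open>h\<close> is \<open>\<delta>(h) \<nabla>F + D(h) \<eta>\<close> with a fixed vector
  \<open>\<eta>\<close>. Retracting \<open>B\<close> onto \<open>A\<close> along \<open>T \<mapsto> 0\<close> turns \<open>D\<close> into a derivation \<open>\<Delta>\<close> of \<open>A\<close>. Modulo a prime \<open>P\<close> of
  \<open>R\<close>, \<open>\<Delta>(h) = 0\<close> means \<open>\<nabla>h = g \<nabla>F\<close>, and comparing degrees gives \<open>h \<in> (R/P)[F]\<close>. A Noetherian induction
  on ideals extends this to all ideals \<open>I\<close>: the kernel of \<open>\<Delta>\<close> on \<open>A/IA\<close> is \<open>(R/I)[F]\<close>. This is exactly what
  is needed to descend from the generic fibres, where \<open>\<Delta>\<close> is a constant multiple of \<open>\<partial>/\<partial>G\<close>: if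
  \<open>c y \<in> \<Delta>(A) + PA\<close> with \<open>c \<notin> P\<close>, then \<open>y \<in> \<Delta>(A) + PA\<close>. So \<open>\<Delta>(G) = 1\<close> for some \<open>G \<in> A\<close>, and
  \<open>A = R[F, G]\<close> by the same descent.

  Conversely, if the fibre at \<open>P\<close> is generated by \<open>F\<close> and one more element \<open>G\<close>, then over the residue field
  the variables \<open>X\<close> are polynomials in \<open>F, T, G\<close>, and the chain rule makes \<open>D(G)\<close>, hence \<open>\<nabla>F\<close>, unimodular
  modulo \<open>P\<close>. Finally, if \<open>A = R[F, G]\<close>, then \<open>D = u \<partial>/\<partial>G\<close> on \<open>R[F, T][G]\<close> with a unit \<open>u\<close>; integrating
  \<open>u\<^sup>-\<^sup>1\<close> gives a slice, and \<open>D\<close> is locally nilpotent because \<open>u\<close> is constant modulo every prime of \<open>R\<close>.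
\<close>

section \<open>Polynomials\<close>

text \<open>No quotient of R is formed: computing over R/I means computing in the one ring R[X]
  modulo the polynomials with coefficients in I. Nothing is lost on A, because A is a retract of
  R[X] as an R-algebra, so that an element of A with coefficients in I already lies in IA. As R may
  have zero divisors and nilpotents, the statements are made for all ideals and passed from I + (b)
  and (I : b) to I: a solution modulo I + (b) leaves an error y + bz with y in IA, and b times a
  solution for z modulo (I : b) corrects it. At a prime P the descent moves to a minimal prime Q
  below P, where the generic fibre is known up to a denominator e outside Q; the denominator is
  removed by a statement for the ideal Q + (e), which is in general not prime. This is why the
  kernel of \<Delta> has to be known modulo every ideal before anything about its image can be
  shown. The rational numbers in R enter through antiderivatives and through the fact that a
  polynomial with vanishing gradient is constant, both valid modulo any ideal because the positive
  integers are units of R.\<close>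

abbreviation lookup :: "('a \<Rightarrow>\<^sub>0 'b::zero) \<Rightarrow> 'a \<Rightarrow> 'b" where "lookup \<equiv> Poly_Mapping.lookup"

abbreviation keys :: "('a \<Rightarrow>\<^sub>0 'b::zero) \<Rightarrow> 'a set" where "keys \<equiv> Poly_Mapping.keys"

abbreviation single :: "'a \<Rightarrow> 'b \<Rightarrow> ('a \<Rightarrow>\<^sub>0 'b::zero)" where "single \<equiv> Poly_Mapping.single"

lemma poly_mapping_eq_sum_single:
  "p = (\<Sum>k\<in>keys p. single k (lookup p k))"
  by (rule poly_mapping_eqI)
    (auto simp: lookup_sum lookup_single when_def in_keys_iff sum.delta'[OF finite_keys] cong: if_cong)

lemma poly_mapping_induct [consumes 1, case_names zero single add]:
  fixes p :: "'a \<Rightarrow>\<^sub>0 'b::comm_monoid_add"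
  assumes "keys p \<subseteq> K" and "P 0"
    and single: "\<And>k v. k \<in> K \<Longrightarrow> P (single k v)"
    and add: "\<And>p q. keys p \<subseteq> K \<Longrightarrow> keys q \<subseteq> K \<Longrightarrow> P p \<Longrightarrow> P q \<Longrightarrow> P (p + q)"
  shows "P p"
proof -
  \<comment> \<open>The bound on the keys is part of the claim, since \<open>add\<close> may only be
    applied to summands supported in \<open>K\<close>.\<close>
  have "P (\<Sum>k\<in>S. single k (lookup p k)) \<and>
      keys (\<Sum>k\<in>S. single k (lookup p k)) \<subseteq> S"
    if "finite S" "S \<subseteq> K" for S
    using that
  proof (induction S)
    case empty
    then show ?case using \<open>P 0\<close> by simp
  next
    case (insert x S)
    then have x: "x \<in> K" and S: "S \<subseteq> K" by auto
    let ?s = "single x (lookup p x)"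
    let ?t = "\<Sum>k\<in>S. single k (lookup p k)"
    have "keys ?s \<subseteq> {x}" by simp
    then have "keys ?s \<subseteq> K" using x by blast
    moreover have "keys (?s + ?t) \<subseteq> insert x S"
      using Poly_Mapping.keys_add[of ?s ?t] insert.IH[OF S] \<open>keys ?s \<subseteq> {x}\<close> by blast
    moreover have "P (?s + ?t)"
      by (rule add) (use insert.IH[OF S] S single[OF x] \<open>keys ?s \<subseteq> K\<close> in blast)+
    ultimately show ?case using insert.hyps by simp
  qed
  from this[OF finite_keys \<open>keys p \<subseteq> K\<close>] show ?thesis
    by (simp flip: poly_mapping_eq_sum_single)
qed

text \<open>The carrier of \<open>mpol_ring N\<close> (compare \<open>mpol_ring_eq\<close>). Ring
  identities are proved in the ambient type of polynomials in all variables, and membership in this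
  set is tracked separately.\<close>

definition mpolys :: "nat \<Rightarrow> 'a::comm_ring_1 mpol set" where
  "mpolys N = {p. \<forall>m \<in> keys p. keys m \<subseteq> {..<N}}"

definition mvar :: "nat \<Rightarrow> 'a::comm_ring_1 mpol" where
  "mvar k = single (single k 1) 1"

lemma mpolysI: "(\<And>m. lookup p m \<noteq> 0 \<Longrightarrow> keys m \<subseteq> {..<N}) \<Longrightarrow> p \<in> mpolys N"
  by (auto simp: mpolys_def in_keys_iff)

lemma mpolysD:
  "p \<in> mpolys N \<Longrightarrow> m \<in> keys p \<Longrightarrow> i \<in> keys m \<Longrightarrow> i < N"
  by (auto simp: mpolys_def)

lemma mpolys_single: "keys m \<subseteq> {..<N} \<Longrightarrow> single m a \<in> mpolys N"
  by (auto simp: mpolys_def)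

lemma mpolys_add: "p \<in> mpolys N \<Longrightarrow> q \<in> mpolys N \<Longrightarrow> p + q \<in> mpolys N"
  using Poly_Mapping.keys_add[of p q] by (fastforce simp: mpolys_def)

lemma mpolys_uminus: "p \<in> mpolys N \<Longrightarrow> - p \<in> mpolys N"
  by (auto simp: mpolys_def in_keys_iff)

lemma mpolys_diff: "p \<in> mpolys N \<Longrightarrow> q \<in> mpolys N \<Longrightarrow> p - q \<in> mpolys N"
  using mpolys_add[OF _ mpolys_uminus] by fastforce

lemma mpolys_mult: "p \<in> mpolys N \<Longrightarrow> q \<in> mpolys N \<Longrightarrow> p * q \<in> mpolys N"
proof -
  assume a: "p \<in> mpolys N" "q \<in> mpolys N"
  have "keys m \<subseteq> {..<N}" if "m \<in> keys (p * q)" for m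
  proof -
    obtain x y where "m = x + y" "x \<in> keys p" "y \<in> keys q"
      using Poly_Mapping.keys_mult[of p q] \<open>m \<in> keys (p * q)\<close> by blast
    then show ?thesis using a Poly_Mapping.keys_add[of x y] by (fastforce simp: mpolys_def)
  qed
  then show ?thesis by (simp add: mpolys_def)
qed

lemma mpolys_0: "0 \<in> mpolys N" and mpolys_1: "1 \<in> mpolys N"
  by (auto simp: mpolys_def)

lemma mpolys_const: "mpol_const a \<in> mpolys N"
  by (auto simp: mpol_const_def intro: mpolys_single)

lemma mpolys_mvar: "k < N \<Longrightarrow> mvar k \<in> mpolys N"
  by (auto simp: mvar_def intro!: mpolys_single)

lemma mpolys_sum: "(\<And>i. i \<in> S \<Longrightarrow> f i \<in> mpolys N) \<Longrightarrow> sum f S \<in> mpolys N"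
  by (induction S rule: infinite_finite_induct) (auto simp: mpolys_0 intro: mpolys_add)

lemma mpolys_prod: "(\<And>i. i \<in> S \<Longrightarrow> f i \<in> mpolys N) \<Longrightarrow> prod f S \<in> mpolys N"
  by (induction S rule: infinite_finite_induct) (auto simp: mpolys_1 intro: mpolys_mult)

lemma mpolys_power: "p \<in> mpolys N \<Longrightarrow> p ^ k \<in> mpolys N"
  by (induction k) (auto simp: mpolys_1 intro: mpolys_mult)

lemmas mpolys_closed = mpolys_0 mpolys_1 mpolys_add mpolys_uminus mpolys_diff mpolys_mult
  mpolys_const mpolys_mvar mpolys_sum mpolys_prod mpolys_power

interpretation mpol_const: comm_ring_hom mpol_const
  by unfold_locales (auto simp: mpol_const_def single_add mult_single)

lemma lookup_const_mult: "lookup (mpol_const a * p) m = a * lookup p m"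
proof -
  have "mpol_const a * p = Poly_Mapping.map ((*) a) p"
    by (simp add: mpol_const_def mult_map_scale_conv_mult)
  then show ?thesis by (simp add: Poly_Mapping.map.rep_eq when_def)
qed

lemma lookup_const: "lookup (mpol_const a) m = (if m = 0 then a else 0)"
  by (simp add: mpol_const_def lookup_single when_def)

lemma mpolys_induct [consumes 1, case_names zero single add]:
  assumes "p \<in> mpolys N" and "P 0"
    and "\<And>m a. keys m \<subseteq> {..<N} \<Longrightarrow> P (single m a)"
    and "\<And>p q. p \<in> mpolys N \<Longrightarrow> q \<in> mpolys N \<Longrightarrow> P p \<Longrightarrow> P q \<Longrightarrow> P (p + q)"
  shows "P p"
proof (rule poly_mapping_induct[of p "{m. keys m \<subseteq> {..<N}}" P])
  show "keys p \<subseteq> {m. keys m \<subseteq> {..<N}}"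
    using assms(1) by (auto simp: mpolys_def)
  show "P (q + r)" if "keys q \<subseteq> {m. keys m \<subseteq> {..<N}}"
    "keys r \<subseteq> {m. keys m \<subseteq> {..<N}}" "P q" "P r" for q r
    using that by (intro assms(4)) (auto simp: mpolys_def)
qed (use assms in auto)

text \<open>Constants and variables generate the polynomials as an algebra. Maps that are
  homomorphisms or derivations only on \<open>mpolys N\<close> are compared by this rule.\<close>

lemma mpolys_ring_induct [consumes 1, case_names const var add mult]:
  assumes p: "p \<in> mpolys N"
    and const: "\<And>a. P (mpol_const a)" and var: "\<And>i. i < N \<Longrightarrow> P (mvar i)"
    and add: "\<And>p q. p \<in> mpolys N \<Longrightarrow> q \<in> mpolys N \<Longrightarrow> P p \<Longrightarrow> P q \<Longrightarrow> P (p + q)"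
    and mult: "\<And>p q. p \<in> mpolys N \<Longrightarrow> q \<in> mpolys N \<Longrightarrow> P p \<Longrightarrow> P q \<Longrightarrow> P (p * q)"
  shows "P p"
  using p
proof (induction p rule: mpolys_induct)
  case zero
  then show ?case using const[of 0] by simp
next
  case (single m a)
  have one: "P 1" using const[of 1] by simp
  have pow: "P (single (single i k) 1)" if "i < N" for i k
  proof (induction k)
    case (Suc k)
    have "single (single i (Suc k)) 1 =
        mvar i * single (single i k) (1::'a)"
      by (simp add: mvar_def mult_single single_add[symmetric])
    then show ?case using Suc that mult[OF mpolys_mvar mpolys_single] var by simp
  qed (use one in simp)
  have "P (single m 1)"
    using single
  proof (induction m rule: poly_mapping_induct)
    case (add m m')
    have "single (m + m') 1 = single m 1 * single m' (1::'a)"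
      by (simp add: mult_single)
    then show ?case using add mult[OF mpolys_single mpolys_single] by simp
  qed (use one pow in auto)
  moreover have "single m a = mpol_const a * single m 1"
    by (simp add: mpol_const_def mult_single)
  ultimately show ?case using mult[OF mpolys_const mpolys_single[OF single]] const by simp
qed (rule add)

lemma mpolys_mono: "M \<le> N \<Longrightarrow> mpolys M \<subseteq> mpolys N"
  by (fastforce simp: mpolys_def)

lemma mpolys_UN: "\<exists>N. p \<in> mpolys N"
proof -
  define N where "N = Suc (Max (\<Union>(keys ` keys p) \<union> {0}))"
  have "k < N" if "k \<in> \<Union>(keys ` keys p)" for k
    unfolding N_def using that by (intro le_imp_less_Suc Max_ge) auto
  then show ?thesis by (auto simp: mpolys_def intro!: exI[of _ N])
qed

subsection \<open>Evaluation\<close>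

definition mon :: "(nat \<Rightarrow> 'b::comm_ring_1) \<Rightarrow> (nat \<Rightarrow>\<^sub>0 nat) \<Rightarrow> 'b" where
  "mon G m = (\<Prod>i \<in> keys m. G i ^ lookup m i)"

text \<open>The counterpart of \<open>poly_eval\<close> for rings that are types;
  \<open>poly_eval_subring_record\<close> identifies the two for subrings of a type.\<close>

definition ev :: "('a::comm_ring_1 \<Rightarrow> 'b::comm_ring_1) \<Rightarrow> (nat \<Rightarrow> 'b) \<Rightarrow> 'a mpol \<Rightarrow> 'b" where
  "ev h G p = (\<Sum>m \<in> keys p. h (lookup p m) * mon G m)"

lemma mon_superset:
  "finite S \<Longrightarrow> keys m \<subseteq> S \<Longrightarrow> mon G m = (\<Prod>i \<in> S. G i ^ lookup m i)"
  unfolding mon_def by (rule prod.mono_neutral_left) (auto simp: in_keys_iff)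

lemma mon_0 [simp]: "mon G 0 = 1"
  by (simp add: mon_def)

lemma mon_single: "mon G (single i k) = G i ^ k"
  by (simp add: mon_def)

lemma mon_add: "mon G (m + m') = mon G m * mon G m'"
proof -
  let ?S = "keys m \<union> keys m'"
  have "keys (m + m') \<subseteq> ?S" by (rule Poly_Mapping.keys_add)
  then show ?thesis
    by (simp add: mon_superset[of ?S] lookup_add power_add prod.distrib)
qed

context comm_ring_hom
begin

lemma ev_superset:
  "finite S \<Longrightarrow> keys p \<subseteq> S \<Longrightarrow>
    ev hom G p = (\<Sum>m \<in> S. hom (lookup p m) * mon G m)"
  unfolding ev_def by (rule sum.mono_neutral_left) (auto simp: in_keys_iff)

lemma ev_add: "ev hom G (p + q) = ev hom G p + ev hom G q"
proof -
  let ?S = "keys p \<union> keys q"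
  have "keys (p + q) \<subseteq> ?S" by (rule Poly_Mapping.keys_add)
  then show ?thesis
    by (simp add: ev_superset[of ?S] lookup_add hom_add distrib_right sum.distrib)
qed

lemma ev_single: "ev hom G (single m a) = hom a * mon G m"
  by (subst ev_superset[of "{m}"]) auto

lemma ev_0 [simp]: "ev hom G 0 = 0"
  by (simp add: ev_def)

lemma ev_mult: "ev hom G (p * q) = ev hom G p * ev hom G q"
proof (induction p rule: poly_mapping_induct[OF subset_UNIV])
  case (2 m a)
  show ?case
  proof (induction q rule: poly_mapping_induct[OF subset_UNIV])
    case (2 m' b)
    show ?case by (simp add: mult_single ev_single hom_mult mon_add)
  qed (auto simp: ev_add ring_distribs)
qed (auto simp: ev_add ring_distribs)

lemma ev_const: "ev hom G (mpol_const a) = hom a"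
  by (simp add: mpol_const_def ev_single)

lemma ev_mvar: "ev hom G (mvar i) = G i"
  by (simp add: mvar_def ev_single mon_single)

lemma ev_hom: "comm_ring_hom (ev hom G)"
proof
  show "ev hom G 1 = 1" using ev_const[of G 1] by simp
qed (simp_all add: ev_add ev_mult)

end

lemma mon_closed:
  assumes "1 \<in> A" "\<And>x y. x \<in> A \<Longrightarrow> y \<in> A \<Longrightarrow> x * y \<in> A" "\<And>i. i \<in> keys m \<Longrightarrow> G i \<in> A"
  shows "mon G m \<in> A"
proof -
  have "x ^ k \<in> A" if "x \<in> A" for x k using that by (induction k) (simp_all add: assms(1,2))
  then have 1: "G i ^ lookup m i \<in> A" if "i \<in> keys m" for i
    using that assms(3) by blast
  have "prod f S \<in> A" if "\<And>i. i \<in> S \<Longrightarrow> f i \<in> A" for f :: "nat \<Rightarrow> 'a" and S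
    using that by (induction S rule: infinite_finite_induct) (simp_all add: assms(1,2))
  from this[OF 1] show ?thesis unfolding mon_def .
qed

lemma ev_closed:
  assumes "0 \<in> A" "1 \<in> A" "\<And>x y. x \<in> A \<Longrightarrow> y \<in> A \<Longrightarrow> x + y \<in> A" "\<And>x y. x \<in> A \<Longrightarrow> y \<in> A \<Longrightarrow> x * y \<in> A"
    and "\<And>m. m \<in> keys p \<Longrightarrow> h (lookup p m) \<in> A"
    and "p \<in> mpolys N" "\<And>i. i < N \<Longrightarrow> G i \<in> A"
  shows "ev h G p \<in> A"
proof -
  have 1: "h (lookup p m) * mon G m \<in> A" if "m \<in> keys p" for m
    using that mpolysD[OF assms(6)] by (intro assms(4,5) mon_closed[OF assms(2,4)]) (auto intro: assms(7))
  have "sum f S \<in> A" if "\<And>i. i \<in> S \<Longrightarrow> f i \<in> A" for f :: "(nat \<Rightarrow>\<^sub>0 nat) \<Rightarrow> 'a" and S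
    using that by (induction S rule: infinite_finite_induct) (simp_all add: assms(1,3))
  from this[OF 1] show ?thesis unfolding ev_def .
qed

lemma ev_cong: "p \<in> mpolys N \<Longrightarrow> (\<And>i. i < N \<Longrightarrow> G i = G' i) \<Longrightarrow> ev h G p = ev h G' p"
  unfolding ev_def mon_def
  by (intro sum.cong refl arg_cong2[where f = "(*)"] prod.cong) (auto dest: mpolysD)

text \<open>The laws are assumed on \<open>mpolys N\<close> only, because maps such as the
  retraction onto A are meaningful only there.\<close>

lemma hom_ev_const:
  assumes "p \<in> mpolys N"
    and "\<And>a. \<phi> (mpol_const a) = h a"
    and "\<And>p q. p \<in> mpolys N \<Longrightarrow> q \<in> mpolys N \<Longrightarrow> \<phi> (p + q) = \<phi> p + \<phi> q"
    and "\<And>p q. p \<in> mpolys N \<Longrightarrow> q \<in> mpolys N \<Longrightarrow> \<phi> (p * q) = \<phi> p * \<phi> q"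
    and "comm_ring_hom h"
  shows "\<phi> p = ev h (\<lambda>i. \<phi> (mvar i)) p"
proof -
  interpret comm_ring_hom h by fact
  show ?thesis
    using assms(1)
    by (induction p rule: mpolys_ring_induct)
      (simp_all only: assms(2-4) ev_const ev_mvar ev_add ev_mult)
qed

subsection \<open>Partial derivatives\<close>

text \<open>Read off coefficient by coefficient, the derivative involves no subtraction of
  exponents; linearity and the symmetry of second derivatives become evident.\<close>

lemma lookup_pderivative:
  "lookup (pderivative i p) m =
    of_nat (Suc (lookup m i)) * lookup p (m + single i 1)"
proof -
  have eq: "lookup (single (x - single i 1)
        (of_nat (lookup x i) * lookup p x)) m =
      (if x = m + single i 1 then of_nat (Suc (lookup m i)) *
        lookup p (m + single i 1) else 0)" for x
  proof (cases "lookup x i = 0")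
    case True
    then have "x \<noteq> m + single i 1"
      by (auto simp: lookup_add)
    then show ?thesis using True by simp
  next
    case False
    then have "x = (x - single i 1) + single i 1"
      by (intro poly_mapping_eqI) (auto simp: lookup_add lookup_minus lookup_single when_def)
    then have "x - single i 1 = m \<longleftrightarrow> x = m + single i 1"
      by (metis add_diff_cancel_right')
    then show ?thesis by (auto simp: lookup_single when_def lookup_add)
  qed
  show ?thesis
    unfolding pderivative_def lookup_sum eq
    by (simp add: sum.delta in_keys_iff)
qed

lemma pderivative_add: "pderivative i (p + q) = pderivative i p + pderivative i q"
  by (rule poly_mapping_eqI) (simp add: lookup_pderivative lookup_add distrib_left)

lemma pderivative_0 [simp]: "pderivative i 0 = 0"
  by (simp add: pderivative_def)

lemma pderivative_diff: "pderivative i (p - q) = pderivative i p - pderivative i q"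
  by (rule poly_mapping_eqI) (simp add: lookup_pderivative lookup_minus right_diff_distrib)

lemma pderivative_single:
  "pderivative i (single m a) =
    single (m - single i 1) (of_nat (lookup m i) * a)"
  by (simp add: pderivative_def)

lemma pderivative_const [simp]: "pderivative i (mpol_const a) = 0"
  by (simp add: mpol_const_def pderivative_single)

lemma pderivative_mvar: "pderivative i (mvar k) = (if i = k then 1 else 0)"
  by (simp add: mvar_def pderivative_single lookup_single when_def)

lemma pderivative_mult: "pderivative i (p * q) = p * pderivative i q + q * pderivative i p"
proof (induction p rule: poly_mapping_induct[OF subset_UNIV])
  case (2 m a)
  show ?case
  proof (induction q rule: poly_mapping_induct[OF subset_UNIV])
    case (2 m' b)
    let ?e = "single i 1 :: nat \<Rightarrow>\<^sub>0 nat"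
    \<comment> \<open>Truncated subtraction is exact where the exponent of \<open>i\<close> is
      positive; where it is zero, the factor \<open>of_nat 0\<close> kills the term.\<close>
    have shift: "x + y - ?e = x + (y - ?e)" if "lookup y i \<noteq> 0" for x y :: "nat \<Rightarrow>\<^sub>0 nat"
      using that
      by (intro poly_mapping_eqI) (auto simp: lookup_add lookup_minus lookup_single when_def)
    have A: "single (m + m' - ?e) (of_nat (lookup m' i) * (a * b)) =
        single m a * single (m' - ?e) (of_nat (lookup m' i) * b)"
      by (cases "lookup m' i = 0") (auto simp: mult_single shift mult_ac simp del: One_nat_def)
    have B: "single (m + m' - ?e) (of_nat (lookup m i) * (a * b)) =
        single m' b * single (m - ?e) (of_nat (lookup m i) * a)"
      using shift[of m m']
      by (cases "lookup m i = 0") (auto simp: mult_single add.commute mult_ac simp del: One_nat_def)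
    have "pderivative i (single m a * single m' b) =
        single (m + m' - ?e) (of_nat (lookup m' i) * (a * b)) +
        single (m + m' - ?e) (of_nat (lookup m i) * (a * b))"
      by (simp add: mult_single pderivative_single lookup_add single_add[symmetric] distrib_right add.commute)
    then show ?case by (simp only: A B pderivative_single)
  qed (auto simp: pderivative_add ring_distribs)
qed (auto simp: pderivative_add ring_distribs)

lemma pderivative_const_mult: "pderivative i (mpol_const a * p) = mpol_const a * pderivative i p"
  by (simp add: pderivative_mult)

lemma pderivative_commute: "pderivative i (pderivative j p) = pderivative j (pderivative i p)"
proof (rule poly_mapping_eqI)
  fix m
  show "lookup (pderivative i (pderivative j p)) m =
      lookup (pderivative j (pderivative i p)) m"
    by (cases "i = j") (simp_all add: lookup_pderivative lookup_add lookup_single add_ac mult_ac)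
qed

lemma mpolys_pderivative: "p \<in> mpolys N \<Longrightarrow> pderivative i p \<in> mpolys N"
proof (rule mpolysI)
  fix m
  assume p: "p \<in> mpolys N" and "lookup (pderivative i p) m \<noteq> 0"
  then have "m + single i 1 \<in> keys p"
    by (auto simp: lookup_pderivative in_keys_iff)
  then have "keys (m + single i 1) \<subseteq> {..<N}"
    using p by (auto simp: mpolys_def)
  moreover have "keys m \<subseteq> keys (m + single i 1)"
    by (auto simp: in_keys_iff lookup_add)
  ultimately show "keys m \<subseteq> {..<N}" by blast
qed

text \<open>Both sides are derivations along \<open>\<phi>\<close> that agree on the variables. In
  the applications \<open>\<phi>\<close> is the identity, the retraction onto A or a
  substitution.\<close>

lemma derivation_chain_rule:
  assumes p: "p \<in> mpolys N"
    and \<phi>: "\<phi> 0 = 0" "\<phi> 1 = 1" "\<And>p q. p \<in> mpolys N \<Longrightarrow> q \<in> mpolys N \<Longrightarrow> \<phi> (p + q) = \<phi> p + \<phi> q"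
      "\<And>p q. p \<in> mpolys N \<Longrightarrow> q \<in> mpolys N \<Longrightarrow> \<phi> (p * q) = \<phi> p * \<phi> q"
    and d: "\<And>a. d (mpol_const a) = 0"
      "\<And>p q. p \<in> mpolys N \<Longrightarrow> q \<in> mpolys N \<Longrightarrow> d (p + q) = d p + d q"
      "\<And>p q. p \<in> mpolys N \<Longrightarrow> q \<in> mpolys N \<Longrightarrow> d (p * q) = \<phi> p * d q + \<phi> q * (d p :: 'b::comm_ring_1)"
  shows "d p = (\<Sum>k<N. \<phi> (pderivative k p) * d (mvar k))"
  using p
proof (induction p rule: mpolys_ring_induct)
  case (const a)
  then show ?case by (simp add: d \<phi>)
next
  case (var i)
  have "(\<Sum>k<N. \<phi> (pderivative k (mvar i)) * d (mvar k)) = (\<Sum>k<N. if k = i then d (mvar k) else 0)"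
    by (rule sum.cong) (auto simp: pderivative_mvar \<phi>)
  then show ?case using var by simp
next
  case (add p q)
  then show ?case
    by (simp add: d \<phi> pderivative_add mpolys_pderivative distrib_right sum.distrib)
next
  case (mult p q)
  have "(\<Sum>k<N. \<phi> (pderivative k (p * q)) * d (mvar k)) =
      (\<Sum>k<N. \<phi> p * (\<phi> (pderivative k q) * d (mvar k)) + \<phi> q * (\<phi> (pderivative k p) * d (mvar k)))"
    using mult.hyps
    by (intro sum.cong) (simp_all add: pderivative_mult \<phi> mpolys_mult mpolys_pderivative algebra_simps)
  then show ?case using mult
    by (simp add: d sum.distrib sum_distrib_left)
qed

section \<open>Ideals of the base ring\<close>

text \<open>Ideals as subsets of a type, so that one notion serves R and its polynomial rings;
  \<open>ideal_class_ring_iff\<close> links it to ring records.\<close>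

definition cideal :: "'a::comm_ring_1 set \<Rightarrow> bool" where
  "cideal I \<longleftrightarrow> 0 \<in> I \<and> (\<forall>x\<in>I. \<forall>y\<in>I. x + y \<in> I) \<and> (\<forall>r. \<forall>x\<in>I. r * x \<in> I)"

definition cprime :: "'a::comm_ring_1 set \<Rightarrow> bool" where
  "cprime P \<longleftrightarrow> cideal P \<and> 1 \<notin> P \<and> (\<forall>a b. a * b \<in> P \<longrightarrow> a \<in> P \<or> b \<in> P)"

lemma cideal_0: "cideal I \<Longrightarrow> 0 \<in> I"
  and cideal_add: "cideal I \<Longrightarrow> x \<in> I \<Longrightarrow> y \<in> I \<Longrightarrow> x + y \<in> I"
  and cideal_mult: "cideal I \<Longrightarrow> x \<in> I \<Longrightarrow> r * x \<in> I"
  by (auto simp: cideal_def)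

lemma cideal_mult2: "cideal I \<Longrightarrow> x \<in> I \<Longrightarrow> x * r \<in> I"
  using cideal_mult[of I x r] by (simp add: mult.commute)

lemma cideal_uminus: "cideal I \<Longrightarrow> x \<in> I \<Longrightarrow> - x \<in> I"
  using cideal_mult[of I x "-1"] by simp

lemma cideal_diff: "cideal I \<Longrightarrow> x \<in> I \<Longrightarrow> y \<in> I \<Longrightarrow> x - y \<in> I"
  using cideal_add[OF _ _ cideal_uminus] by fastforce

lemma cideal_sum: "cideal I \<Longrightarrow> (\<And>i. i \<in> S \<Longrightarrow> f i \<in> I) \<Longrightarrow> sum f S \<in> I"
  by (induction S rule: infinite_finite_induct) (auto intro: cideal_add cideal_0)

lemma cideal_zero: "cideal {0}"
  by (auto simp: cideal_def)

lemma cprimeD: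
  assumes "cprime P"
  shows "cideal P" "1 \<notin> P" "a * b \<in> P \<Longrightarrow> a \<in> P \<or> b \<in> P"
  using assms unfolding cprime_def by blast+

lemma cprime_mult: "cprime P \<Longrightarrow> a \<notin> P \<Longrightarrow> b \<notin> P \<Longrightarrow> a * b \<notin> P"
  using cprimeD(3) by blast

lemma cprime_prod: "cprime P \<Longrightarrow> (\<And>i. i \<in> S \<Longrightarrow> f i \<notin> P) \<Longrightarrow> prod f S \<notin> P"
  by (induction S rule: infinite_finite_induct) (simp_all add: cprimeD(2) cprime_mult)

lemma cideal_unit: "cideal I \<Longrightarrow> u * v = 1 \<Longrightarrow> u * x \<in> I \<Longrightarrow> x \<in> I"
  using cideal_mult[of I "u * x" v] by (simp add: mult_ac flip: mult.assoc)

lemma cring_class_ring: "cring (class_ring :: 'a::comm_ring_1 ring)"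
proof (rule cringI)
  show "abelian_group (class_ring :: 'a ring)"
    by (rule abelian_groupI) (auto intro: exI[of _ "- x" for x] simp: add_ac)
  show "comm_monoid (class_ring :: 'a ring)"
    by (rule comm_monoidI) (auto simp: mult_ac)
qed (auto simp: distrib_right)

lemma ideal_class_ring_iff: "ideal I (class_ring :: 'a::comm_ring_1 ring) \<longleftrightarrow> cideal I"
proof
  have ab: "abelian_group (class_ring :: 'a ring)" and rg: "Ring.ring (class_ring :: 'a ring)"
    using cring_class_ring cring.axioms(1) Ring.ring.axioms(1) by blast+
  show "cideal I" if "ideal I (class_ring :: 'a ring)"
    using ideal.I_l_closed[OF that] additive_subgroup.zero_closed[OF ideal.axioms(1)[OF that]]
      additive_subgroup.a_closed[OF ideal.axioms(1)[OF that]]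
    by (auto simp: cideal_def)
  assume I: "cideal I"
  show "ideal I (class_ring :: 'a ring)"
  proof (rule idealI)
    show "subgroup I (add_monoid (class_ring :: 'a ring))"
    proof (rule group.subgroupI[OF abelian_group.a_group[OF ab]])
      show "inv\<^bsub>add_monoid (class_ring :: 'a ring)\<^esub> a \<in> I" if "a \<in> I" for a
      proof -
        have "inv\<^bsub>add_monoid (class_ring :: 'a ring)\<^esub> a = - a"
          using abelian_group.minus_equality[OF ab, of "- a" a] by (simp add: a_inv_def)
        then show ?thesis using cideal_uminus[OF I that] by simp
      qed
    qed (use I in \<open>auto simp: cideal_def\<close>)
  qed (use I rg in \<open>auto intro: cideal_mult cideal_mult2\<close>)
qed

lemma primeideal_class_ring_iff: "primeideal P (class_ring :: 'a::comm_ring_1 ring) \<longleftrightarrow> cprime P"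
proof
  assume "primeideal P (class_ring :: 'a ring)"
  then interpret primeideal P "class_ring :: 'a ring" .
  have I: "cideal P" using is_ideal by (simp add: ideal_class_ring_iff)
  have "1 \<notin> P"
  proof
    assume "1 \<in> P"
    then have "P = UNIV" using cideal_mult[OF I, of 1] by auto
    then show False using I_notcarr by simp
  qed
  then show "cprime P" using I I_prime by (auto simp: cprime_def)
next
  assume P: "cprime P"
  then show "primeideal P (class_ring :: 'a ring)"
    by (intro primeidealI) (auto simp: ideal_class_ring_iff cring_class_ring cprime_def)
qed

section \<open>Noetherian induction over ideals\<close>

definition iadjoin :: "'a::comm_ring_1 set \<Rightarrow> 'a \<Rightarrow> 'a set" where
  "iadjoin I a = {x + r * a | x r. x \<in> I}"

text \<open>The colon ideal (I : a).\<close>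

definition iquot :: "'a::comm_ring_1 set \<Rightarrow> 'a \<Rightarrow> 'a set" where
  "iquot I a = {r. a * r \<in> I}"

lemma cideal_iadjoin: "cideal I \<Longrightarrow> cideal (iadjoin I a)"
proof -
  assume I: "cideal I"
  have "0 + 0 * a \<in> iadjoin I a" using cideal_0[OF I] unfolding iadjoin_def by blast
  moreover have "(x + r * a) + (y + s * a) \<in> iadjoin I a" if "x \<in> I" "y \<in> I" for x y r s
    unfolding iadjoin_def mem_Collect_eq using cideal_add[OF I that]
    by (intro exI[of _ "x + y"] exI[of _ "r + s"]) (simp add: algebra_simps)
  moreover have "t * (x + r * a) \<in> iadjoin I a" if "x \<in> I" for x r t
    unfolding iadjoin_def mem_Collect_eq using cideal_mult[OF I that, of t]
    by (intro exI[of _ "t * x"] exI[of _ "t * r"]) (simp add: algebra_simps)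
  ultimately show ?thesis unfolding cideal_def iadjoin_def by fastforce
qed

lemma cideal_iquot: "cideal I \<Longrightarrow> cideal (iquot I a)"
  by (auto simp: cideal_def iquot_def distrib_left mult.left_commute)

lemma iadjoin_subset: "I \<subseteq> iadjoin I a"
proof
  fix x assume "x \<in> I"
  then have "x + 0 * a \<in> iadjoin I a" unfolding iadjoin_def by blast
  then show "x \<in> iadjoin I a" by simp
qed

lemma iadjoin_supset: "cideal I \<Longrightarrow> a \<notin> I \<Longrightarrow> I \<subset> iadjoin I a"
proof -
  assume I: "cideal I" and a: "a \<notin> I"
  have "0 + 1 * a \<in> iadjoin I a"
    using cideal_0[OF I] unfolding iadjoin_def by blast
  then show ?thesis using a iadjoin_subset[of I a] by auto
qed

text \<open>A maximal counterexample M is proper and not prime, say ab lies in M with a and b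
  outside. Then M + (a) contains a and (M : a) contains b, so both are strictly larger than M and
  \<open>step\<close> applies.\<close>

lemma noetherian_ideal_induct [consumes 2, case_names unit prime step]:
  fixes I :: "'a::comm_ring_1 set"
  assumes noeth: "noetherian_ring (class_ring :: 'a ring)" and I: "cideal I"
    and unit: "S UNIV"
    and prime: "\<And>P. cprime P \<Longrightarrow> (\<And>J. cideal J \<Longrightarrow> P \<subset> J \<Longrightarrow> S J) \<Longrightarrow> S P"
    and step: "\<And>I a. cideal I \<Longrightarrow> S (iadjoin I a) \<Longrightarrow> S (iquot I a) \<Longrightarrow> S I"
  shows "S I"
proof (rule ccontr)
  assume "\<not> S I"
  let ?Bad = "{I. cideal I \<and> \<not> S I}"
  have "\<exists>M\<in>?Bad. \<forall>X\<in>?Bad. M \<subseteq> X \<longrightarrow> X = M"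
  proof (rule subset_Zorn_nonempty)
    show "?Bad \<noteq> {}" using I \<open>\<not> S I\<close> by blast
    fix C assume C: "C \<noteq> {}" "subset.chain ?Bad C"
    \<comment> \<open>By the ascending chain condition the chain contains its union, which is
      therefore again a counterexample.\<close>
    then have "subset.chain {I. ideal I (class_ring :: 'a ring)} C"
      by (auto simp: subset_chain_def ideal_class_ring_iff)
    from noetherian_ring.ideal_chain_is_trivial[OF noeth C(1) this]
    show "\<Union>C \<in> ?Bad" using C(2) by (auto simp: subset_chain_def)
  qed
  then obtain M where M: "cideal M" "\<not> S M" and max: "\<And>J. cideal J \<Longrightarrow> M \<subset> J \<Longrightarrow> S J"
    by blast
  have "\<not> cprime M" using prime max M by blast
  moreover have "1 \<notin> M"
  proof
    assume "1 \<in> M"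
    then have "M = UNIV" using cideal_mult[OF M(1), of 1] by auto
    then show False using M unit by simp
  qed
  ultimately obtain a b where ab: "a * b \<in> M" "a \<notin> M" "b \<notin> M"
    using M(1) by (auto simp: cprime_def)
  have "b \<in> iquot M a" using ab by (simp add: iquot_def)
  moreover have "M \<subseteq> iquot M a" using cideal_mult[OF M(1)] by (auto simp: iquot_def)
  ultimately have "M \<subset> iquot M a" using ab(3) by blast
  then have "S (iquot M a)" using max cideal_iquot[OF M(1)] by blast
  moreover have "S (iadjoin M a)"
    using max cideal_iadjoin[OF M(1)] iadjoin_supset[OF M(1) ab(2)] by blast
  ultimately show False using step[OF M(1)] M(2) by blast
qed

text \<open>The intersection of a chain of primes is prime. Zorn's lemma yields maximal elements, so
  it is applied to the complements of the primes below \<open>P\<close>.\<close>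

lemma minimal_prime_exists:
  assumes P: "cprime (P :: 'a::comm_ring_1 set)"
  obtains Q where "minimal_prime class_ring Q" "cprime Q" "Q \<subseteq> P"
proof -
  let ?A = "uminus ` {Q. cprime Q \<and> Q \<subseteq> P}"
  have "\<exists>M\<in>?A. \<forall>X\<in>?A. M \<subseteq> X \<longrightarrow> X = M"
  proof (rule subset_Zorn_nonempty)
    show "?A \<noteq> {}" using P by blast
    fix C assume C: "C \<noteq> {}" "subset.chain ?A C"
    define D where "D = uminus ` C"
    have D: "\<And>Q. Q \<in> D \<Longrightarrow> cprime Q \<and> Q \<subseteq> P" "D \<noteq> {}"
      using C by (auto simp: D_def subset_chain_def)
    have total: "Q \<subseteq> Q' \<or> Q' \<subseteq> Q" if "Q \<in> D" "Q' \<in> D" for Q Q'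
    proof -
      have Q: "- Q \<in> C" "- Q' \<in> C" using that by (auto simp: D_def)
      have "\<forall>X\<in>C. \<forall>Y\<in>C. X \<subseteq> Y \<or> Y \<subseteq> X" using C(2) by (simp add: subset_chain_def)
      from bspec[OF bspec[OF this Q(1)] Q(2)] show ?thesis by auto
    qed
    have "cideal (\<Inter>D)"
      using D cprimeD(1) unfolding cideal_def by blast
    moreover have "1 \<notin> \<Inter>D" using D cprimeD(2) by blast
    moreover have "a \<in> \<Inter>D \<or> b \<in> \<Inter>D" if ab: "a * b \<in> \<Inter>D" for a b
    proof (rule ccontr)
      assume "\<not> ?thesis"
      then obtain Q Q' where "Q \<in> D" "Q' \<in> D" "a \<notin> Q" "b \<notin> Q'" by blast
      then show False using total[of Q Q'] ab cprimeD(3) D(1) by blast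
    qed
    ultimately have "cprime (\<Inter>D)" unfolding cprime_def by blast
    moreover have "\<Inter>D \<subseteq> P" using D by blast
    moreover have "\<Union>C = - \<Inter>D" unfolding D_def by auto
    ultimately show "\<Union>C \<in> ?A" by blast
  qed
  then obtain Q where Q: "cprime Q" "Q \<subseteq> P"
    and "\<forall>X\<in>?A. - Q \<subseteq> X \<longrightarrow> X = - Q" by blast
  then have min: "Q' = Q" if "cprime Q'" "Q' \<subseteq> Q" for Q'
    using that by (auto simp: image_iff)
  then have "minimal_prime class_ring Q"
    using Q(1) by (auto simp: minimal_prime_def primeideal_class_ring_iff)
  with Q show ?thesis using that by blast
qed

subsection \<open>Polynomials with coefficients in an ideal\<close>

text \<open>The extension of I to the polynomial ring; a congruence modulo it stands for an equation
  over R/I.\<close>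

definition coeffs_in :: "'a::comm_ring_1 set \<Rightarrow> 'a mpol set" where
  "coeffs_in I = {p. \<forall>m. lookup p m \<in> I}"

lemma coeffs_inD: "p \<in> coeffs_in I \<Longrightarrow> lookup p m \<in> I"
  by (simp add: coeffs_in_def)

lemma lookup_mult_sum:
  "lookup (f * g) k =
    (\<Sum>(a, b) \<in> keys f \<times> keys g.
      if a + b = k then lookup f a * lookup g b else 0)"
proof -
  have "f * g = (\<Sum>a\<in>keys f. \<Sum>b\<in>keys g.
      single (a + b) (lookup f a * lookup g b))"
    by (subst poly_mapping_eq_sum_single[of f], subst poly_mapping_eq_sum_single[of g])
      (simp add: sum_product mult_single)
  then show ?thesis
    by (simp add: sum.cartesian_product lookup_sum lookup_single when_def split_def)
qed

lemma cideal_coeffs_in: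
  assumes I: "cideal I"
  shows "cideal (coeffs_in I)"
proof -
  have "lookup (r * p) m \<in> I" if "p \<in> coeffs_in I" for r p m
    unfolding lookup_mult_sum
    by (rule cideal_sum[OF I])
      (auto simp: cideal_0[OF I] intro: cideal_mult[OF I coeffs_inD[OF that]])
  then show ?thesis
    using I by (auto simp: cideal_def coeffs_in_def lookup_add)
qed

lemma coeffs_in_mono: "I \<subseteq> J \<Longrightarrow> coeffs_in I \<subseteq> coeffs_in J"
  by (auto simp: coeffs_in_def)

lemma coeffs_in_UNIV [simp]: "coeffs_in UNIV = UNIV"
  by (auto simp: coeffs_in_def)

lemma coeffs_in_zero [simp]: "coeffs_in {0} = {0}"
  by (auto simp: coeffs_in_def intro: poly_mapping_eqI)

lemma const_mem_coeffs_in: "cideal I \<Longrightarrow> mpol_const a \<in> coeffs_in I \<longleftrightarrow> a \<in> I"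
  by (auto simp: coeffs_in_def lookup_const cideal_0 split: if_splits)

text \<open>Dividing by the constant \<open>a\<close> modulo I replaces I by the colon ideal, which
  is how the second hypothesis of the Noetherian induction step comes into play.\<close>

lemma const_mult_mem_coeffs_in: "mpol_const a * p \<in> coeffs_in I \<longleftrightarrow> p \<in> coeffs_in (iquot I a)"
  by (simp add: coeffs_in_def lookup_const_mult iquot_def)

lemma const_mult_mem_coeffs_in_prime:
  "cprime P \<Longrightarrow> a \<notin> P \<Longrightarrow> mpol_const a * p \<in> coeffs_in P \<Longrightarrow> p \<in> coeffs_in P"
  using cprimeD(3) by (fastforce simp: coeffs_in_def lookup_const_mult)

lemma pderivative_coeffs_in: "cideal I \<Longrightarrow> p \<in> coeffs_in I \<Longrightarrow> pderivative i p \<in> coeffs_in I"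
  by (auto simp: coeffs_in_def lookup_pderivative intro: cideal_mult)

lemma coeffs_in_ev:
  assumes "cideal I" "p \<in> coeffs_in I"
  shows "ev mpol_const G p \<in> coeffs_in I"
  unfolding ev_def using assms
  by (intro cideal_sum cideal_mult2 cideal_coeffs_in) (auto simp: const_mem_coeffs_in coeffs_inD)

text \<open>The decomposition is chosen coefficient by coefficient. Restricting \<open>r\<close> to
  the exponents of \<open>p\<close> keeps both parts polynomials in the same variables.\<close>

lemma coeffs_in_iadjoin:
  assumes I: "cideal I" and p: "p \<in> coeffs_in (iadjoin I a)" "p \<in> mpolys N"
  obtains q r where "q \<in> coeffs_in I" "q \<in> mpolys N" "r \<in> mpolys N" "p = q + mpol_const a * r"
proof -
  have "\<forall>m. \<exists>s. lookup p m - a * s \<in> I"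
  proof
    fix m
    obtain x s where "x \<in> I" "lookup p m = x + s * a"
      using coeffs_inD[OF p(1), of m] by (auto simp: iadjoin_def)
    then show "\<exists>s. lookup p m - a * s \<in> I"
      by (auto simp: mult.commute intro!: exI[of _ s])
  qed
  then obtain s where s: "\<And>m. lookup p m - a * s m \<in> I" by metis
  define r where "r = (\<Sum>m\<in>keys p. single m (s m))"
  have r: "r \<in> mpolys N" unfolding r_def using p(2)
    by (intro mpolys_sum mpolys_single) (auto dest: mpolysD)
  have lr: "lookup r m = (if m \<in> keys p then s m else 0)" for m
    by (simp add: r_def lookup_sum lookup_single when_def)
  have "lookup (p - mpol_const a * r) m \<in> I" for m
    using s[of m] by (auto simp: lookup_minus lookup_const_mult lr in_keys_iff cideal_0[OF I])
  then have "p - mpol_const a * r \<in> coeffs_in I" by (simp add: coeffs_in_def)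
  moreover have "p - mpol_const a * r \<in> mpolys N" using p(2) r by (intro mpolys_closed)
  ultimately show ?thesis using that[OF _ _ r] by simp
qed

text \<open>The leading coefficients for the order that compares the exponents of the variable \<open>i\<close> first
  multiply to the leading coefficient of the product, modulo \<open>P\<close>.\<close>

lemma degree_mod_prime_le:
  fixes f g :: "'a::comm_ring_1 mpol"
  assumes P: "cprime P" and f: "f \<notin> coeffs_in P"
    and bound: "\<And>m. lookup (g * f) m \<notin> P \<Longrightarrow> lookup m i < d"
    and m: "lookup g m \<notin> P"
  shows "lookup m i < d"
proof -
  note id = cprimeD(1)[OF P]
  have lead: "\<exists>x. lookup p x \<notin> P \<and>
      (\<forall>y. lookup p y \<notin> P \<longrightarrow> lookup y i < lookup x i \<or>
        (lookup y i = lookup x i \<and> y \<le> x))"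
    if "lookup p z \<notin> P" for p :: "'a mpol" and z
  proof -
    define S where "S = {y. lookup p y \<notin> P}"
    have "S \<subseteq> keys p" using cideal_0[OF id] unfolding S_def by (auto simp: in_keys_iff)
    then have fin: "finite S" using finite_keys by (rule finite_subset)
    have "z \<in> S" using that unfolding S_def by simp
    then have ne: "S \<noteq> {}" by blast
    define M where "M = Max ((\<lambda>y. lookup y i) ` S)"
    define S' where "S' = {y \<in> S. lookup y i = M}"
    have "M \<in> (\<lambda>y. lookup y i) ` S" unfolding M_def using fin ne by (intro Max_in) auto
    then have "S' \<noteq> {}" by (auto simp: S'_def)
    moreover have fin': "finite S'" using fin by (simp add: S'_def)
    ultimately have "Max S' \<in> S'" by (rule Max_in[rotated])
    moreover have "lookup y i \<le> M" if "y \<in> S" for y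
      unfolding M_def using that fin by (intro Max_ge) auto
    moreover have "y \<le> Max S'" if "y \<in> S'" for y using fin' that by (rule Max_ge)
    ultimately show ?thesis by (intro exI[of _ "Max S'"]) (auto simp: S'_def S_def order_less_le)
  qed
  obtain x where x: "lookup g x \<notin> P"
    "\<And>y. lookup g y \<notin> P \<Longrightarrow> lookup y i < lookup x i \<or>
        (lookup y i = lookup x i \<and> y \<le> x)"
    using lead[OF m] by blast
  obtain w where "lookup f w \<notin> P" using f by (auto simp: coeffs_in_def)
  from lead[OF this] obtain z where z: "lookup f z \<notin> P"
    "\<And>y. lookup f y \<notin> P \<Longrightarrow> lookup y i < lookup z i \<or>
        (lookup y i = lookup z i \<and> y \<le> z)"
    by blast
  let ?h = "\<lambda>(a, b). if a + b = x + z then lookup g a * lookup f b else 0"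
  have rest: "?h ab \<in> P" if ab: "ab \<noteq> (x, z)" for ab
  proof (rule ccontr)
    assume h: "?h ab \<notin> P"
    obtain a b where [simp]: "ab = (a, b)" by fastforce
    have sum: "a + b = x + z" and "lookup g a * lookup f b \<notin> P"
      using h cideal_0[OF id] by (auto split: if_splits)
    then have "lookup g a \<notin> P" "lookup f b \<notin> P"
      using cideal_mult[OF id] cideal_mult2[OF id] by blast+
    from x(2)[OF this(1)] z(2)[OF this(2)]
    have le: "lookup a i < lookup x i \<or>
        (lookup a i = lookup x i \<and> a \<le> x)"
      "lookup b i < lookup z i \<or>
        (lookup b i = lookup z i \<and> b \<le> z)" .
    \<comment> \<open>Neither exponent of \<open>i\<close> exceeds its maximum and the sums agree,
      so both maxima are attained and the monomial order decides; it is strictly compatible with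
      addition.\<close>
    have "lookup a i + lookup b i = lookup x i + lookup z i"
      using sum by (metis lookup_add)
    with le have "a \<le> x" "b \<le> z" by auto
    then have "a = x \<and> b = z" using sum
      using add_less_le_mono[of a x b z] add_le_less_mono[of a x b z] by (auto simp: order_le_less)
    then show False using ab by simp
  qed
  have keys: "x \<in> keys g" "z \<in> keys f"
    using x(1) z(1) cideal_0[OF id] by (auto simp: in_keys_iff)
  have "lookup (g * f) (x + z) = ?h (x, z) +
      (\<Sum>ab \<in> keys g \<times> keys f - {(x, z)}. ?h ab)"
    unfolding lookup_mult_sum using keys by (intro sum.remove) auto
  moreover have "(\<Sum>ab \<in> keys g \<times> keys f - {(x, z)}. ?h ab) \<in> P"
    by (rule cideal_sum[OF id]) (use rest in blast)
  moreover have "?h (x, z) \<notin> P" using cprime_mult[OF P x(1) z(1)] by simp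
  ultimately have "lookup (g * f) (x + z) \<notin> P"
    using cideal_diff[OF id, of "?h (x, z) + (\<Sum>ab \<in> keys g \<times> keys f - {(x, z)}. ?h ab)"
      "\<Sum>ab \<in> keys g \<times> keys f - {(x, z)}. ?h ab"]
    by (simp only: add_diff_cancel_right') blast
  from bound[OF this] have "lookup x i < d" by (simp add: lookup_add)
  then show ?thesis using x(2)[OF m] by auto
qed

lemma cprime_coeffs_in:
  assumes P: "cprime P"
  shows "cprime (coeffs_in P)"
proof -
  \<comment> \<open>With the bound 0 the degree estimate has a vacuous premise and says that
    \<open>g\<close> has no coefficient outside \<open>P\<close>, whichever variable is
    chosen.\<close>
  have "g \<in> coeffs_in P" if "g * f \<in> coeffs_in P" "f \<notin> coeffs_in P" for f g
    using degree_mod_prime_le[OF P that(2), of g undefined 0] that(1)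
    by (auto simp: coeffs_in_def)
  then show ?thesis
    using P cideal_coeffs_in[of P] const_mem_coeffs_in[of P 1]
    by (auto simp: cprime_def)
qed

section \<open>Determinants\<close>

lemma det_cong_ideal:
  fixes A B :: "'a::comm_ring_1 mat"
  assumes I: "cideal I" and A: "A \<in> carrier_mat n n" and B: "B \<in> carrier_mat n n"
    and AB: "\<And>i j. i < n \<Longrightarrow> j < n \<Longrightarrow> A $$ (i, j) - B $$ (i, j) \<in> I"
  shows "det A - det B \<in> I"
proof -
  have prod: "prod f S - prod g S \<in> I" if "finite S" "\<And>i. i \<in> S \<Longrightarrow> f i - g i \<in> I"
    for f g :: "nat \<Rightarrow> 'a" and S
    using that
  proof (induction S)
    case empty
    then show ?case by (simp add: cideal_0[OF I])
  next
    case (insert x S)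
    have "f x * prod f S - g x * prod g S = f x * (prod f S - prod g S) + (f x - g x) * prod g S"
      by (simp add: algebra_simps)
    moreover have "f x * (prod f S - prod g S) + (f x - g x) * prod g S \<in> I"
      using insert by (intro cideal_add[OF I] cideal_mult[OF I] cideal_mult2[OF I]) auto
    ultimately show ?case using insert.hyps by simp
  qed
  have "det A - det B = (\<Sum>p | p permutes {0..<n}. signof p *
      ((\<Prod>i = 0..<n. A $$ (i, p i)) - (\<Prod>i = 0..<n. B $$ (i, p i))))"
    by (simp add: det_def'[OF A] det_def'[OF B] sum_subtractf right_diff_distrib)
  moreover have "\<dots> \<in> I"
  proof (intro cideal_sum[OF I] cideal_mult[OF I] prod)
    fix p i assume "p \<in> {p. p permutes {0..<n}}" "i \<in> {0..<n}"
    then have "i < n" "p i < n" using permutes_in_image[of p "{0..<n}" i] by auto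
    then show "A $$ (i, p i) - B $$ (i, p i) \<in> I" by (rule AB)
  qed simp
  ultimately show ?thesis by simp
qed

lemma det_closed:
  fixes M :: "'a::comm_ring_1 mat"
  assumes S: "0 \<in> S" "1 \<in> S" "\<And>x y. x \<in> S \<Longrightarrow> y \<in> S \<Longrightarrow> x + y \<in> S"
      "\<And>x y. x \<in> S \<Longrightarrow> y \<in> S \<Longrightarrow> x * y \<in> S" "\<And>x. x \<in> S \<Longrightarrow> - x \<in> S"
    and M: "M \<in> carrier_mat n n" "\<And>i j. i < n \<Longrightarrow> j < n \<Longrightarrow> M $$ (i, j) \<in> S"
  shows "det M \<in> S"
proof -
  have prod: "prod f T \<in> S" if "\<And>i. i \<in> T \<Longrightarrow> f i \<in> S" for f :: "nat \<Rightarrow> 'a" and T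
    using that by (induction T rule: infinite_finite_induct) (simp_all add: S(2,4))
  have sum: "sum f T \<in> S" if "\<And>i. i \<in> T \<Longrightarrow> f i \<in> S" for f :: "(nat \<Rightarrow> nat) \<Rightarrow> 'a" and T
    using that by (induction T rule: infinite_finite_induct) (simp_all add: S(1,3))
  have sgn: "signof p \<in> S" for p :: "nat \<Rightarrow> nat"
    using S(2) S(5)[OF S(2)] by (simp add: sign_def)
  show ?thesis
    unfolding det_def'[OF M(1)]
  proof (intro sum S(4) prod sgn)
    fix p i assume "p \<in> {p. p permutes {0..<n}}" "i \<in> {0..<n}"
    then have "i < n" "p i < n" using permutes_in_image[of p "{0..<n}" i] by auto
    then show "M $$ (i, p i) \<in> S" by (rule M(2))
  qed
qed

text \<open>Multiplying by the adjugate shows that \<open>det A\<close> times \<open>B\<close> is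
  the adjugate of \<open>A\<close>, which commutes with \<open>A\<close>; the factor
  \<open>det A\<close> is then cancelled, being a unit with inverse \<open>det B\<close>.\<close>

lemma mat_left_inverse_comm_ring:
  fixes A B :: "'a::comm_ring_1 mat"
  assumes A: "A \<in> carrier_mat n n" and B: "B \<in> carrier_mat n n" and AB: "A * B = 1\<^sub>m n"
  shows "B * A = 1\<^sub>m n"
proof -
  have d: "det B * det A = 1"
    using det_mult[OF A B] AB by (simp add: mult.commute)
  note adj = adj_mat[OF A]
  have "det A \<cdot>\<^sub>m B = (adj_mat A * A) * B"
    using B by (simp add: adj(3) mult_smult_assoc_mat[OF one_carrier_mat B])
  also have "\<dots> = adj_mat A"
    using assoc_mult_mat[OF adj(1) A B] adj(1) by (simp add: AB)
  finally have "det A \<cdot>\<^sub>m (B * A) = det A \<cdot>\<^sub>m 1\<^sub>m n"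
    using adj(3) mult_smult_assoc_mat[OF B A, of "det A"] by metis
  then have "det B \<cdot>\<^sub>m (det A \<cdot>\<^sub>m (B * A)) = det B \<cdot>\<^sub>m (det A \<cdot>\<^sub>m 1\<^sub>m n)" by simp
  moreover have "det B \<cdot>\<^sub>m (det A \<cdot>\<^sub>m M) = M" if "M \<in> carrier_mat n n" for M :: "'a mat"
    using that by (intro eq_matI) (auto simp: d simp flip: mult.assoc)
  ultimately show ?thesis using A B by (metis mult_carrier_mat one_carrier_mat)
qed

text \<open>An m by m + 1 matrix \<open>f\<close> completed by a last row \<open>r\<close>. With a
  gradient as \<open>r\<close> this is a Jacobian derivation, and with \<open>unit_row k\<close> it
  is the signed minor of \<open>f\<close> without column \<open>k\<close>.\<close>

definition rdet :: "nat \<Rightarrow> (nat \<Rightarrow> nat \<Rightarrow> 'a) \<Rightarrow> (nat \<Rightarrow> 'a) \<Rightarrow> 'a::comm_ring_1" where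
  "rdet m f r = det (mat (Suc m) (Suc m) (\<lambda>(i, k). if i < m then f i k else r k))"

abbreviation unit_row :: "nat \<Rightarrow> nat \<Rightarrow> 'a::zero_neq_one" where
  "unit_row k l \<equiv> if l = k then 1 else 0"

lemma rdet_expand: "rdet m f r = (\<Sum>k<Suc m. r k * rdet m f (unit_row k))"
proof -
  let ?M = "\<lambda>r. mat (Suc m) (Suc m) (\<lambda>(i, k). if i < m then f i k else r k)"
  have del: "mat_delete (?M r) m k = mat_delete (?M s) m k" for r s k
    by (rule eq_matI) (auto simp: mat_delete_def)
  then have cof: "cofactor (?M r) m k = cofactor (?M s) m k" for r s k
    unfolding cofactor_def by (simp only: del[of r k s])
  have expand: "rdet m f r = (\<Sum>k<Suc m. r k * cofactor (?M (\<lambda>_. 0)) m k)" for r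
    unfolding rdet_def
    by (subst laplace_expansion_row[of _ "Suc m" m])
      (auto intro!: sum.cong simp: cof[of r _ "\<lambda>_. 0"])
  have "rdet m f (unit_row k) = cofactor (?M (\<lambda>_. 0)) m k" if "k < Suc m" for k
  proof -
    have "(\<Sum>l<Suc m. unit_row k l * cofactor (?M (\<lambda>_. 0)) m l) =
        (\<Sum>l<Suc m. if l = k then cofactor (?M (\<lambda>_. 0)) m l else 0)"
      by (rule sum.cong) auto
    then show ?thesis using that unfolding expand[of "unit_row k"] by simp
  qed
  then show ?thesis unfolding expand[of r] by simp
qed

lemma rdet_repeated: "i < m \<Longrightarrow> rdet m f (f i) = 0"
  unfolding rdet_def by (rule det_identical_rows[of _ "Suc m" i m]) auto

lemma rdet_closed:
  assumes S: "0 \<in> S" "1 \<in> S" "\<And>x y. x \<in> S \<Longrightarrow> y \<in> S \<Longrightarrow> x + y \<in> S"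
      "\<And>x y. x \<in> S \<Longrightarrow> y \<in> S \<Longrightarrow> x * y \<in> S" "\<And>x. x \<in> S \<Longrightarrow> - x \<in> S"
    and f: "\<And>i k. i < m \<Longrightarrow> k < Suc m \<Longrightarrow> f i k \<in> S" "\<And>k. k < Suc m \<Longrightarrow> r k \<in> S"
  shows "rdet m f r \<in> S"
  unfolding rdet_def by (rule det_closed[OF S]) (auto intro: f)

text \<open>Applied to the Jacobian matrix, whose row 0 is the gradient of F, this places every
  value of the Jacobian derivation in the ideal generated by that gradient.\<close>

lemma rdet_expand_first:
  assumes "0 < m"
    and S: "0 \<in> S" "1 \<in> S" "\<And>x y. x \<in> S \<Longrightarrow> y \<in> S \<Longrightarrow> x + y \<in> S"
      "\<And>x y. x \<in> S \<Longrightarrow> y \<in> S \<Longrightarrow> x * y \<in> S" "\<And>x. x \<in> S \<Longrightarrow> - x \<in> S"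
    and f: "\<And>i k. i < m \<Longrightarrow> k < Suc m \<Longrightarrow> f i k \<in> S" "\<And>k. k < Suc m \<Longrightarrow> r k \<in> S"
  obtains c where "\<And>k. c k \<in> S" "rdet m f r = (\<Sum>k<Suc m. f 0 k * c k)"
proof -
  let ?M = "mat (Suc m) (Suc m) (\<lambda>(i, k). if i < m then f i k else r k)"
  have pow: "(-1) ^ k \<in> S" for k :: nat
    using S(2) S(5)[OF S(2)] by (induction k) (auto intro: S(5))
  have "cofactor ?M 0 k \<in> S" if "k < Suc m" for k
    unfolding cofactor_def
  proof (intro S(4) pow det_closed[OF S])
    show "mat_delete ?M 0 k \<in> carrier_mat m m" by (auto simp: mat_delete_def)
  qed (auto simp: mat_delete_def f)
  moreover have "rdet m f r = (\<Sum>k<Suc m. f 0 k * cofactor ?M 0 k)"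
    unfolding rdet_def using assms(1)
    by (subst laplace_expansion_row[of _ "Suc m" 0]) (auto intro!: sum.cong)
  \<comment> \<open>The cofactors are extended by 0, so that closure in \<open>S\<close> holds for
    all indices.\<close>
  ultimately show ?thesis
    by (intro that[of "\<lambda>k. if k < Suc m then cofactor ?M 0 k else 0"]) (auto simp: S(1) intro!: sum.cong)
qed

text \<open>Cauchy-Binet for an \<open>m \<times> (m + 1)\<close> matrix and a right inverse: summing the determinants of the
  products of the completions by unit vectors reduces it to a trace.\<close>

lemma sum_maximal_minors_right_inverse:
  fixes J V :: "nat \<Rightarrow> nat \<Rightarrow> 'a::comm_ring_1"
  assumes JV: "\<And>i j. i < m \<Longrightarrow> j < m \<Longrightarrow> (\<Sum>k<Suc m. J i k * V j k) = (if i = j then 1 else 0)"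
  shows "(\<Sum>k<Suc m. rdet m V (unit_row k) * rdet m J (unit_row k)) = 1"
proof -
  have summand: "rdet m V (unit_row k) * rdet m J (unit_row k) = 1 - (\<Sum>i<m. V i k * J i k)"
    if k: "k < Suc m" for k
  proof -
    define A where "A = mat (Suc m) (Suc m) (\<lambda>(i, l). if i < m then J i l else unit_row k l)"
    define B where "B = mat (Suc m) (Suc m) (\<lambda>(l, i). if i < m then V i l else unit_row k l)"
    \<comment> \<open>\<open>A * B\<close> is the identity matrix bordered by column
      \<open>k\<close> of \<open>J\<close> and of \<open>V\<close>; the unipotent \<open>L\<close>
      clears the last row, leaving 1 minus the product of the borders as the only diagonal entry
      that may differ from 1.\<close>
    define L where "L = mat (Suc m) (Suc m) (\<lambda>(i, j). if i = j then 1 else if i = m then - V j k else 0)"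
    have carr: "A \<in> carrier_mat (Suc m) (Suc m)" "B \<in> carrier_mat (Suc m) (Suc m)"
      "L \<in> carrier_mat (Suc m) (Suc m)" "A * B \<in> carrier_mat (Suc m) (Suc m)"
      by (auto simp: A_def B_def L_def)
    have B: "rdet m V (unit_row k) = det B"
      unfolding rdet_def by (subst det_transpose[symmetric, of _ "Suc m"])
        (auto intro!: arg_cong[of _ _ det] eq_matI simp: B_def)
    have A: "rdet m J (unit_row k) = det A" by (simp add: rdet_def A_def)
    have unit_sum: "(\<Sum>l<Suc m. unit_row k l * g l) = g k" "(\<Sum>l<Suc m. g l * unit_row k l) = g k" for g :: "nat \<Rightarrow> 'a"
      using k by (simp_all add: if_distrib[of "\<lambda>x. _ * x"] if_distrib[of "\<lambda>x. x * _"] sum.delta cong: if_cong)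
    have AB: "(A * B) $$ (i, j) = (if i < m then if j < m then (if i = j then 1 else 0) else J i k
        else if j < m then V j k else 1)" if "i < Suc m" "j < Suc m" for i j
    proof -
      have "(A * B) $$ (i, j) = (\<Sum>l<Suc m. (if i < m then J i l else unit_row k l) *
          (if j < m then V j l else unit_row k l))"
        using that by (simp add: A_def B_def scalar_prod_def atLeast0LessThan)
      then show ?thesis using JV[of i j] unit_sum by (auto simp del: sum.lessThan_Suc)
    qed
    have LAB: "(L * (A * B)) $$ (i, j) = (if i < m then (A * B) $$ (i, j)
        else (A * B) $$ (m, j) - (\<Sum>l<m. V l k * (A * B) $$ (l, j)))" if "i < Suc m" "j < Suc m" for i j
    proof -
      have "(L * (A * B)) $$ (i, j) =
          (\<Sum>l<Suc m. (if i = l then 1 else if i = m then - V l k else 0) * (A * B) $$ (l, j))"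
        using that carr by (simp add: L_def scalar_prod_def atLeast0LessThan)
      also have "\<dots> = (\<Sum>l<m. (if i = l then 1 else if i = m then - V l k else 0) * (A * B) $$ (l, j)) +
          (if i = m then (A * B) $$ (m, j) else 0)"
        by simp
      also have "(\<Sum>l<m. (if i = l then 1 else if i = m then - V l k else 0) * (A * B) $$ (l, j)) =
          (if i < m then (A * B) $$ (i, j) else - (\<Sum>l<m. V l k * (A * B) $$ (l, j)))"
      proof (cases "i < m")
        case True
        then have "(\<Sum>l<m. (if i = l then 1 else if i = m then - V l k else 0) * (A * B) $$ (l, j)) =
            (\<Sum>l<m. if i = l then (A * B) $$ (l, j) else 0)"
          by (intro sum.cong) auto
        then show ?thesis using True by simp
      next
        case False
        then have "(\<Sum>l<m. (if i = l then 1 else if i = m then - V l k else 0) * (A * B) $$ (l, j)) =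
            (\<Sum>l<m. - (V l k * (A * B) $$ (l, j)))"
          using that(1) by (intro sum.cong) auto
        then show ?thesis using False by (simp add: sum_negf)
      qed
      finally show ?thesis using that(1) by auto
    qed
    have delta: "(\<Sum>l<m. V l k * (if l = j then 1 else 0)) = V j k" if "j < m" for j
      using that by (simp add: if_distrib[of "\<lambda>x. _ * x"] sum.delta' cong: if_cong)
    have "upper_triangular (L * (A * B))"
    proof (rule upper_triangularI)
      fix i j assume "j < i" "i < dim_row (L * (A * B))"
      then have ij: "j < i" "i < Suc m" "j < Suc m" "j < m" using carr by auto
      show "(L * (A * B)) $$ (i, j) = 0"
      proof (cases "i < m")
        case True
        then show ?thesis using ij by (simp add: LAB AB)
      next
        case False
        then show ?thesis using ij delta[of j] by (simp add: LAB AB)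
      qed
    qed
    then have "det (L * (A * B)) = prod_list (diag_mat (L * (A * B)))"
      by (rule det_upper_triangular) (use carr in auto)
    also have "\<dots> = (\<Prod>i<Suc m. (L * (A * B)) $$ (i, i))"
      using carr by (simp add: prod_list_diag_prod atLeast0LessThan)
    also have "\<dots> = (\<Prod>i<m. (L * (A * B)) $$ (i, i)) * (L * (A * B)) $$ (m, m)" by simp
    also have "(\<Prod>i<m. (L * (A * B)) $$ (i, i)) = 1"
      by (rule prod.neutral) (auto simp: LAB AB)
    also have "(L * (A * B)) $$ (m, m) = 1 - (\<Sum>l<m. V l k * J l k)"
      by (simp add: LAB AB)
    finally have 1: "det (L * (A * B)) = 1 - (\<Sum>l<m. V l k * J l k)" by simp
    have "det L = prod_list (diag_mat L)"
      by (rule det_lower_triangular[of "Suc m"]) (auto simp: L_def)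
    also have "\<dots> = 1"
      using carr(3) by (subst prod_list_diag_prod) (auto simp: L_def intro!: prod.neutral)
    finally have "det (L * (A * B)) = det A * det B"
      using det_mult[OF carr(3,4)] det_mult[OF carr(1,2)] by simp
    then show ?thesis by (simp add: A B 1 mult.commute)
  qed
  \<comment> \<open>There are m + 1 summands, and the subtracted terms add up to the trace of the
    product of \<open>J\<close> with the transpose of \<open>V\<close>, which is m.\<close>
  have "(\<Sum>k<Suc m. rdet m V (unit_row k) * rdet m J (unit_row k)) =
      of_nat (Suc m) - (\<Sum>k<Suc m. \<Sum>i<m. V i k * J i k)"
    by (simp add: summand sum_subtractf del: sum.lessThan_Suc)
  also have "(\<Sum>k<Suc m. \<Sum>i<m. V i k * J i k) = (\<Sum>i<m. \<Sum>k<Suc m. J i k * V i k)"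
    by (subst sum.swap) (simp add: mult.commute)
  also have "\<dots> = of_nat m" by (simp add: JV del: sum.lessThan_Suc)
  finally show ?thesis by simp
qed

text \<open>The rows of \<open>J\<close> completed by the signed minors \<open>\<eta>\<close> of
  \<open>V\<close> form a square matrix; its inverse has the rows of \<open>V\<close> and the signed
  minors \<open>\<kappa>\<close> of \<open>J\<close> as columns. One product is the identity by the
  vanishing of determinants with a repeated row and by the previous identity. Hence the other
  product is the identity too, and it expands \<open>r\<close> in the completed rows.\<close>

lemma row_expansion_right_inverse:
  fixes J V :: "nat \<Rightarrow> nat \<Rightarrow> 'a::comm_ring_1"
  assumes JV: "\<And>i j. i < m \<Longrightarrow> j < m \<Longrightarrow> (\<Sum>k<Suc m. J i k * V j k) = (if i = j then 1 else 0)"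
    and k: "k < Suc m"
  shows "r k = (\<Sum>i<m. (\<Sum>l<Suc m. r l * V i l) * J i k) + rdet m J r * rdet m V (unit_row k)"
proof -
  define \<kappa> where "\<kappa> k = rdet m J (unit_row k)" for k
  define \<eta> where "\<eta> k = rdet m V (unit_row k)" for k
  define Q where "Q = mat (Suc m) (Suc m) (\<lambda>(i, k). if i < m then J i k else \<eta> k)"
  define Q' where "Q' = mat (Suc m) (Suc m) (\<lambda>(k, i). if i < m then V i k else \<kappa> k)"
  have carr: "Q \<in> carrier_mat (Suc m) (Suc m)" "Q' \<in> carrier_mat (Suc m) (Suc m)"
    by (auto simp: Q_def Q'_def)
  have J\<kappa>: "(\<Sum>k<Suc m. J i k * \<kappa> k) = 0" if "i < m" for i
    using rdet_expand[of m J "J i"] rdet_repeated[OF that, of J] by (simp add: \<kappa>_def)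
  have V\<eta>: "(\<Sum>k<Suc m. \<eta> k * V i k) = 0" if "i < m" for i
    using rdet_expand[of m V "V i"] rdet_repeated[OF that, of V] by (simp add: \<eta>_def mult.commute)
  have \<eta>\<kappa>: "(\<Sum>k<Suc m. \<eta> k * \<kappa> k) = 1"
    using sum_maximal_minors_right_inverse[OF JV] by (simp add: \<eta>_def \<kappa>_def)
  have "Q * Q' = 1\<^sub>m (Suc m)"
  proof (rule eq_matI)
    fix i j assume "i < dim_row (1\<^sub>m (Suc m) :: 'a mat)" "j < dim_col (1\<^sub>m (Suc m) :: 'a mat)"
    then have ij: "i < Suc m" "j < Suc m" by auto
    have "(Q * Q') $$ (i, j) = (\<Sum>k<Suc m. (if i < m then J i k else \<eta> k) * (if j < m then V j k else \<kappa> k))"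
      using ij by (simp add: Q_def Q'_def scalar_prod_def atLeast0LessThan)
    also have "\<dots> = (if i = j then 1 else 0)"
      using ij JV J\<kappa> V\<eta> \<eta>\<kappa> by (auto simp: less_Suc_eq simp del: sum.lessThan_Suc)
    finally show "(Q * Q') $$ (i, j) = 1\<^sub>m (Suc m) $$ (i, j)" using ij by simp
  qed (use carr in auto)
  then have "Q' * Q = 1\<^sub>m (Suc m)" by (rule mat_left_inverse_comm_ring[OF carr])
  moreover have "(Q' * Q) $$ (l, k) = (\<Sum>i<m. V i l * J i k) + \<kappa> l * \<eta> k" if "l < Suc m" for l
    using that k by (simp add: Q_def Q'_def scalar_prod_def atLeast0LessThan)
  ultimately have *: "(\<Sum>i<m. V i l * J i k) + \<kappa> l * \<eta> k = (if l = k then 1 else 0)" if "l < Suc m" for l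
    using that k by (metis index_one_mat(1))
  have "r k = (\<Sum>l<Suc m. r l * (if l = k then 1 else 0))"
    using k by (simp add: if_distrib[of "\<lambda>x. _ * x"] sum.delta cong: if_cong)
  also have "\<dots> = (\<Sum>l<Suc m. r l * ((\<Sum>i<m. V i l * J i k) + \<kappa> l * \<eta> k))"
    by (rule sum.cong) (simp_all add: *)
  also have "\<dots> = (\<Sum>l<Suc m. \<Sum>i<m. r l * V i l * J i k) + (\<Sum>l<Suc m. r l * \<kappa> l) * \<eta> k"
    by (simp add: distrib_left sum.distrib sum_distrib_left sum_distrib_right mult.assoc del: sum.lessThan_Suc)
  also have "(\<Sum>l<Suc m. \<Sum>i<m. r l * V i l * J i k) = (\<Sum>i<m. (\<Sum>l<Suc m. r l * V i l) * J i k)"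
    by (subst sum.swap) (simp add: sum_distrib_right del: sum.lessThan_Suc)
  also have "(\<Sum>l<Suc m. r l * \<kappa> l) = rdet m J r"
    by (simp add: rdet_expand[of m J r] \<kappa>_def)
  finally show ?thesis by (simp add: \<eta>_def)
qed

lemma jacobian_derivation_eq_rdet:
  "length fs = m \<Longrightarrow> jacobian_derivation (Suc m) fs g =
    rdet m (\<lambda>i k. pderivative k (fs ! i)) (\<lambda>k. pderivative k g)"
  unfolding jacobian_derivation_def jacobian_def rdet_def
  by (intro arg_cong[of _ _ det] eq_matI) (auto simp: nth_append)

lemma minor_eq_rdet:
  assumes M: "M = mat m (Suc m) (\<lambda>(i, k). f i k)" and k: "k < Suc m"
  shows "det (submatrix M {..<m} ({..<Suc m} - {k})) = (-1) ^ (m + k) * rdet m f (unit_row k)"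
proof -
  let ?M = "mat (Suc m) (Suc m) (\<lambda>(i, l). if i < m then f i l else unit_row k l)"
  have "rdet m f (unit_row k) = (\<Sum>l<Suc m. ?M $$ (m, l) * cofactor ?M m l)"
    unfolding rdet_def by (rule laplace_expansion_row) auto
  also have "\<dots> = (\<Sum>l<Suc m. if l = k then cofactor ?M m l else 0)"
    by (rule sum.cong) auto
  also have "\<dots> = cofactor ?M m k" using k by simp
  finally have "(-1) ^ (m + k) * rdet m f (unit_row k) = det (mat_delete ?M m k)"
    by (simp add: cofactor_def flip: mult.assoc power_add mult_2)
  moreover have "mat_delete ?M m k = submatrix M {..<m} ({..<Suc m} - {k})"
  proof (rule eq_matI)
    have c: "{i. i < m \<and> i \<in> {..<m}} = {..<m}" "{j. j < Suc m \<and> j \<in> {..<Suc m} - {k}} = {..<Suc m} - {k}"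
      "{j. j < Suc m \<and> j \<noteq> k} = {..<Suc m} - {k}"
      by auto
    show "dim_row (mat_delete ?M m k) = dim_row (submatrix M {..<m} ({..<Suc m} - {k}))"
      "dim_col (mat_delete ?M m k) = dim_col (submatrix M {..<m} ({..<Suc m} - {k}))"
      using k by (simp_all add: dim_submatrix M c)
    fix i j assume "i < dim_row (submatrix M {..<m} ({..<Suc m} - {k}))"
      "j < dim_col (submatrix M {..<m} ({..<Suc m} - {k}))"
    then have ij: "i < m" "j < m" using k by (simp_all add: dim_submatrix M c)
    \<comment> \<open>Column \<open>j\<close> of the minor is column \<open>?j\<close> of the full
      matrix, the index \<open>k\<close> being skipped.\<close>
    let ?j = "if j < k then j else Suc j"
    have "{a \<in> {..<m}. a < i} = {..<i}" using ij by auto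
    moreover have "{a \<in> {..<Suc m} - {k}. a < ?j} = (if j < k then {..<j} else {..<Suc j} - {k})"
      using ij by auto
    ultimately have "card {a \<in> {..<m}. a < i} = i" "card {a \<in> {..<Suc m} - {k}. a < ?j} = j"
      by auto
    moreover have "submatrix M {..<m} ({..<Suc m} - {k}) $$
        (card {a \<in> {..<m}. a < i}, card {a \<in> {..<Suc m} - {k}. a < ?j}) = M $$ (i, ?j)"
      using ij by (intro submatrix_index_card) (auto simp: M)
    ultimately have "submatrix M {..<m} ({..<Suc m} - {k}) $$ (i, j) = M $$ (i, ?j)" by simp
    then show "mat_delete ?M m k $$ (i, j) = submatrix M {..<m} ({..<Suc m} - {k}) $$ (i, j)"
      using ij by (simp add: mat_delete_def M)
  qed
  ultimately show ?thesis by simp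
qed

text \<open>A set of m columns out of m + 1 omits exactly one, and all m rows must be taken, so the
  minors are indexed by the omitted column.\<close>

lemma minors_eq:
  assumes M: "M = mat m (Suc m) (\<lambda>(i, k). f i k)"
  shows "minors m M = (\<lambda>k. (-1) ^ (m + k) * rdet m f (unit_row k)) ` {..<Suc m}"
proof -
  have I: "I = {..<m}" if "I \<subseteq> {..<m}" "card I = m" for I :: "nat set"
    using that by (intro card_subset_eq) auto
  have J: "\<exists>k<Suc m. J = {..<Suc m} - {k}" if J: "J \<subseteq> {..<Suc m}" "card J = m" for J :: "nat set"
  proof -
    have "card ({..<Suc m} - J) = 1" using J by (subst card_Diff_subset) (auto intro: finite_subset)
    then obtain k where "{..<Suc m} - J = {k}" by (auto simp: card_1_singleton_iff)
    then show ?thesis using J by (intro exI[of _ k]) auto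
  qed
  have dim: "dim_row M = m" "dim_col M = Suc m" by (simp_all add: M)
  show ?thesis
  proof (intro equalityI subsetI)
    fix x assume "x \<in> minors m M"
    then obtain I' J' where x: "x = det (submatrix M I' J')" "I' \<subseteq> {..<m}" "J' \<subseteq> {..<Suc m}"
      "card I' = m" "card J' = m"
      by (auto simp: minors_def dim)
    obtain k where k: "k < Suc m" "J' = {..<Suc m} - {k}" using J[OF x(3,5)] by blast
    show "x \<in> (\<lambda>k. (-1) ^ (m + k) * rdet m f (unit_row k)) ` {..<Suc m}"
      unfolding x(1) I[OF x(2,4)] k(2) minor_eq_rdet[OF M k(1)] using k(1) by blast
  next
    fix x assume "x \<in> (\<lambda>k. (-1) ^ (m + k) * rdet m f (unit_row k)) ` {..<Suc m}"
    then obtain k where k: "k < Suc m" "x = det (submatrix M {..<m} ({..<Suc m} - {k}))"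
      using minor_eq_rdet[OF M] by auto
    then show "x \<in> minors m M"
      unfolding minors_def dim
      by (intro CollectI exI[of _ "{..<m}"] exI[of _ "{..<Suc m} - {k}"]) auto
  qed
qed

section \<open>Retracts of polynomial rings\<close>

lemma add_eq_0_poly_mapping_nat: "a + b = 0 \<longleftrightarrow> a = 0 \<and> b = 0" for a b :: "nat \<Rightarrow>\<^sub>0 nat"
  by (auto simp: poly_mapping_eq_iff lookup_add fun_eq_iff)

text \<open>Exponents add up to 0 only if both are 0. For polynomials in T over A this makes the
  constant coefficient multiplicative, and with it the retraction \<open>proj\<close>.\<close>

lemma lookup_mult_0: "lookup (p * q) 0 = lookup p 0 * lookup q 0"
  for p q :: "'a::comm_ring_1 mpol"
proof -
  have "lookup (p * q) 0 = (\<Sum>ab\<in>keys p \<times> keys q.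
      if ab = (0, 0) then lookup p 0 * lookup q 0 else 0)"
    unfolding lookup_mult_sum by (rule sum.cong) (simp_all add: add_eq_0_poly_mapping_nat split: prod.split)
  then show ?thesis by (auto simp: in_keys_iff)
qed

lemma comm_ring_hom_id: "comm_ring_hom (id :: 'a::comm_ring_1 \<Rightarrow> 'a)"
  by unfold_locales auto

lemma ev_ev:
  assumes "comm_ring_hom h"
  shows "ev h G (ev mpol_const G' q) = ev h (\<lambda>i. ev h G (G' i)) q"
proof -
  interpret comm_ring_hom h by fact
  obtain N where "q \<in> mpolys N" using mpolys_UN by blast
  then show ?thesis
    by (induction q rule: mpolys_ring_induct)
      (simp_all only: mpol_const.ev_const mpol_const.ev_mvar mpol_const.ev_add mpol_const.ev_mult
        ev_const ev_mvar ev_add ev_mult)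
qed

text \<open>The equality A[T] = R[X] appears as bijectivity of the evaluation at \<open>T\<close>
  from polynomials with coefficients in \<open>A\<close> onto the polynomials in n + 2 variables,
  and the inclusion of the rational numbers as invertibility of the positive integers.\<close>

locale stably_polynomial =
  fixes n :: nat and A :: "'r::comm_ring_1 mpol set" and T :: "nat \<Rightarrow> 'r mpol" and F :: "'r mpol"
  assumes noetherian: "noetherian_ring (class_ring :: 'r ring)"
    and rational: "\<exists>c::'r. of_nat (Suc k) * c = 1"
    and A_mpolys: "A \<subseteq> mpolys (Suc (Suc n))"
    and A_const: "mpol_const a \<in> A"
    and A_add: "x \<in> A \<Longrightarrow> y \<in> A \<Longrightarrow> x + y \<in> A"
    and A_mult: "x \<in> A \<Longrightarrow> y \<in> A \<Longrightarrow> x * y \<in> A"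
    and T_mpolys: "i < n \<Longrightarrow> T i \<in> mpolys (Suc (Suc n))"
    and AT_inj: "inj_on (ev id T) {p \<in> mpolys n. \<forall>m. lookup p m \<in> A}"
    and AT_surj: "mpolys (Suc (Suc n)) \<subseteq> ev id T ` {p \<in> mpolys n. \<forall>m. lookup p m \<in> A}"
    and F_A: "F \<in> A"
begin

abbreviation N :: nat where "N \<equiv> Suc (Suc n)"

abbreviation B :: "'r mpol set" where "B \<equiv> mpolys (Suc (Suc n))"

definition AT :: "'r mpol mpol set" where
  "AT = {p \<in> mpolys n. \<forall>m. lookup p m \<in> A}"

definition coefT :: "'r mpol \<Rightarrow> 'r mpol mpol" where
  "coefT = inv_into AT (ev id T)"

definition proj :: "'r mpol \<Rightarrow> 'r mpol" where
  "proj f = lookup (coefT f) 0"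

text \<open>The partial derivative with respect to \<open>T i\<close> over A, transported from A[T]
  to R[X].\<close>

definition dT :: "nat \<Rightarrow> 'r mpol \<Rightarrow> 'r mpol" where
  "dT i f = ev id T (pderivative i (coefT f))"

interpretation idh: comm_ring_hom "id :: 'r mpol \<Rightarrow> 'r mpol" by (rule comm_ring_hom_id)

lemma A_0: "0 \<in> A" and A_1: "1 \<in> A"
  using A_const[of 0] A_const[of 1] by simp_all

lemma A_uminus: "x \<in> A \<Longrightarrow> - x \<in> A"
  using A_mult[OF A_const[of "-1"], of x] by (simp add: mpol_const.hom_uminus)

lemma A_diff: "x \<in> A \<Longrightarrow> y \<in> A \<Longrightarrow> x - y \<in> A"
  using A_add[OF _ A_uminus] by fastforce

lemma A_sum: "(\<And>i. i \<in> S \<Longrightarrow> f i \<in> A) \<Longrightarrow> sum f S \<in> A"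
  by (induction S rule: infinite_finite_induct) (simp_all add: A_0 A_add)

lemma A_power: "x \<in> A \<Longrightarrow> x ^ k \<in> A"
  by (induction k) (simp_all add: A_1 A_mult)

lemmas A_closed = A_0 A_1 A_const A_add A_mult A_uminus A_diff A_sum A_power

lemma A_B: "x \<in> A \<Longrightarrow> x \<in> B"
  using A_mpolys by blast

lemma A_ev: "q \<in> mpolys M \<Longrightarrow> (\<And>i. i < M \<Longrightarrow> G i \<in> A) \<Longrightarrow> ev mpol_const G q \<in> A"
  by (rule ev_closed[where N = M]) (simp_all add: A_closed)

lemma B_ev: "q \<in> mpolys M \<Longrightarrow> (\<And>i. i < M \<Longrightarrow> G i \<in> B) \<Longrightarrow> ev mpol_const G q \<in> B"
  by (rule ev_closed[where N = M]) (simp_all add: mpolys_closed)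

lemma AT_add: "p \<in> AT \<Longrightarrow> q \<in> AT \<Longrightarrow> p + q \<in> AT"
  by (simp add: AT_def mpolys_add lookup_add A_add)

lemma AT_mult: "p \<in> AT \<Longrightarrow> q \<in> AT \<Longrightarrow> p * q \<in> AT"
proof -
  assume pq: "p \<in> AT" "q \<in> AT"
  have "lookup (p * q) m \<in> A" for m
    unfolding lookup_mult_sum using pq by (intro A_sum) (auto simp: AT_def A_mult A_0)
  then show ?thesis using pq by (simp add: AT_def mpolys_mult)
qed

lemma AT_const: "a \<in> A \<Longrightarrow> mpol_const a \<in> AT"
  by (simp add: AT_def mpolys_const lookup_const A_0)

lemma AT_mvar: "i < n \<Longrightarrow> mvar i \<in> AT"
  by (simp add: AT_def mpolys_mvar) (simp add: mvar_def lookup_single when_def A_0 A_1)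

lemma coefT: "f \<in> B \<Longrightarrow> coefT f \<in> AT" and ev_coefT: "f \<in> B \<Longrightarrow> ev id T (coefT f) = f"
  using AT_surj inv_into_into[of f "ev id T" AT] f_inv_into_f[of f "ev id T" AT]
  unfolding coefT_def AT_def by blast+

lemma coefT_ev: "p \<in> AT \<Longrightarrow> coefT (ev id T p) = p"
  using AT_inj unfolding coefT_def AT_def by (rule inv_into_f_f)

lemma coefT_eqI: "p \<in> AT \<Longrightarrow> ev id T p = f \<Longrightarrow> coefT f = p"
  using coefT_ev by blast

lemma coefT_add: "f \<in> B \<Longrightarrow> g \<in> B \<Longrightarrow> coefT (f + g) = coefT f + coefT g"
  by (intro coefT_eqI AT_add coefT) (simp_all add: idh.ev_add ev_coefT)

lemma coefT_mult: "f \<in> B \<Longrightarrow> g \<in> B \<Longrightarrow> coefT (f * g) = coefT f * coefT g"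
  by (intro coefT_eqI AT_mult coefT) (simp_all add: idh.ev_mult ev_coefT)

lemma coefT_A: "a \<in> A \<Longrightarrow> coefT a = mpol_const a"
  by (intro coefT_eqI AT_const) (simp_all add: idh.ev_const)

lemma coefT_T: "i < n \<Longrightarrow> coefT (T i) = mvar i"
  by (intro coefT_eqI AT_mvar) (simp_all add: idh.ev_mvar)

lemma proj_A: "f \<in> B \<Longrightarrow> proj f \<in> A"
  using coefT[of f] by (simp add: proj_def AT_def)

lemma proj_id: "a \<in> A \<Longrightarrow> proj a = a"
  by (simp add: proj_def coefT_A lookup_const)

lemma proj_add: "f \<in> B \<Longrightarrow> g \<in> B \<Longrightarrow> proj (f + g) = proj f + proj g"
  by (simp add: proj_def coefT_add lookup_add)

lemma proj_mult: "f \<in> B \<Longrightarrow> g \<in> B \<Longrightarrow> proj (f * g) = proj f * proj g"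
  by (simp add: proj_def coefT_mult lookup_mult_0)

lemma proj_const: "proj (mpol_const a) = mpol_const a"
  by (rule proj_id[OF A_const])

text \<open>The retraction substitutes elements of A for the variables and fixes R, hence it is
  compatible with passing to R/I.\<close>

lemma proj_ev: "f \<in> B \<Longrightarrow> proj f = ev mpol_const (\<lambda>k. proj (mvar k)) f"
  by (rule hom_ev_const[where N = N])
    (simp_all add: proj_const proj_add proj_mult mpol_const.comm_ring_hom_axioms)

lemma proj_coeffs_in: "cideal I \<Longrightarrow> f \<in> B \<Longrightarrow> f \<in> coeffs_in I \<Longrightarrow> proj f \<in> coeffs_in I"
  by (subst proj_ev) (auto intro: coeffs_in_ev)

lemma pderivative_proj:
  assumes "f \<in> B"
  shows "pderivative j (proj f) = (\<Sum>k<N. proj (pderivative k f) * pderivative j (proj (mvar k)))"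
  using assms
  by (rule derivation_chain_rule)
    (simp_all add: proj_const proj_add proj_mult proj_id A_0 A_1 pderivative_add pderivative_mult)

lemma dT_chain: "f \<in> B \<Longrightarrow> dT i f = (\<Sum>k<N. pderivative k f * dT i (mvar k))"
proof (rule derivation_chain_rule[where \<phi> = "\<lambda>f. f"])
  show "dT i (mpol_const a) = 0" for a
    by (simp add: dT_def coefT_A A_const)
qed (simp_all add: dT_def coefT_add coefT_mult pderivative_add pderivative_mult idh.ev_add
    idh.ev_mult ev_coefT)

lemma dT_A: "a \<in> A \<Longrightarrow> dT i a = 0"
  by (simp add: dT_def coefT_A)

lemma dT_T: "j < n \<Longrightarrow> dT i (T j) = (if i = j then 1 else 0)"
  using idh.ev_const[of T 1] by (simp add: dT_def coefT_T pderivative_mvar)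

lemma dT_B: "f \<in> B \<Longrightarrow> dT i f \<in> B"
proof -
  assume "f \<in> B"
  then have c: "coefT f \<in> AT" by (rule coefT)
  have "lookup (pderivative i (coefT f)) m \<in> B" for m
    unfolding lookup_pderivative mpol_const.hom_of_nat[symmetric] using c
    by (intro mpolys_mult mpolys_const A_B) (simp add: AT_def)
  then show ?thesis
    unfolding dT_def using c
    by (intro ev_closed[where N = n]) (auto simp: mpolys_closed T_mpolys AT_def mpolys_pderivative)
qed

text \<open>A decomposition found in R[X] is retracted to A; \<open>x\<close> is unchanged, and
  coefficients in I remain in I.\<close>

lemma coeffs_in_iadjoin_A:
  assumes "cideal I" "x \<in> A" "x \<in> coeffs_in (iadjoin I a)"
  obtains y z where "y \<in> A" "y \<in> coeffs_in I" "z \<in> A" "x = y + mpol_const a * z"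
proof -
  obtain q r where qr: "q \<in> coeffs_in I" "q \<in> B" "r \<in> B" "x = q + mpol_const a * r"
    using coeffs_in_iadjoin[OF assms(1,3) A_B[OF assms(2)]] by blast
  then have "x = proj q + mpol_const a * proj r"
    using proj_id[OF assms(2)] by (simp add: proj_add proj_mult proj_const mpolys_closed)
  then show ?thesis using that qr assms(1) proj_A proj_coeffs_in by blast
qed

section \<open>The Jacobian derivation and its behaviour on the fibres\<close>

definition J :: "nat \<Rightarrow> nat \<Rightarrow> 'r mpol" where
  "J i k = pderivative k ((F # map T [0..<n]) ! i)"

text \<open>The signed maximal minors of the Jacobian matrix, equal to the values of
  \<open>D\<close> at the variables by \<open>D_mvar\<close>.\<close>

definition \<kappa> :: "nat \<Rightarrow> 'r mpol" where
  "\<kappa> k = rdet (Suc n) J (unit_row k)"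

definition D :: "'r mpol \<Rightarrow> 'r mpol" where
  "D = jacobian_derivation N (F # map T [0..<n])"

lemma J_0: "J 0 k = pderivative k F"
  by (simp add: J_def)

lemma J_Suc: "i < n \<Longrightarrow> J (Suc i) k = pderivative k (T i)"
  by (simp add: J_def)

lemma J_B: "i < Suc n \<Longrightarrow> J i k \<in> B"
  by (cases i) (auto simp: J_0 J_Suc intro!: mpolys_pderivative T_mpolys A_B[OF F_A])

lemma D_rdet: "D g = rdet (Suc n) J (\<lambda>k. pderivative k g)"
  unfolding D_def J_def by (rule jacobian_derivation_eq_rdet) simp

lemma D_sum: "D g = (\<Sum>k<N. pderivative k g * \<kappa> k)"
  unfolding D_rdet \<kappa>_def by (rule rdet_expand)

lemma D_mvar: "k < N \<Longrightarrow> D (mvar k) = \<kappa> k"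
proof -
  assume k: "k < N"
  have "D (mvar k) = (\<Sum>l<N. if l = k then \<kappa> l else 0)"
    unfolding D_sum by (rule sum.cong) (auto simp: pderivative_mvar)
  then show ?thesis using k by (simp del: sum.lessThan_Suc)
qed

lemma \<kappa>_B: "\<kappa> k \<in> B"
  unfolding \<kappa>_def by (rule rdet_closed) (auto simp: mpolys_closed J_B)

lemma D_B: "g \<in> B \<Longrightarrow> D g \<in> B"
  unfolding D_sum by (intro mpolys_sum mpolys_mult mpolys_pderivative \<kappa>_B)

lemma D_add: "D (f + g) = D f + D g"
  by (simp add: D_sum pderivative_add distrib_right sum.distrib del: sum.lessThan_Suc)

lemma D_mult: "D (f * g) = f * D g + g * D f"
  by (simp add: D_sum pderivative_mult distrib_right sum.distrib sum_distrib_left mult.assoc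
      del: sum.lessThan_Suc)

lemma D_const: "D (mpol_const a) = 0"
  by (simp add: D_sum)

lemma D_const_mult: "D (mpol_const a * f) = mpol_const a * D f"
  by (simp add: D_mult D_const)

lemma D_0: "D 0 = 0"
  using D_const[of 0] by simp

lemma D_uminus: "D (- f) = - D f"
  using D_add[of f "- f"] by (simp add: D_0 eq_neg_iff_add_eq_0 add.commute)

lemma D_diff: "D (f - g) = D f - D g"
  using D_add[of f "- g"] by (simp add: D_uminus)

lemma D_F: "D F = 0"
proof -
  have "J 0 = (\<lambda>k. pderivative k F)" by (intro ext J_0)
  then show ?thesis using rdet_repeated[of 0 "Suc n" J] by (simp add: D_rdet)
qed

lemma D_T: "i < n \<Longrightarrow> D (T i) = 0"
proof -
  assume "i < n"
  then have "J (Suc i) = (\<lambda>k. pderivative k (T i))" by (intro ext J_Suc)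
  then show ?thesis using rdet_repeated[of "Suc i" "Suc n" J] \<open>i < n\<close> by (simp add: D_rdet)
qed

lemma D_coeffs_in: "cideal I \<Longrightarrow> f \<in> coeffs_in I \<Longrightarrow> D f \<in> coeffs_in I"
  unfolding D_sum
  by (intro cideal_sum cideal_mult2 cideal_coeffs_in pderivative_coeffs_in)

lemma D_gradient_F:
  assumes "g \<in> B"
  obtains c where "\<And>k. c k \<in> B" "D g = (\<Sum>k<N. pderivative k F * c k)"
  unfolding D_rdet J_0[symmetric]
  using assms
  by (rule_tac rdet_expand_first[of "Suc n" B J "\<lambda>k. pderivative k g"])
    (auto simp: mpolys_closed J_B mpolys_pderivative)

text \<open>\<open>F\<close> and \<open>G\<close> generate the fibre of \<open>A\<close> at \<open>P\<close> over the residue field, with the denominators cleared.\<close>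

definition generates_mod :: "'r set \<Rightarrow> 'r mpol \<Rightarrow> bool" where
  "generates_mod P G \<longleftrightarrow> G \<in> A \<and> (\<forall>y\<in>A. \<exists>c q. c \<notin> P \<and> q \<in> mpolys 2 \<and>
     mpol_const c * y - ev mpol_const ((!) [F, G]) q \<in> coeffs_in P)"

text \<open>Modulo \<open>P\<close> the variables are, up to denominators, polynomials in \<open>F, T, G\<close>; by the chain rule the
  Jacobian matrix of \<open>F, T, G\<close> is then invertible.\<close>

lemma generates_mod_D:
  assumes P: "cprime P" and G: "generates_mod P G"
  obtains s z where "s \<notin> P" "z \<in> B" "mpol_const s - z * D G \<in> coeffs_in P"
proof -
  note id = cprimeD(1)[OF P] and idc = cideal_coeffs_in[OF cprimeD(1)[OF P]]
  have GA: "G \<in> A" using G by (simp add: generates_mod_def)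
  define fs where "fs = (F # map T [0..<n]) @ [G]"
  have fs_B: "fs ! i \<in> B" if "i < N" for i
    using that by (auto simp: fs_def nth_append nth_Cons' less_Suc_eq_0_disj intro!: A_B F_A GA T_mpolys)
  let ?e = "ev mpol_const ((!) fs)"
  \<comment> \<open>\<open>K\<close> collects the elements that become polynomials in F, T, G modulo
    \<open>P\<close> after multiplication by a constant outside \<open>P\<close>. It is closed under
    sums and products since such constants multiply, and it contains A and T, hence all of
    B.\<close>
  define K where "K = {f. \<exists>c q. c \<notin> P \<and> q \<in> B \<and> mpol_const c * f - ?e q \<in> coeffs_in P}"
  have KI: "f \<in> K" if "c \<notin> P" "q \<in> B" "mpol_const c * f - ?e q \<in> coeffs_in P" for f c q
    using that by (auto simp: K_def)
  have var: "fs ! i \<in> K" if "i < N" for i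
    by (rule KI[of 1 "mvar i"])
      (use that in \<open>simp_all add: cprimeD(2)[OF P] mpolys_mvar mpol_const.ev_mvar cideal_0[OF idc]\<close>)
  have "mpol_const a \<in> K" for a
    by (rule KI[of 1 "mpol_const a"])
      (simp_all add: cprimeD(2)[OF P] mpolys_const mpol_const.ev_const cideal_0[OF idc])
  from this[of 0] this[of 1] have const: "0 \<in> K" "1 \<in> K" by simp_all
  have add: "f + g \<in> K" if fg: "f \<in> K" "g \<in> K" for f g
  proof -
    obtain c q c' q' where *: "c \<notin> P" "q \<in> B" "mpol_const c * f - ?e q \<in> coeffs_in P"
      "c' \<notin> P" "q' \<in> B" "mpol_const c' * g - ?e q' \<in> coeffs_in P"
      using fg by (auto simp: K_def)
    have "mpol_const (c * c') * (f + g) - ?e (mpol_const c' * q + mpol_const c * q') =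
        mpol_const c' * (mpol_const c * f - ?e q) + mpol_const c * (mpol_const c' * g - ?e q')"
      by (simp add: mpol_const.ev_add mpol_const.ev_mult mpol_const.ev_const mpol_const.hom_mult algebra_simps)
    also have "\<dots> \<in> coeffs_in P" by (intro cideal_add[OF idc] cideal_mult[OF idc] *)
    finally show ?thesis by (rule KI[rotated 2]) (use * cprime_mult[OF P *(1,4)] in \<open>auto intro!: mpolys_closed\<close>)
  qed
  have mult: "f * g \<in> K" if fg: "f \<in> K" "g \<in> K" for f g
  proof -
    obtain c q c' q' where *: "c \<notin> P" "q \<in> B" "mpol_const c * f - ?e q \<in> coeffs_in P"
      "c' \<notin> P" "q' \<in> B" "mpol_const c' * g - ?e q' \<in> coeffs_in P"
      using fg by (auto simp: K_def)
    have "mpol_const (c * c') * (f * g) - ?e (q * q') =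
        mpol_const c' * g * (mpol_const c * f - ?e q) + ?e q * (mpol_const c' * g - ?e q')"
      by (simp add: mpol_const.ev_mult mpol_const.hom_mult algebra_simps)
    also have "\<dots> \<in> coeffs_in P" by (intro cideal_add[OF idc] cideal_mult[OF idc] *)
    finally show ?thesis by (rule KI[rotated 2]) (use * cprime_mult[OF P *(1,4)] in \<open>auto intro!: mpolys_closed\<close>)
  qed
  have A_K: "y \<in> K" if "y \<in> A" for y
  proof -
    obtain c q where cq: "c \<notin> P" "q \<in> mpolys 2"
      "mpol_const c * y - ev mpol_const ((!) [F, G]) q \<in> coeffs_in P"
      using G \<open>y \<in> A\<close> by (auto simp: generates_mod_def)
    \<comment> \<open>F has index 0 and G index n + 1 in \<open>fs\<close>, with the T in between,
      whereas \<open>generates_mod\<close> numbers F and G as 0 and 1.\<close>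
    define q' where "q' = ev mpol_const ((!) [mvar 0, mvar (Suc n)]) q"
    have "q' \<in> B" unfolding q'_def using cq(2)
      by (rule B_ev) (auto simp: less_2_cases_iff intro!: mpolys_mvar)
    moreover have "?e q' = ev mpol_const ((!) [F, G]) q"
      unfolding q'_def ev_ev[OF mpol_const.comm_ring_hom_axioms]
      by (rule ev_cong[OF cq(2)]) (auto simp: less_2_cases_iff mpol_const.ev_mvar fs_def nth_append)
    ultimately show ?thesis using cq by (intro KI[of c q']) auto
  qed
  have T_K: "T i \<in> K" if "i < n" for i
    using var[of "Suc i"] that by (simp add: fs_def nth_append)
  have "f \<in> K" if "f \<in> B" for f
  proof -
    have "ev id T (coefT f) \<in> K"
      using coefT[OF that] by (intro ev_closed[where N = n] const add mult)
        (auto simp: AT_def A_K T_K)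
    then show ?thesis by (simp add: ev_coefT that)
  qed
  then have "\<exists>c q. c \<notin> P \<and> q \<in> B \<and> mpol_const c * mvar k - ?e q \<in> coeffs_in P" if "k < N" for k
    using mpolys_mvar[OF that] unfolding K_def by blast
  then obtain c q where cq: "\<And>k. k < N \<Longrightarrow> c k \<notin> P" "\<And>k. k < N \<Longrightarrow> q k \<in> B"
    "\<And>k. k < N \<Longrightarrow> mpol_const (c k) * mvar k - ?e (q k) \<in> coeffs_in P"
    by metis
  \<comment> \<open>Differentiating the relations for \<open>mpol_const (c k) * mvar k\<close> shows
    that \<open>Cm\<close> is congruent to \<open>Qm * Jm\<close> modulo \<open>P\<close>. The
    determinant of \<open>Cm\<close> is a constant outside \<open>P\<close>, and that of
    \<open>Jm\<close> is \<open>D G\<close>.\<close>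
  define Qm where "Qm = mat N N (\<lambda>(k, l). ?e (pderivative l (q k)))"
  define Jm where "Jm = mat N N (\<lambda>(l, j). pderivative j (fs ! l))"
  define Cm where "Cm = mat N N (\<lambda>(k, j). if k = j then mpol_const (c k) else 0)"
  have carr: "Qm \<in> carrier_mat N N" "Jm \<in> carrier_mat N N" "Cm \<in> carrier_mat N N"
    by (auto simp: Qm_def Jm_def Cm_def)
  have "det Cm - det (Qm * Jm) \<in> coeffs_in P"
  proof (rule det_cong_ideal[OF idc carr(3) mult_carrier_mat[OF carr(1,2)]])
    fix k j assume kj: "k < N" "j < N"
    have "pderivative j (?e (q k)) = (\<Sum>l<N. ?e (pderivative l (q k)) * pderivative j (?e (mvar l)))"
      using cq(2)[OF kj(1)]
      by (rule derivation_chain_rule)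
        (use mpol_const.ev_const[of "(!) fs" 1] in \<open>simp_all add: mpol_const.ev_add mpol_const.ev_mult
          mpol_const.ev_const pderivative_add pderivative_mult\<close>)
    then have "(Qm * Jm) $$ (k, j) = pderivative j (?e (q k))"
      using kj by (simp add: Qm_def Jm_def scalar_prod_def atLeast0LessThan mpol_const.ev_mvar
          del: sum.lessThan_Suc)
    moreover have "Cm $$ (k, j) = pderivative j (mpol_const (c k) * mvar k)"
      using kj by (simp add: Cm_def pderivative_const_mult pderivative_mvar)
    ultimately have "Cm $$ (k, j) - (Qm * Jm) $$ (k, j) =
        pderivative j (mpol_const (c k) * mvar k - ?e (q k))"
      by (simp add: pderivative_diff)
    then show "Cm $$ (k, j) - (Qm * Jm) $$ (k, j) \<in> coeffs_in P"
      using pderivative_coeffs_in[OF id cq(3)[OF kj(1)]] by simp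
  qed
  moreover have "det Cm = mpol_const (\<Prod>k<N. c k)"
  proof -
    have "det Cm = prod_list (diag_mat Cm)"
      by (rule det_lower_triangular[of N]) (auto simp: Cm_def)
    then show ?thesis
      by (simp add: prod_list_diag_prod Cm_def atLeast0LessThan mpol_const.hom_prod del: prod.lessThan_Suc)
  qed
  moreover have "det (Qm * Jm) = det Qm * D G"
  proof -
    have "det Jm = D G"
      by (simp add: D_def jacobian_derivation_def jacobian_def Jm_def fs_def)
    then show ?thesis by (simp add: det_mult[OF carr(1,2)])
  qed
  moreover have "det Qm \<in> B"
  proof (rule det_closed)
    fix i j assume "i < N" "j < N"
    then show "Qm $$ (i, j) \<in> B"
      using cq(2) fs_B by (auto simp: Qm_def intro!: B_ev[where M = N] mpolys_pderivative)
  qed (use carr in \<open>auto simp: mpolys_closed\<close>)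
  moreover have "(\<Prod>k<N. c k) \<notin> P" by (rule cprime_prod[OF P]) (simp add: cq(1))
  ultimately show ?thesis using that by metis
qed

definition unimodular_gradient :: "'r set \<Rightarrow> bool" where
  "unimodular_gradient I \<longleftrightarrow> (\<exists>a. (\<forall>k. a k \<in> B) \<and> 1 - (\<Sum>k<N. a k * pderivative k F) \<in> coeffs_in I)"

text \<open>At a prime \<open>P\<close> a constant \<open>s\<close> outside \<open>P\<close> is a
  multiple of \<open>D G\<close> modulo \<open>P\<close>, hence a combination of the derivatives of
  F. The induction hypothesis for the larger ideal \<open>iadjoin P s\<close> writes 1 as such a
  combination up to a multiple of \<open>s\<close>.\<close>

lemma unimodular_gradientI:
  assumes "\<And>P. cprime P \<Longrightarrow> \<exists>G. generates_mod P G"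
  obtains a where "\<And>k. a k \<in> B" "(\<Sum>k<N. a k * pderivative k F) = 1"
proof -
  have "unimodular_gradient I" if "cideal I" for I
    using noetherian that
  proof (induction I rule: noetherian_ideal_induct)
    case unit
    show ?case by (auto simp: unimodular_gradient_def mpolys_0 intro!: exI[of _ "\<lambda>_. 0"])
  next
    case (prime P)
    note id = cprimeD(1)[OF prime(1)] and idc = cideal_coeffs_in[OF cprimeD(1)[OF prime(1)]]
    obtain G where G: "generates_mod P G" using assms[OF prime(1)] by blast
    obtain s z where s: "s \<notin> P" "z \<in> B" "mpol_const s - z * D G \<in> coeffs_in P"
      using generates_mod_D[OF prime(1) G] by blast
    have "G \<in> B" using G by (simp add: generates_mod_def A_B)
    then obtain c where c: "\<And>k. c k \<in> B" "D G = (\<Sum>k<N. pderivative k F * c k)"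
      using D_gradient_F by blast
    have "unimodular_gradient (iadjoin P s)"
      using prime(2) cideal_iadjoin[OF id] iadjoin_supset[OF id s(1)] by blast
    then obtain a where a: "\<And>k. a k \<in> B"
      and 1: "1 - (\<Sum>k<N. a k * pderivative k F) \<in> coeffs_in (iadjoin P s)"
      unfolding unimodular_gradient_def by blast
    have "1 - (\<Sum>k<N. a k * pderivative k F) \<in> B"
      using a by (intro mpolys_closed mpolys_pderivative A_B[OF F_A])
    then obtain x r where xr: "x \<in> coeffs_in P" "r \<in> B"
      "1 - (\<Sum>k<N. a k * pderivative k F) = x + mpol_const s * r"
      by (rule coeffs_in_iadjoin[OF id 1])
    have "1 - (\<Sum>k<N. (a k + r * z * c k) * pderivative k F) =
        1 - (\<Sum>k<N. a k * pderivative k F) - r * z * D G"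
      by (simp add: c(2) sum_distrib_left sum.distrib algebra_simps del: sum.lessThan_Suc)
    also have "\<dots> = x + r * (mpol_const s - z * D G)"
      unfolding xr(3) by (simp add: algebra_simps)
    also have "\<dots> \<in> coeffs_in P" by (intro cideal_add[OF idc] cideal_mult[OF idc] xr s)
    finally show ?case
      unfolding unimodular_gradient_def using a c(1) xr(2) s(2)
      by (intro exI[of _ "\<lambda>k. a k + r * z * c k"] conjI allI) (auto intro!: mpolys_closed)
  next
    case (step I b)
    note idc = cideal_coeffs_in[OF step(1)]
    obtain a a' where a: "\<And>k. a k \<in> B" "\<And>k. a' k \<in> B"
      and 1: "1 - (\<Sum>k<N. a k * pderivative k F) \<in> coeffs_in (iadjoin I b)"
      and 2: "1 - (\<Sum>k<N. a' k * pderivative k F) \<in> coeffs_in (iquot I b)"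
      using step(2,3) unfolding unimodular_gradient_def by blast
    let ?s = "\<Sum>k<N. a k * pderivative k F" and ?t = "\<Sum>k<N. a' k * pderivative k F"
    have sB: "?s \<in> B" using a by (intro mpolys_closed mpolys_pderivative A_B[OF F_A])
    then obtain x r where xr: "x \<in> coeffs_in I" "r \<in> B" "1 - ?s = x + mpol_const b * r"
      by (rule_tac coeffs_in_iadjoin[OF step(1) 1 mpolys_diff[OF mpolys_1 sB]])
    \<comment> \<open>If \<open>?s\<close> is 1 modulo I + (b) and \<open>?t\<close> is 1 modulo (I
      : b), then (1 - \<open>?s\<close>)(1 - \<open>?t\<close>) lies in the extension of I; the new
      coefficients are read off from this product.\<close>
    have "1 - (\<Sum>k<N. (a k + a' k - ?s * a' k) * pderivative k F) = 1 - ?s - ?t + ?s * ?t"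
    proof -
      have "(\<Sum>k<N. (a k + a' k - x * a' k) * pderivative k F) = ?s + ?t - x * ?t" for x
        by (simp only: left_diff_distrib distrib_right sum_subtractf sum.distrib mult.assoc sum_distrib_left)
      then show ?thesis by (simp del: sum.lessThan_Suc)
    qed
    also have "\<dots> = (1 - ?s) * (1 - ?t)" by (simp add: algebra_simps del: sum.lessThan_Suc)
    also have "\<dots> = x * (1 - ?t) + r * (mpol_const b * (1 - ?t))"
      unfolding xr(3) by (simp add: algebra_simps del: sum.lessThan_Suc)
    also have "\<dots> \<in> coeffs_in I"
      using 2 by (intro cideal_add[OF idc cideal_mult2[OF idc xr(1)] cideal_mult[OF idc]])
        (simp only: const_mult_mem_coeffs_in)
    finally show ?case
      unfolding unimodular_gradient_def using a sB
      by (intro exI[of _ "\<lambda>k. a k + a' k - ?s * a' k"] conjI allI) (auto intro!: mpolys_closed simp del: sum.lessThan_Suc)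
  qed
  from this[OF cideal_zero] show ?thesis using that by (auto simp: unimodular_gradient_def)
qed

end

lemma ev_cong_ideal:
  assumes "comm_ring_hom h" and I: "cideal I" and q: "q \<in> mpolys M"
    and G: "\<And>i. i < M \<Longrightarrow> G i - G' i \<in> I"
  shows "ev h G q - ev h G' q \<in> I"
proof -
  interpret comm_ring_hom h by fact
  show ?thesis
    using q
  proof (induction q rule: mpolys_ring_induct)
    case (const a)
    then show ?case by (simp add: ev_const cideal_0[OF I])
  next
    case (var i)
    then show ?case by (simp add: ev_mvar G)
  next
    case (add p q)
    have "ev h G (p + q) - ev h G' (p + q) = (ev h G p - ev h G' p) + (ev h G q - ev h G' q)"
      by (simp add: ev_add)
    then show ?case using cideal_add[OF I add.IH] by simp
  next
    case (mult p q)
    have "ev h G (p * q) - ev h G' (p * q) =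
        ev h G p * (ev h G q - ev h G' q) + (ev h G p - ev h G' p) * ev h G' q"
      by (simp add: ev_mult algebra_simps)
    then show ?case using cideal_add[OF I cideal_mult[OF I mult.IH(2)] cideal_mult2[OF I mult.IH(1)]] by simp
  qed
qed

lemma exponent_bound: "\<exists>d. \<forall>m \<in> keys p. (g m :: nat) < d"
proof (intro exI ballI)
  fix m assume "m \<in> keys p"
  then have "g m \<le> Max (g ` keys p)" by simp
  then show "g m < Suc (Max (g ` keys p))" by simp
qed

text \<open>Over the domain R/P a divisor of a nonzero constant is constant, because in each
  variable its degree is at most that of the product.\<close>

lemma unit_mod_prime:
  fixes u w :: "'a::comm_ring_1 mpol"
  assumes P: "cprime P" and s: "s \<notin> P" and uw: "mpol_const s - u * w \<in> coeffs_in P"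
  obtains r where "r \<notin> P" "u - mpol_const r \<in> coeffs_in P"
proof -
  note id = cprimeD(1)[OF P] and idc = cideal_coeffs_in[OF cprimeD(1)[OF P]]
  have uw_notin: "u * w \<notin> coeffs_in P"
    using cideal_add[OF idc uw, of "u * w"] s by (auto simp: const_mem_coeffs_in[OF id])
  then have w: "w \<notin> coeffs_in P" using cideal_mult[OF idc] by blast
  have u0: "m = 0" if m: "lookup u m \<notin> P" for m
  proof -
    have "lookup m i < 1" for i
    proof (rule degree_mod_prime_le[OF P w _ m])
      fix m' assume m': "lookup (u * w) m' \<notin> P"
      have "lookup (mpol_const s) m' - lookup (u * w) m' \<in> P"
        using coeffs_inD[OF uw, of m'] by (simp add: lookup_minus)
      then have "m' = 0" using m' cideal_uminus[OF id] by (fastforce simp: lookup_const split: if_splits)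
      then show "lookup m' i < 1" by simp
    qed
    then show ?thesis by (intro poly_mapping_eqI) simp
  qed
  then have "u - mpol_const (lookup u 0) \<in> coeffs_in P"
    by (auto simp: coeffs_in_def lookup_minus lookup_const cideal_0[OF id])
  moreover have "lookup u 0 \<notin> P"
  proof
    assume "lookup u 0 \<in> P"
    then have "lookup u m \<in> P" for m using u0[of m] by (cases "m = 0") auto
    then have "u \<in> coeffs_in P" by (simp add: coeffs_in_def)
    then show False using uw_notin cideal_mult2[OF idc] by blast
  qed
  ultimately show ?thesis using that by blast
qed

section \<open>Integration over R and derivations of A\<close>

context stably_polynomial
begin

text \<open>Integration monomial by monomial divides by the raised exponent, which is a unit of
  R.\<close>

lemma antiderivative:
  assumes "q \<in> mpolys M" "i < M"
  shows "\<exists>q' \<in> mpolys M. pderivative i q' = (q :: 'r mpol)"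
  using assms(1)
proof (induction q rule: mpolys_induct)
  case zero
  then show ?case by (auto intro!: bexI[of _ 0] mpolys_0)
next
  case (single m b)
  obtain c :: 'r where c: "of_nat (Suc (lookup m i)) * c = 1" using rational by blast
  let ?q = "single (m + single i 1) (c * b)"
  have "keys (m + single i 1) \<subseteq> {..<M}"
    using single Poly_Mapping.keys_add[of m "single i 1"] \<open>i < M\<close> by auto
  then have "?q \<in> mpolys M" by (rule mpolys_single)
  moreover have "pderivative i ?q = single m b"
    using c by (simp add: pderivative_single lookup_add flip: mult.assoc)
  ultimately show ?case by blast
next
  case (add p q)
  then obtain p' q' where "p' \<in> mpolys M" "q' \<in> mpolys M" "pderivative i p' = p" "pderivative i q' = q"
    by blast
  then show ?case by (intro bexI[of _ "p' + q'"]) (auto simp: pderivative_add mpolys_add)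
qed

text \<open>A monomial other than 1 contains some variable; the derivative in that variable carries
  its coefficient times a positive integer, that is, times a unit.\<close>

lemma constant_mod:
  assumes I: "cideal I" and f: "f \<in> mpolys M" and d: "\<And>k. k < M \<Longrightarrow> pderivative k f \<in> coeffs_in I"
  shows "f - mpol_const (lookup f 0 :: 'r) \<in> coeffs_in I"
proof -
  have "lookup f m \<in> I" if "m \<noteq> 0" for m
  proof (cases "m \<in> keys f")
    case True
    have "\<exists>k. lookup m k \<noteq> 0" using that by (auto simp: poly_mapping_eq_iff fun_eq_iff)
    then obtain k where k: "lookup m k \<noteq> 0" by blast
    then have "k < M" using f True mpolysD by (metis in_keys_iff)
    define m' where "m' = m - single k 1"
    have m: "m = m' + single k 1"
      unfolding m'_def using k
      by (intro poly_mapping_eqI) (auto simp: lookup_add lookup_minus lookup_single when_def)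
    obtain c :: 'r where c: "of_nat (Suc (lookup m' k)) * c = 1" using rational by blast
    have "of_nat (Suc (lookup m' k)) * lookup f m \<in> I"
      using coeffs_inD[OF d[OF \<open>k < M\<close>], of m'] by (simp only: lookup_pderivative m)
    then show ?thesis by (rule cideal_unit[OF I c])
  qed (simp add: in_keys_iff cideal_0[OF I])
  then show ?thesis by (auto simp: coeffs_in_def lookup_minus lookup_const cideal_0[OF I])
qed

text \<open>R-derivations of A; the last clause says that \<open>d\<close> induces a derivation of
  A/IA for every ideal I.\<close>

definition A_derivation :: "('r mpol \<Rightarrow> 'r mpol) \<Rightarrow> bool" where
  "A_derivation d \<longleftrightarrow> (\<forall>x\<in>A. d x \<in> A) \<and> (\<forall>a. d (mpol_const a) = 0) \<and>
     (\<forall>x\<in>A. \<forall>y\<in>A. d (x + y) = d x + d y) \<and> (\<forall>x\<in>A. \<forall>y\<in>A. d (x * y) = x * d y + y * d x) \<and>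
     (\<forall>I. cideal I \<longrightarrow> (\<forall>x \<in> A \<inter> coeffs_in I. d x \<in> coeffs_in I))"

lemma A_derivationD:
  assumes "A_derivation d"
  shows "x \<in> A \<Longrightarrow> d x \<in> A" "d (mpol_const a) = 0" "x \<in> A \<Longrightarrow> y \<in> A \<Longrightarrow> d (x + y) = d x + d y"
    "x \<in> A \<Longrightarrow> y \<in> A \<Longrightarrow> d (x * y) = x * d y + y * d x"
    "cideal I \<Longrightarrow> x \<in> A \<Longrightarrow> x \<in> coeffs_in I \<Longrightarrow> d x \<in> coeffs_in I"
  using assms by (auto simp: A_derivation_def)

lemma A_derivation_const_mult:
  "A_derivation d \<Longrightarrow> x \<in> A \<Longrightarrow> d (mpol_const a * x) = mpol_const a * d x"
  by (simp add: A_derivationD A_const)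

lemma A_derivation_diff:
  assumes d: "A_derivation d" and "x \<in> A" "y \<in> A"
  shows "d (x - y) = d x - d y"
proof -
  have "x - y + y = x" by simp
  then have "d x = d (x - y) + d y"
    using A_derivationD(3)[OF d A_diff[OF assms(2,3)] assms(3)] by simp
  then show ?thesis by simp
qed

lemma A_derivation_ev:
  assumes d: "A_derivation d" and q: "q \<in> mpolys M" and G: "\<And>i. i < M \<Longrightarrow> G i \<in> A"
  shows "d (ev mpol_const G q) = (\<Sum>k<M. ev mpol_const G (pderivative k q) * d (G k))"
proof -
  have "d (ev mpol_const G q) = (\<Sum>k<M. ev mpol_const G (pderivative k q) * d (ev mpol_const G (mvar k)))"
    using q
    by (rule derivation_chain_rule[where \<phi> = "ev mpol_const G" and d = "\<lambda>q. d (ev mpol_const G q)"])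
      (use mpol_const.ev_const[of G 1] in \<open>simp_all add: mpol_const.ev_add mpol_const.ev_mult
        mpol_const.ev_const A_derivationD[OF d] A_ev[OF _ G]\<close>)
  then show ?thesis by (simp add: mpol_const.ev_mvar)
qed

abbreviation evF :: "'r mpol \<Rightarrow> 'r mpol" where "evF \<equiv> ev mpol_const (\<lambda>_. F)"

abbreviation evFG :: "'r mpol \<Rightarrow> 'r mpol \<Rightarrow> 'r mpol" where "evFG G \<equiv> ev mpol_const ((!) [F, G])"

lemma evF_A: "q \<in> mpolys 1 \<Longrightarrow> evF q \<in> A"
  by (rule A_ev) (auto simp: F_A)

lemma evFG_evF: "q \<in> mpolys 1 \<Longrightarrow> evFG G q = evF q"
  by (erule ev_cong) simp

lemma nth_FG_A: "G \<in> A \<Longrightarrow> i < 2 \<Longrightarrow> [F, G] ! i \<in> A"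
  by (auto simp: less_2_cases_iff F_A)

lemma evFG_A: "G \<in> A \<Longrightarrow> q \<in> mpolys 2 \<Longrightarrow> evFG G q \<in> A"
  by (rule A_ev) (auto simp: nth_FG_A)

lemma pderivative_evF:
  "q \<in> mpolys 1 \<Longrightarrow> pderivative k (evF q) = evF (pderivative 0 q) * pderivative k F"
  using derivation_chain_rule[where N = 1 and p = q and \<phi> = evF and d = "\<lambda>q. pderivative k (evF q)"]
    mpol_const.ev_const[of "\<lambda>_. F" 1]
  by (simp add: mpol_const.ev_add mpol_const.ev_mult mpol_const.ev_const mpol_const.ev_mvar
      pderivative_add pderivative_mult)

lemma A_derivation_evF: "A_derivation d \<Longrightarrow> d F = 0 \<Longrightarrow> q \<in> mpolys 1 \<Longrightarrow> d (evF q) = 0"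
  using A_derivation_ev[of d q 1 "\<lambda>_. F"] by (simp add: F_A)

lemma A_derivation_evFG:
  "A_derivation d \<Longrightarrow> G \<in> A \<Longrightarrow> q \<in> mpolys 2 \<Longrightarrow>
    d (evFG G q) = evFG G (pderivative 0 q) * d F + evFG G (pderivative 1 q) * d G"
  using A_derivation_ev[of d q 2 "(!) [F, G]"] by (simp add: nth_FG_A numeral_2_eq_2)

end

section \<open>Consequences of a unimodular gradient\<close>

locale unimodular = stably_polynomial n A T F
  for n :: nat and A :: "'r::comm_ring_1 mpol set" and T and F +
  fixes a :: "nat \<Rightarrow> 'r mpol"
  assumes a_B: "a k \<in> mpolys (Suc (Suc n))"
    and a_F: "(\<Sum>k<Suc (Suc n). a k * pderivative k F) = 1"
begin

text \<open>The derivation with components \<open>a\<close> maps F to 1. Subtracting its values at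
  the \<open>T i\<close> times the derivations \<open>dT i\<close> makes it vanish on T without
  changing it on A, where the \<open>dT i\<close> vanish. Its retraction is
  \<open>delta\<close>.\<close>

definition v :: "nat \<Rightarrow> 'r mpol" where
  "v k = a k - (\<Sum>i<n. (\<Sum>l<N. a l * pderivative l (T i)) * dT i (mvar k))"

definition V :: "nat \<Rightarrow> nat \<Rightarrow> 'r mpol" where
  "V i k = (case i of 0 \<Rightarrow> v k | Suc j \<Rightarrow> dT j (mvar k))"

text \<open>The signed maximal minors of the right inverse \<open>V\<close>: the row that completes
  the Jacobian matrix to an invertible square matrix.\<close>

definition \<eta> :: "nat \<Rightarrow> 'r mpol" where
  "\<eta> k = rdet (Suc n) V (unit_row k)"

definition delta :: "'r mpol \<Rightarrow> 'r mpol" where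
  "delta h = proj (\<Sum>l<N. pderivative l h * v l)"

definition Delta :: "'r mpol \<Rightarrow> 'r mpol" where
  "Delta h = proj (D h)"

text \<open>The vector \<open>\<eta>\<close> retracted to A and carried back to the variables by the
  Jacobian matrix of the retraction. It takes the place of \<open>\<eta>\<close> once the
  coefficients of the gradient formula have to lie in A.\<close>

definition \<theta> :: "nat \<Rightarrow> 'r mpol" where
  "\<theta> j = (\<Sum>k<N. proj (\<eta> k) * pderivative j (proj (mvar k)))"

lemma v_B: "k < N \<Longrightarrow> v k \<in> B"
  unfolding v_def
  by (intro mpolys_diff mpolys_sum mpolys_mult a_B mpolys_pderivative T_mpolys dT_B mpolys_mvar) auto

lemma V_B: "k < N \<Longrightarrow> V i k \<in> B"
  by (auto simp: V_def v_B dT_B mpolys_mvar split: nat.split)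

lemma \<eta>_B: "\<eta> k \<in> B"
  unfolding \<eta>_def by (rule rdet_closed) (auto simp: mpolys_closed V_B simp del: less_Suc_eq)

lemma sum_pderivative_v:
  assumes "f \<in> B"
  shows "(\<Sum>k<N. pderivative k f * v k) = (\<Sum>k<N. a k * pderivative k f) -
    (\<Sum>i<n. (\<Sum>l<N. a l * pderivative l (T i)) * dT i f)"
proof -
  have "(\<Sum>k<N. pderivative k f * v k) = (\<Sum>k<N. a k * pderivative k f) -
      (\<Sum>k<N. \<Sum>i<n. (\<Sum>l<N. a l * pderivative l (T i)) * (pderivative k f * dT i (mvar k)))"
    by (simp add: v_def right_diff_distrib sum_subtractf sum_distrib_left mult_ac del: sum.lessThan_Suc)
  also have "(\<Sum>k<N. \<Sum>i<n. (\<Sum>l<N. a l * pderivative l (T i)) * (pderivative k f * dT i (mvar k))) =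
      (\<Sum>i<n. (\<Sum>l<N. a l * pderivative l (T i)) * dT i f)"
    by (subst sum.swap) (simp only: dT_chain[OF assms] sum_distrib_left)
  finally show ?thesis .
qed

lemma J_V:
  assumes "i < Suc n" "j < Suc n"
  shows "(\<Sum>k<N. J i k * V j k) = (if i = j then 1 else 0)"
proof -
  have delta: "(\<Sum>i<n. c i * dT i (T j)) = c j" if "j < n" for j and c :: "nat \<Rightarrow> 'r mpol"
    using that by (simp add: dT_T if_distrib[of "\<lambda>x. _ * x"] sum.delta cong: if_cong)
  show ?thesis
  proof (cases i; cases j)
    assume "i = 0" "j = 0"
    then show ?thesis
      using sum_pderivative_v[OF A_B[OF F_A]] a_F
      by (simp add: J_0 V_def dT_A[OF F_A] del: sum.lessThan_Suc)
  next
    fix i' assume "i = Suc i'" "j = 0"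
    then show ?thesis
      using sum_pderivative_v[OF T_mpolys[of i']] delta assms
      by (simp add: J_Suc V_def del: sum.lessThan_Suc)
  next
    fix j' assume "i = 0" "j = Suc j'"
    then show ?thesis
      using dT_chain[OF A_B[OF F_A], of j']
      by (simp add: J_0 V_def dT_A[OF F_A] del: sum.lessThan_Suc)
  next
    fix i' j' assume "i = Suc i'" "j = Suc j'"
    then show ?thesis
      using dT_chain[OF T_mpolys[of i'], of j'] assms
      by (auto simp add: J_Suc V_def dT_T simp del: sum.lessThan_Suc)
  qed
qed

lemma sum_\<eta>_\<kappa>: "(\<Sum>k<N. \<eta> k * \<kappa> k) = 1"
  using sum_maximal_minors_right_inverse[OF J_V] by (simp add: \<eta>_def \<kappa>_def)

text \<open>The gradient of \<open>h\<close> is expanded in the gradients of F and T and the vector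
  \<open>\<eta>\<close>. The coefficients at the gradients of T are the \<open>dT i h\<close>, which
  vanish for \<open>h\<close> in A, and the coefficient at \<open>\<eta>\<close> is
  \<open>D h\<close>.\<close>

lemma gradient_A_proj:
  assumes h: "h \<in> A" and k: "k < N"
  shows "proj (pderivative k h) = delta h * proj (pderivative k F) + Delta h * proj (\<eta> k)"
proof -
  have "pderivative k h =
      (\<Sum>i<Suc n. (\<Sum>l<N. pderivative l h * V i l) * J i k) + rdet (Suc n) J (\<lambda>k. pderivative k h) * \<eta> k"
    unfolding \<eta>_def using J_V k by (rule row_expansion_right_inverse)
  also have "(\<Sum>i<Suc n. (\<Sum>l<N. pderivative l h * V i l) * J i k) =
      (\<Sum>l<N. pderivative l h * v l) * pderivative k F +
      (\<Sum>i<n. (\<Sum>l<N. pderivative l h * dT i (mvar l)) * J (Suc i) k)"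
    by (simp add: sum.lessThan_Suc_shift[of _ n] J_0 V_def del: sum.lessThan_Suc)
  also have "(\<Sum>i<n. (\<Sum>l<N. pderivative l h * dT i (mvar l)) * J (Suc i) k) = 0"
    by (simp add: dT_chain[OF A_B[OF h], symmetric] dT_A[OF h] del: sum.lessThan_Suc)
  finally have "pderivative k h = (\<Sum>l<N. pderivative l h * v l) * pderivative k F + D h * \<eta> k"
    by (simp add: D_rdet del: sum.lessThan_Suc)
  moreover have "(\<Sum>l<N. pderivative l h * v l) \<in> B"
    using h by (intro mpolys_sum mpolys_mult mpolys_pderivative v_B A_B) auto
  ultimately show ?thesis
    using h F_A \<eta>_B D_B[OF A_B[OF h]]
    by (simp add: proj_add proj_mult mpolys_mult mpolys_pderivative A_B delta_def Delta_def
        del: sum.lessThan_Suc)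
qed

text \<open>Retracting the coefficients into A also retracts the gradients, but \<open>h\<close> and
  F are fixed by the retraction, so its chain rule recovers their gradients from the retracted
  ones.\<close>

lemma gradient_A:
  assumes h: "h \<in> A"
  shows "pderivative j h = delta h * pderivative j F + Delta h * \<theta> j"
proof -
  have "pderivative j h = (\<Sum>k<N. proj (pderivative k h) * pderivative j (proj (mvar k)))"
    using pderivative_proj[OF A_B[OF h], of j] by (simp only: proj_id[OF h])
  also have "\<dots> = (\<Sum>k<N. (delta h * proj (pderivative k F) + Delta h * proj (\<eta> k)) * pderivative j (proj (mvar k)))"
    by (rule sum.cong) (simp_all add: gradient_A_proj[OF h])
  also have "\<dots> = delta h * (\<Sum>k<N. proj (pderivative k F) * pderivative j (proj (mvar k))) + Delta h * \<theta> j"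
    by (simp only: \<theta>_def distrib_right sum.distrib sum_distrib_left mult.assoc)
  also have "(\<Sum>k<N. proj (pderivative k F) * pderivative j (proj (mvar k))) = pderivative j F"
    using pderivative_proj[OF A_B[OF F_A], of j] by (simp only: proj_id[OF F_A])
  finally show ?thesis .
qed

lemma A_derivation_Delta: "A_derivation Delta"
  unfolding A_derivation_def Delta_def
  by (auto simp: D_add D_mult D_const proj_id A_0 proj_add proj_mult A_B D_B mpolys_mult
      intro: proj_A proj_coeffs_in D_coeffs_in)

lemma A_derivation_delta: "A_derivation delta"
proof -
  let ?s = "\<lambda>h. \<Sum>l<N. pderivative l h * v l"
  have B: "?s h \<in> B" if "h \<in> B" for h
    using that by (intro mpolys_sum mpolys_mult mpolys_pderivative v_B) auto
  have "?s (x + y) = ?s x + ?s y" "?s (x * y) = x * ?s y + y * ?s x" for x y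
    by (simp_all only: pderivative_add pderivative_mult distrib_right sum.distrib sum_distrib_left mult.assoc)
  moreover have "?s h \<in> coeffs_in I" if "cideal I" "h \<in> coeffs_in I" for h I
    using that by (intro cideal_sum cideal_mult2 cideal_coeffs_in pderivative_coeffs_in)
  moreover have "?s (mpol_const a) = 0" for a by simp
  ultimately show ?thesis
    unfolding A_derivation_def delta_def
    by (auto simp: proj_id A_0 proj_add proj_mult A_B B mpolys_mult simp del: sum.lessThan_Suc
        intro: proj_A proj_coeffs_in)
qed

lemma delta_F: "delta F = 1"
  using J_V[of 0 0] by (simp add: delta_def J_0 V_def proj_id A_1 del: sum.lessThan_Suc)

lemma Delta_F: "Delta F = 0"
  by (simp add: Delta_def D_F proj_id A_0)

text \<open>The induction is on the degree of \<open>h\<close> modulo \<open>P\<close> in a variable \<open>i\<close> with \<open>\<partial>F/\<partial>X\<^sub>i \<noteq> 0\<close>: symmetry of the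
  second derivatives makes \<open>g\<close> satisfy the same hypothesis, and \<open>g\<close> has smaller degree than \<open>h\<close>.\<close>

lemma gradient_multiple_mod_prime:
  assumes P: "cprime P" and i: "pderivative i F \<notin> coeffs_in P"
  shows "h \<in> B \<Longrightarrow> g \<in> B \<Longrightarrow> (\<And>k. pderivative k h - g * pderivative k F \<in> coeffs_in P) \<Longrightarrow>
    (\<And>m. lookup h m \<notin> P \<Longrightarrow> lookup m i < d) \<Longrightarrow>
    \<exists>q \<in> mpolys 1. h - evF q \<in> coeffs_in P"
proof (induction d arbitrary: h g)
  case 0
  have "h \<in> coeffs_in P" using "0.prems"(4) by (auto simp: coeffs_in_def)
  then show ?case by (auto intro!: bexI[of _ 0] mpolys_0)
next
  case (Suc d)
  note id = cprimeD(1)[OF P] and idc = cideal_coeffs_in[OF cprimeD(1)[OF P]]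
  \<comment> \<open>The derivative of \<open>g\<close> along \<open>a\<close>: since the gradient of
    F takes the value 1 on \<open>a\<close>, a gradient of \<open>g\<close> proportional to that of
    F must have this factor.\<close>
  define g' where "g' = (\<Sum>l<N. a l * pderivative l g)"
  have "pderivative j g - g' * pderivative j F \<in> coeffs_in P" for j
  proof -
    have E: "pderivative j g * pderivative l F - pderivative l g * pderivative j F \<in> coeffs_in P" for l
    proof -
      have "pderivative j g * pderivative l F - pderivative l g * pderivative j F =
          pderivative l (pderivative j h - g * pderivative j F) - pderivative j (pderivative l h - g * pderivative l F)"
        by (simp add: pderivative_diff pderivative_mult pderivative_commute[of l j] algebra_simps)
      also have "\<dots> \<in> coeffs_in P"
        by (intro cideal_diff[OF idc] pderivative_coeffs_in[OF id] Suc.prems(3))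
      finally show ?thesis .
    qed
    have "pderivative j g = pderivative j g * (\<Sum>l<N. a l * pderivative l F)" by (simp only: a_F mult_1_right)
    then have "pderivative j g - g' * pderivative j F =
        (\<Sum>l<N. a l * (pderivative j g * pderivative l F - pderivative l g * pderivative j F))"
      by (simp only: g'_def sum_distrib_left sum_distrib_right right_diff_distrib sum_subtractf mult_ac)
    also have "\<dots> \<in> coeffs_in P" by (intro cideal_sum[OF idc] cideal_mult[OF idc] E)
    finally show ?thesis .
  qed
  moreover have "g' \<in> B"
    unfolding g'_def using Suc.prems(2) by (intro mpolys_sum mpolys_mult mpolys_pderivative a_B)
  \<comment> \<open>The product of \<open>g\<close> and the derivative of F is the derivative of
    \<open>h\<close> modulo \<open>P\<close>, which has lost one degree in \<open>i\<close>;
    dividing by a nonzero factor over a domain does not raise the degree.\<close>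
  moreover have "lookup m i < d" if m: "lookup g m \<notin> P" for m
  proof (rule degree_mod_prime_le[OF P i _ m])
    fix m' assume m': "lookup (g * pderivative i F) m' \<notin> P"
    have "lookup (pderivative i h) m' \<notin> P"
    proof
      assume "lookup (pderivative i h) m' \<in> P"
      then show False
        using m' cideal_diff[OF id, of "lookup (pderivative i h) m'"]
          coeffs_inD[OF Suc.prems(3)[of i], of m'] by (fastforce simp: lookup_minus)
    qed
    then have "lookup h (m' + single i 1) \<notin> P"
      using cideal_mult[OF id] by (auto simp: lookup_pderivative)
    from Suc.prems(4)[OF this] show "lookup m' i < d" by (simp add: lookup_add)
  qed
  ultimately obtain q where q: "q \<in> mpolys 1" "g - evF q \<in> coeffs_in P"
    using Suc.IH[OF Suc.prems(2)] by blast
  \<comment> \<open>As \<open>g\<close> is a polynomial in F modulo \<open>P\<close>, the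
    antiderivative of that polynomial, evaluated at F, has the same gradient as \<open>h\<close>, so
    the difference is a constant modulo \<open>P\<close>.\<close>
  obtain q' where q': "q' \<in> mpolys 1" "pderivative 0 q' = q"
    using antiderivative[OF q(1), of 0] by auto
  define h' where "h' = h - evF q'"
  have "h' \<in> B" using Suc.prems(1) evF_A[OF q'(1)] by (simp add: h'_def mpolys_diff A_B)
  moreover have "pderivative k h' \<in> coeffs_in P" for k
  proof -
    have "pderivative k h' = (pderivative k h - g * pderivative k F) + (g - evF q) * pderivative k F"
      by (simp add: h'_def pderivative_diff pderivative_evF[OF q'(1)] q'(2) algebra_simps)
    then show ?thesis
      using cideal_add[OF idc Suc.prems(3)[of k] cideal_mult2[OF idc q(2)]] by simp
  qed
  ultimately have "h' - mpol_const (lookup h' 0) \<in> coeffs_in P"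
    by (rule constant_mod[OF id])
  then have "h - evF (q' + mpol_const (lookup h' 0)) \<in> coeffs_in P"
    by (simp add: h'_def mpol_const.ev_add mpol_const.ev_const algebra_simps)
  then show ?case using q'(1) by (blast intro: mpolys_add mpolys_const)
qed

lemma Delta_evF: "q \<in> mpolys 1 \<Longrightarrow> Delta (evF q) = 0"
  by (rule A_derivation_evF[OF A_derivation_Delta Delta_F])

lemmas Delta_diff = A_derivation_diff[OF A_derivation_Delta]
lemmas Delta_add = A_derivationD(3)[OF A_derivation_Delta]
lemmas Delta_const_mult = A_derivation_const_mult[OF A_derivation_Delta]
lemmas Delta_A = A_derivationD(1)[OF A_derivation_Delta]
lemmas Delta_coeffs_in = A_derivationD(5)[OF A_derivation_Delta]

text \<open>At a prime \<open>P\<close> the gradient of F does not vanish modulo \<open>P\<close>,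
  and \<open>gradient_A\<close> makes the gradient of \<open>x\<close> proportional to it. In the
  induction step \<Delta> kills polynomials in F, so an error y + bz has b \<Delta>(z) in the
  extension of I, and the hypothesis for the colon ideal applies to z.\<close>

lemma kernel_Delta_mod:
  assumes "cideal I" "x \<in> A" "Delta x \<in> coeffs_in I"
  shows "\<exists>q \<in> mpolys 1. x - evF q \<in> coeffs_in I"
proof -
  have "\<forall>x\<in>A. Delta x \<in> coeffs_in I \<longrightarrow> (\<exists>q \<in> mpolys 1. x - evF q \<in> coeffs_in I)"
    using noetherian assms(1)
  proof (induction I rule: noetherian_ideal_induct)
    case unit
    show ?case by (auto intro: mpolys_0)
  next
    case (prime P)
    note P = prime(1) and idc = cideal_coeffs_in[OF cprimeD(1)[OF prime(1)]]
    have "\<exists>i. pderivative i F \<notin> coeffs_in P"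
    proof (rule ccontr)
      assume "\<not> ?thesis"
      then have "(\<Sum>k<N. a k * pderivative k F) \<in> coeffs_in P"
        by (intro cideal_sum[OF idc] cideal_mult[OF idc]) blast
      then have "1 \<in> coeffs_in P" by (simp only: a_F)
      then show False using cprimeD(2)[OF cprime_coeffs_in[OF P]] by blast
    qed
    then obtain i where i: "pderivative i F \<notin> coeffs_in P" by blast
    show ?case
    proof (intro ballI impI)
      fix x assume x: "x \<in> A" "Delta x \<in> coeffs_in P"
      obtain d where d: "\<forall>m\<in>keys x. lookup m i < d"
        using exponent_bound[of x "\<lambda>m. lookup m i"] by blast
      show "\<exists>q \<in> mpolys 1. x - evF q \<in> coeffs_in P"
      proof (rule gradient_multiple_mod_prime[OF P i A_B[OF x(1)]])
        show "delta x \<in> B" using x A_derivationD(1)[OF A_derivation_delta] A_B by blast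
        show "pderivative k x - delta x * pderivative k F \<in> coeffs_in P" for k
          using cideal_mult2[OF idc x(2)] by (simp add: gradient_A[OF x(1)])
        show "lookup m i < d" if "lookup x m \<notin> P" for m
          using that d cideal_0[OF cprimeD(1)[OF P]] by (auto simp: in_keys_iff)
      qed
    qed
  next
    case (step I b)
    note idc = cideal_coeffs_in[OF step(1)]
    have sub: "coeffs_in I \<subseteq> coeffs_in (iadjoin I b)"
      by (rule coeffs_in_mono[OF iadjoin_subset])
    show ?case
    proof (intro ballI impI)
      fix x assume x: "x \<in> A" "Delta x \<in> coeffs_in I"
      then obtain q where q: "q \<in> mpolys 1" "x - evF q \<in> coeffs_in (iadjoin I b)"
        using step(2) sub by blast
      have "x - evF q \<in> A" using x q evF_A A_diff by blast
      from coeffs_in_iadjoin_A[OF step(1) this q(2)]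
      obtain y z where yz: "y \<in> A" "y \<in> coeffs_in I" "z \<in> A" "x - evF q = y + mpol_const b * z" by blast
      have "Delta (x - evF q) = Delta x"
        using x q by (simp add: Delta_diff evF_A Delta_evF)
      moreover have "Delta (y + mpol_const b * z) = Delta y + mpol_const b * Delta z"
        using yz by (simp add: Delta_add Delta_const_mult A_mult A_const)
      ultimately have "mpol_const b * Delta z = Delta x - Delta y"
        by (simp add: yz(4)) (metis add_diff_cancel_left')
      also have "\<dots> \<in> coeffs_in I"
        by (rule cideal_diff[OF idc x(2) Delta_coeffs_in[OF step(1) yz(1,2)]])
      finally have "Delta z \<in> coeffs_in (iquot I b)" by (simp add: const_mult_mem_coeffs_in)
      then obtain q' where q': "q' \<in> mpolys 1" "z - evF q' \<in> coeffs_in (iquot I b)"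
        using step(3) yz(3) by blast
      have "x - evF (q + mpol_const b * q') = y + mpol_const b * (z - evF q')"
        using yz(4) by (simp add: mpol_const.ev_add mpol_const.ev_mult mpol_const.ev_const algebra_simps)
      also have "\<dots> \<in> coeffs_in I"
        using cideal_add[OF idc yz(2)] q'(2) by (simp add: const_mult_mem_coeffs_in)
      finally show "\<exists>q \<in> mpolys 1. x - evF q \<in> coeffs_in I"
        using q(1) q'(1) by (blast intro: mpolys_closed)
    qed
  qed
  then show ?thesis using assms by blast
qed

text \<open>The retraction turns the relation between \<open>D G\<close> and a constant outside
  \<open>P\<close> into one for \<Delta>(G), which therefore divides a nonzero constant over
  R/P.\<close>

lemma Delta_generator_mod:
  assumes P: "cprime P" and G: "generates_mod P G"
  obtains r where "r \<notin> P" "Delta G - mpol_const r \<in> coeffs_in P"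
proof -
  obtain s z where sz: "s \<notin> P" "z \<in> B" "mpol_const s - z * D G \<in> coeffs_in P"
    using generates_mod_D[OF P G] by blast
  have GB: "D G \<in> B" using G by (simp add: generates_mod_def A_B D_B)
  have "proj (mpol_const s - z * D G) = mpol_const s - proj z * Delta G"
  proof -
    have "mpol_const s - z * D G \<in> B" using sz GB by (intro mpolys_closed)
    then have "proj (mpol_const s - z * D G) + proj (z * D G) = proj (mpol_const s)"
      using proj_add[OF _ mpolys_mult[OF sz(2) GB]] by fastforce
    then show ?thesis using sz(2) GB by (simp add: proj_mult proj_const Delta_def eq_diff_eq)
  qed
  moreover have "proj (mpol_const s - z * D G) \<in> coeffs_in P"
    using sz GB by (intro proj_coeffs_in cprimeD(1)[OF P] mpolys_closed)
  ultimately have "mpol_const s - Delta G * proj z \<in> coeffs_in P" by (simp add: mult.commute)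
  then show ?thesis using unit_mod_prime[OF P sz(1)] that by blast
qed

text \<open>On R[F, G] the derivation \<Delta> acts as the derivative in G, and \<open>delta\<close>
  as the derivative in F plus \<open>delta G\<close> times the derivative in G. So the hypothesis on
  \<open>p\<close> passes to both partial derivatives, which have smaller total degree; what remains
  is the constant term. With I = 0 this is the algebraic independence of F and G.\<close>

lemma purity:
  assumes G: "G \<in> A" "Delta G = 1" and I: "cideal I"
    and p: "p \<in> mpolys 2" "evFG G p \<in> coeffs_in I"
  shows "p \<in> coeffs_in I"
proof -
  note idc = cideal_coeffs_in[OF I]
  obtain d where "\<forall>m\<in>keys p. lookup m 0 + lookup m 1 < d"
    using exponent_bound[of p "\<lambda>m. lookup m 0 + lookup m 1"] by blast
  then show ?thesis
    using p
  proof (induction d arbitrary: p)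
    case 0
    then have "keys p = {}" by blast
    then show ?case by (simp add: cideal_0[OF idc])
  next
    case (Suc d)
    have bound: "\<forall>m\<in>keys (pderivative i p). lookup m 0 + lookup m 1 < d"
      if "i < 2" for i
    proof
      fix m assume "m \<in> keys (pderivative i p)"
      then have "m + single i 1 \<in> keys p"
        by (auto simp: in_keys_iff lookup_pderivative)
      with Suc.prems(1) have "lookup (m + single i 1) 0 +
          lookup (m + single i 1) 1 < Suc d" by blast
      then show "lookup m 0 + lookup m 1 < d"
        using that by (auto simp: lookup_add lookup_single less_2_cases_iff)
    qed
    have A: "evFG G p \<in> A" using Suc.prems(2) G by (simp add: evFG_A)
    have "Delta (evFG G p) = evFG G (pderivative 1 p)"
      using A_derivation_evFG[OF A_derivation_Delta G(1) Suc.prems(2)] by (simp add: Delta_F G(2))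
    then have 1: "evFG G (pderivative 1 p) \<in> coeffs_in I"
      using Delta_coeffs_in[OF I A Suc.prems(3)] by simp
    have "delta (evFG G p) = evFG G (pderivative 0 p) + evFG G (pderivative 1 p) * delta G"
      using A_derivation_evFG[OF A_derivation_delta G(1) Suc.prems(2)] by (simp add: delta_F)
    then have "evFG G (pderivative 0 p) = delta (evFG G p) - evFG G (pderivative 1 p) * delta G"
      by simp
    also have "\<dots> \<in> coeffs_in I"
      by (intro cideal_diff[OF idc] cideal_mult2[OF idc] 1
          A_derivationD(5)[OF A_derivation_delta I A Suc.prems(3)])
    finally have 0: "evFG G (pderivative 0 p) \<in> coeffs_in I" .
    have "pderivative k p \<in> coeffs_in I" if "k < 2" for k
      using that Suc.IH[OF bound[OF that] mpolys_pderivative[OF Suc.prems(2)]] 0 1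
      by (auto simp: less_2_cases_iff)
    from constant_mod[OF I Suc.prems(2) this]
    have c: "p - mpol_const (lookup p 0) \<in> coeffs_in I" .
    from coeffs_in_ev[OF I this, of "(!) [F, G]"]
    have "evFG G p - evFG G (p - mpol_const (lookup p 0)) \<in> coeffs_in I"
      by (intro cideal_diff[OF idc] Suc.prems(3))
    moreover have "evFG G (p - mpol_const (lookup p 0)) + mpol_const (lookup p 0) = evFG G p"
      using mpol_const.ev_add[of "(!) [F, G]" "p - mpol_const (lookup p 0)"
          "mpol_const (lookup p 0)"] by (simp add: mpol_const.ev_const)
    ultimately have "mpol_const (lookup p 0) \<in> coeffs_in I"
      by (metis add_diff_cancel_left')
    with c show ?case using cideal_add[OF idc c] by fastforce
  qed
qed

end

section \<open>Descent from the generic fibres\<close>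

locale generic_coordinate = unimodular n A T F a
  for n :: nat and A :: "'r::comm_ring_1 mpol set" and T and F and a +
  assumes generic: "minimal_prime (class_ring :: 'r ring) P \<Longrightarrow> \<exists>G. generates_mod P G"
begin

text \<open>The aim is I = 0 and y = 1, but the induction runs through all ideals, and
  \<open>y\<close> ranges over A because the error \<open>z\<close> of an induction step is
  arbitrary.\<close>

lemma Delta_surjective_mod:
  assumes "cideal I" "y \<in> A"
  shows "\<exists>x\<in>A. y - Delta x \<in> coeffs_in I"
proof -
  have "\<forall>y\<in>A. \<exists>x\<in>A. y - Delta x \<in> coeffs_in I"
    using noetherian assms(1)
  proof (induction I rule: noetherian_ideal_induct)
    case unit
    show ?case using A_0 by auto
  next
    case (prime P)
    \<comment> \<open>Being solvable modulo the smaller prime \<open>Q\<close> is the stronger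
      statement, and at \<open>Q\<close> the generic fibre provides a generator
      \<open>G\<close>.\<close>
    obtain Q where Q: "minimal_prime class_ring Q" "cprime Q" "Q \<subseteq> P"
      using minimal_prime_exists[OF prime(1)] by blast
    note id = cprimeD(1)[OF Q(2)] and idc = cideal_coeffs_in[OF cprimeD(1)[OF Q(2)]]
    obtain G where G: "generates_mod Q G" using generic[OF Q(1)] by blast
    then have GA: "G \<in> A" by (simp add: generates_mod_def)
    obtain r where r: "r \<notin> Q" "Delta G - mpol_const r \<in> coeffs_in Q"
      using Delta_generator_mod[OF Q(2) G] by blast
    show ?case
    proof
      fix y assume y: "y \<in> A"
      then obtain c q where cq: "c \<notin> Q" "q \<in> mpolys 2" "mpol_const c * y - evFG G q \<in> coeffs_in Q"
        using G by (auto simp: generates_mod_def)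
      \<comment> \<open>Integration in G: \<Delta> of the result is q(F, G) \<Delta>(G), which is
        \<open>r\<close> times q(F, G) modulo \<open>Q\<close>, so \<open>y\<close> is reached up to
        the factor \<open>e\<close>.\<close>
      obtain q' where q': "q' \<in> mpolys 2" "pderivative 1 q' = q"
        using antiderivative[OF cq(2), of 1] by auto
      define x where "x = evFG G q'"
      have x: "x \<in> A" using q' GA by (simp add: x_def evFG_A)
      have dx: "Delta x = evFG G q * Delta G"
        using A_derivation_evFG[OF A_derivation_Delta GA q'(1)] by (simp add: x_def Delta_F q'(2) del: One_nat_def)
      define e where "e = r * c"
      have e: "e \<notin> Q" unfolding e_def by (rule cprime_mult[OF Q(2) r(1) cq(1)])
      have "mpol_const e * y - Delta x = mpol_const r * (mpol_const c * y - evFG G q) -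
          evFG G q * (Delta G - mpol_const r)"
        by (simp add: e_def dx mpol_const.hom_mult algebra_simps)
      also have "\<dots> \<in> coeffs_in Q"
        by (intro cideal_diff[OF idc] cideal_mult[OF idc] cq r)
      finally have ey: "mpol_const e * y - Delta x \<in> coeffs_in Q" .
      \<comment> \<open>Modulo Q + (e) the element \<open>x\<close> is in the kernel of \<Delta>,
        hence a polynomial in F plus elements of QA and eA. Dropping the polynomial, which \<Delta>
        does not see, and dividing by \<open>e\<close> over the domain R/Q gives the preimage
        \<open>z\<close>.\<close>
      have J: "cideal (iadjoin Q e)" by (rule cideal_iadjoin[OF id])
      have "e \<in> iadjoin Q e" using cideal_0[OF id] by (force simp: iadjoin_def intro: exI[of _ 0] exI[of _ 1])
      then have "mpol_const e * y \<in> coeffs_in (iadjoin Q e)"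
        using cideal_mult2[OF cideal_coeffs_in[OF J]] const_mem_coeffs_in[OF J] by blast
      moreover have "mpol_const e * y - Delta x \<in> coeffs_in (iadjoin Q e)"
        using ey coeffs_in_mono[of Q "iadjoin Q e"] iadjoin_supset[OF id e] by blast
      ultimately have "Delta x \<in> coeffs_in (iadjoin Q e)"
        using cideal_diff[OF cideal_coeffs_in[OF J]] by fastforce
      from kernel_Delta_mod[OF J x this]
      obtain p where p: "p \<in> mpolys 1" "x - evF p \<in> coeffs_in (iadjoin Q e)" by blast
      have "x - evF p \<in> A" using x p evF_A A_diff by blast
      from coeffs_in_iadjoin_A[OF id this p(2)]
      obtain w z where wz: "w \<in> A" "w \<in> coeffs_in Q" "z \<in> A" "x - evF p = w + mpol_const e * z" by blast
      have "Delta (x - evF p) = Delta x"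
        using x p by (simp add: Delta_diff evF_A Delta_evF)
      moreover have "Delta (w + mpol_const e * z) = Delta w + mpol_const e * Delta z"
        using wz by (simp add: Delta_add Delta_const_mult A_mult A_const)
      ultimately have "mpol_const e * (y - Delta z) = (mpol_const e * y - Delta x) + Delta w"
        by (simp add: wz(4) algebra_simps)
      also have "\<dots> \<in> coeffs_in Q"
        by (intro cideal_add[OF idc] ey Delta_coeffs_in[OF id] wz)
      finally have "y - Delta z \<in> coeffs_in Q" by (rule const_mult_mem_coeffs_in_prime[OF Q(2) e])
      then show "\<exists>x\<in>A. y - Delta x \<in> coeffs_in P"
        using wz(3) coeffs_in_mono[OF Q(3)] by blast
    qed
  next
    case (step I b)
    note idc = cideal_coeffs_in[OF step(1)]
    show ?case
    proof
      fix y assume y: "y \<in> A"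
      then obtain x where x: "x \<in> A" "y - Delta x \<in> coeffs_in (iadjoin I b)" using step(2) by blast
      have "y - Delta x \<in> A" using x y Delta_A A_diff by blast
      from coeffs_in_iadjoin_A[OF step(1) this x(2)]
      obtain w z where wz: "w \<in> A" "w \<in> coeffs_in I" "z \<in> A" "y - Delta x = w + mpol_const b * z" by blast
      obtain x' where x': "x' \<in> A" "z - Delta x' \<in> coeffs_in (iquot I b)" using step(3) wz(3) by blast
      have "Delta (x + mpol_const b * x') = Delta x + mpol_const b * Delta x'"
        using x x' by (simp add: Delta_add Delta_const_mult A_mult A_const)
      then have "y - Delta (x + mpol_const b * x') = w + mpol_const b * (z - Delta x')"
        using wz(4) by (simp add: algebra_simps)
      also have "\<dots> \<in> coeffs_in I"
        using cideal_add[OF idc wz(2)] x'(2) by (simp add: const_mult_mem_coeffs_in)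
      finally show "\<exists>x\<in>A. y - Delta x \<in> coeffs_in I"
        using x x' by (blast intro: A_add A_mult A_const)
    qed
  qed
  then show ?thesis using assms by blast
qed

text \<open>The generator \<open>H\<close> of the generic fibre at \<open>Q\<close> is a polynomial
  in F and G modulo \<open>Q\<close> up to no denominator at all, because rG - H lies in the kernel
  of \<Delta> there. This gives \<open>y\<close> up to a denominator \<open>c\<close>, which
  \<open>purity\<close> for the ideal Q + (c) removes.\<close>

lemma generation_mod:
  assumes G: "G \<in> A" "Delta G = 1" and "cideal I" "y \<in> A"
  shows "\<exists>q\<in>mpolys 2. y - evFG G q \<in> coeffs_in I"
proof -
  have "\<forall>y\<in>A. \<exists>q\<in>mpolys 2. y - evFG G q \<in> coeffs_in I"
    using noetherian assms(3)
  proof (induction I rule: noetherian_ideal_induct)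
    case unit
    show ?case using mpolys_0 by auto
  next
    case (prime P)
    obtain Q where Q: "minimal_prime class_ring Q" "cprime Q" "Q \<subseteq> P"
      using minimal_prime_exists[OF prime(1)] by blast
    note id = cprimeD(1)[OF Q(2)] and idc = cideal_coeffs_in[OF cprimeD(1)[OF Q(2)]]
    obtain H where H: "generates_mod Q H" using generic[OF Q(1)] by blast
    then have HA: "H \<in> A" by (simp add: generates_mod_def)
    obtain r where r: "r \<notin> Q" "Delta H - mpol_const r \<in> coeffs_in Q"
      using Delta_generator_mod[OF Q(2) H] by blast
    have rA: "mpol_const r * G - H \<in> A" using G HA by (intro A_diff A_mult A_const)
    have "Delta (mpol_const r * G - H) = - (Delta H - mpol_const r)"
      using G HA by (simp add: Delta_diff Delta_const_mult A_mult A_const)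
    then have "Delta (mpol_const r * G - H) \<in> coeffs_in Q"
      using cideal_uminus[OF idc r(2)] by simp
    from kernel_Delta_mod[OF id rA this]
    obtain p where p: "p \<in> mpolys 1" "mpol_const r * G - H - evF p \<in> coeffs_in Q" by blast
    define p' where "p' = mpol_const r * mvar 1 - p"
    have p': "p' \<in> mpolys 2"
      unfolding p'_def using p(1) mpolys_mono[of 1 2] by (intro mpolys_diff mpolys_mult mpolys_const mpolys_mvar) auto
    have "evFG G p' + evFG G p = mpol_const r * G"
      using mpol_const.ev_add[of "(!) [F, G]" p' p]
      by (simp add: p'_def mpol_const.ev_mult mpol_const.ev_const mpol_const.ev_mvar)
    then have "evFG G p' + evF p = mpol_const r * G" by (simp only: evFG_evF[OF p(1)])
    then have "H - evFG G p' = - (mpol_const r * G - H - evF p)" by (simp add: algebra_simps)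
    then have HG: "H - evFG G p' \<in> coeffs_in Q" using cideal_uminus[OF idc p(2)] by metis
    show ?case
    proof
      fix y assume "y \<in> A"
      then obtain c q where cq: "c \<notin> Q" "q \<in> mpolys 2" "mpol_const c * y - evFG H q \<in> coeffs_in Q"
        using H by (auto simp: generates_mod_def)
      define q' where "q' = ev mpol_const ((!) [mvar 0, p']) q"
      have q': "q' \<in> mpolys 2"
        unfolding q'_def using cq(2) p'
        by (intro ev_closed[where N = 2]) (auto simp: mpolys_closed less_2_cases_iff)
      have "evFG G q' = ev mpol_const ((!) [F, evFG G p']) q"
        unfolding q'_def ev_ev[OF mpol_const.comm_ring_hom_axioms]
        by (rule ev_cong[OF cq(2)]) (auto simp: less_2_cases_iff mpol_const.ev_mvar)
      moreover have "evFG H q - ev mpol_const ((!) [F, evFG G p']) q \<in> coeffs_in Q"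
        using mpol_const.comm_ring_hom_axioms idc cq(2)
        by (rule ev_cong_ideal) (auto simp: less_2_cases_iff HG cideal_0[OF idc])
      ultimately have cy: "mpol_const c * y - evFG G q' \<in> coeffs_in Q"
        using cideal_add[OF idc cq(3)] by fastforce
      have J: "cideal (iadjoin Q c)" by (rule cideal_iadjoin[OF id])
      have "c \<in> iadjoin Q c" using cideal_0[OF id] by (force simp: iadjoin_def intro: exI[of _ 0] exI[of _ 1])
      then have "mpol_const c * y \<in> coeffs_in (iadjoin Q c)"
        using cideal_mult2[OF cideal_coeffs_in[OF J]] const_mem_coeffs_in[OF J] by blast
      moreover have "mpol_const c * y - evFG G q' \<in> coeffs_in (iadjoin Q c)"
        using cy coeffs_in_mono[of Q "iadjoin Q c"] iadjoin_supset[OF id cq(1)] by blast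
      ultimately have "evFG G q' \<in> coeffs_in (iadjoin Q c)"
        using cideal_diff[OF cideal_coeffs_in[OF J]] by fastforce
      from purity[OF G J q' this] have "q' \<in> coeffs_in (iadjoin Q c)" .
      from coeffs_in_iadjoin[OF id this q']
      obtain s t where st: "s \<in> coeffs_in Q" "t \<in> mpolys 2" "q' = s + mpol_const c * t" by blast
      have "mpol_const c * (y - evFG G t) = (mpol_const c * y - evFG G q') + evFG G s"
        by (simp add: st(3) mpol_const.ev_add mpol_const.ev_mult mpol_const.ev_const algebra_simps)
      also have "\<dots> \<in> coeffs_in Q" by (intro cideal_add[OF idc] cy coeffs_in_ev[OF id] st)
      finally have "y - evFG G t \<in> coeffs_in Q" by (rule const_mult_mem_coeffs_in_prime[OF Q(2) cq(1)])
      then show "\<exists>q\<in>mpolys 2. y - evFG G q \<in> coeffs_in P"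
        using st(2) coeffs_in_mono[OF Q(3)] by blast
    qed
  next
    case (step I b)
    note idc = cideal_coeffs_in[OF step(1)]
    show ?case
    proof
      fix y assume y: "y \<in> A"
      then obtain q where q: "q \<in> mpolys 2" "y - evFG G q \<in> coeffs_in (iadjoin I b)" using step(2) by blast
      have "y - evFG G q \<in> A" using q y evFG_A[OF G(1)] A_diff by blast
      from coeffs_in_iadjoin_A[OF step(1) this q(2)]
      obtain w z where wz: "w \<in> A" "w \<in> coeffs_in I" "z \<in> A" "y - evFG G q = w + mpol_const b * z" by blast
      obtain q' where q': "q' \<in> mpolys 2" "z - evFG G q' \<in> coeffs_in (iquot I b)" using step(3) wz(3) by blast
      have "y - evFG G (q + mpol_const b * q') = w + mpol_const b * (z - evFG G q')"
        using wz(4) by (simp add: mpol_const.ev_add mpol_const.ev_mult mpol_const.ev_const algebra_simps)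
      also have "\<dots> \<in> coeffs_in I"
        using cideal_add[OF idc wz(2)] q'(2) by (simp add: const_mult_mem_coeffs_in)
      finally show "\<exists>q\<in>mpolys 2. y - evFG G q \<in> coeffs_in I"
        using q(1) q'(1) by (blast intro: mpolys_closed)
    qed
  qed
  then show ?thesis using assms(4) by blast
qed

lemma coordinate:
  obtains G where "G \<in> A" "bij_betw (evFG G) (mpolys 2) A"
proof -
  obtain G where G: "G \<in> A" "Delta G = 1"
    using Delta_surjective_mod[OF cideal_zero A_1] by auto
  have "inj_on (evFG G) (mpolys 2)"
  proof (rule inj_onI)
    fix p q assume pq: "p \<in> mpolys 2" "q \<in> mpolys 2" "evFG G p = evFG G q"
    have "evFG G (p - q) + evFG G q = evFG G p"
      by (simp only: mpol_const.ev_add[symmetric] diff_add_cancel)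
    then have "evFG G (p - q) \<in> coeffs_in {0}" using pq(3) by simp
    from purity[OF G cideal_zero mpolys_diff[OF pq(1,2)] this] show "p = q" by simp
  qed
  moreover have "evFG G ` mpolys 2 = A"
    using generation_mod[OF G cideal_zero] evFG_A[OF G(1)] by auto
  ultimately show ?thesis using that[OF G(1)] by (simp add: bij_betw_def)
qed

end

section \<open>Slice and local nilpotency when F and G generate A\<close>

context unimodular
begin

context
  fixes G assumes G: "G \<in> A" "A \<subseteq> evFG G ` mpolys 2"
begin

text \<open>New generators of R[X] over R: F has index 0, \<open>T i\<close> index i + 1 and G index
  n + 1.\<close>

definition coords :: "nat \<Rightarrow> 'r mpol" where
  "coords i = ((F # map T [0..<n]) @ [G]) ! i"

lemma coords_B: "i < N \<Longrightarrow> coords i \<in> B"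
  by (auto simp: coords_def nth_append nth_Cons' less_Suc_eq_0_disj intro!: T_mpolys A_B[OF F_A] A_B[OF G(1)])

lemma B_coords: "f \<in> B \<Longrightarrow> \<exists>q \<in> B. f = ev mpol_const coords q"
proof -
  assume f: "f \<in> B"
  let ?K = "ev mpol_const coords ` B"
  have K: "ev mpol_const coords q \<in> ?K" if "q \<in> B" for q using that by blast
  have cl: "x + y \<in> ?K" "x * y \<in> ?K" if "x \<in> ?K" "y \<in> ?K" for x y
    using that K[OF mpolys_add] K[OF mpolys_mult]
    by (auto simp: mpol_const.ev_add mpol_const.ev_mult)
  have "mpol_const r \<in> ?K" for r using K[OF mpolys_const[of r]] by (simp add: mpol_const.ev_const)
  from this[of 0] this[of 1] have const: "0 \<in> ?K" "1 \<in> ?K" by simp_all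
  have var: "coords i \<in> ?K" if "i < N" for i
    using K[OF mpolys_mvar[OF that]] by (simp add: mpol_const.ev_mvar)
  have A_K: "y \<in> ?K" if "y \<in> A" for y
  proof -
    obtain q where q: "q \<in> mpolys 2" "y = evFG G q" using G \<open>y \<in> A\<close> by blast
    define q' where "q' = ev mpol_const ((!) [mvar 0, mvar (Suc n)]) q"
    have "q' \<in> B" unfolding q'_def using q(1)
      by (rule B_ev) (auto simp: less_2_cases_iff intro!: mpolys_mvar)
    moreover have "ev mpol_const coords q' = evFG G q"
      unfolding q'_def ev_ev[OF mpol_const.comm_ring_hom_axioms]
      by (rule ev_cong[OF q(1)]) (auto simp: less_2_cases_iff mpol_const.ev_mvar coords_def nth_append)
    ultimately show ?thesis using q(2) by (metis imageI)
  qed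
  have T_K: "T i \<in> ?K" if "i < n" for i
    using var[of "Suc i"] that by (simp add: coords_def nth_append)
  have "ev id T (coefT f) \<in> ?K"
    using coefT[OF f] by (intro ev_closed[where N = n] const cl) (auto simp: AT_def A_K T_K)
  then show ?thesis by (auto simp: ev_coefT f)
qed

text \<open>\<open>D\<close> vanishes on F and T, so in these coordinates it is the derivative in G,
  the last one, times \<open>D G\<close>.\<close>

lemma D_coords:
  assumes "q \<in> B"
  shows "D (ev mpol_const coords q) = ev mpol_const coords (pderivative (Suc n) q) * D G"
proof -
  have "D (ev mpol_const coords q) =
      (\<Sum>k<N. ev mpol_const coords (pderivative k q) * D (ev mpol_const coords (mvar k)))"
    using assms
    by (rule derivation_chain_rule)
      (use mpol_const.ev_const[of coords 1] in \<open>simp_all add: mpol_const.ev_add mpol_const.ev_mult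
        mpol_const.ev_const D_add D_mult D_const\<close>)
  also have "\<dots> = (\<Sum>k<Suc n. ev mpol_const coords (pderivative k q) * D (coords k)) +
      ev mpol_const coords (pderivative (Suc n) q) * D (coords (Suc n))"
    by (simp add: mpol_const.ev_mvar)
  also have "(\<Sum>k<Suc n. ev mpol_const coords (pderivative k q) * D (coords k)) = 0"
  proof (rule sum.neutral, rule ballI)
    fix k assume "k \<in> {..<Suc n}"
    then have "D (coords k) = 0"
      by (cases k) (auto simp: coords_def nth_append D_F D_T)
    then show "ev mpol_const coords (pderivative k q) * D (coords k) = 0" by simp
  qed
  also have "coords (Suc n) = G" by (simp add: coords_def nth_append)
  finally show ?thesis by simp
qed

text \<open>Each variable is a polynomial in the coordinates, so all minors \<open>\<kappa>\<close>
  are multiples of \<open>D G\<close>; on the other hand they generate the unit ideal.\<close>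

lemma D_G_unit: "\<exists>z\<in>B. z * D G = 1"
proof -
  have "\<forall>k. \<exists>q. k < N \<longrightarrow> q \<in> B \<and> mvar k = ev mpol_const coords q"
    using B_coords[OF mpolys_mvar] by blast
  then obtain q where q: "\<And>k. k < N \<Longrightarrow> q k \<in> B" "\<And>k. k < N \<Longrightarrow> mvar k = ev mpol_const coords (q k)"
    by metis
  define e where "e k = ev mpol_const coords (pderivative (Suc n) (q k))" for k
  have \<kappa>: "\<kappa> k = e k * D G" if "k < N" for k
  proof -
    show ?thesis using D_mvar[OF that] D_coords[OF q(1)[OF that]] q(2)[OF that] by (simp add: e_def)
  qed
  have "(\<Sum>k<N. \<eta> k * e k) * D G = (\<Sum>k<N. \<eta> k * \<kappa> k)"
    unfolding sum_distrib_right by (rule sum.cong) (auto simp: \<kappa> mult.assoc)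
  then have "(\<Sum>k<N. \<eta> k * e k) * D G = 1" by (simp only: sum_\<eta>_\<kappa>)
  moreover have "(\<Sum>k<N. \<eta> k * e k) \<in> B"
  proof (intro mpolys_sum mpolys_mult \<eta>_B)
    fix k assume "k \<in> {..<N}"
    then show "e k \<in> B"
      unfolding e_def by (intro B_ev[where M = N] mpolys_pderivative q(1)) (auto intro: coords_B)
  qed
  ultimately show ?thesis by blast
qed

lemma D_slice: "\<exists>s\<in>B. D s = 1"
proof -
  obtain z where z: "z \<in> B" "z * D G = 1" using D_G_unit by blast
  obtain q where q: "q \<in> B" "z = ev mpol_const coords q" using B_coords[OF z(1)] by blast
  obtain q' where q': "q' \<in> B" "pderivative (Suc n) q' = q" using antiderivative[OF q(1), of "Suc n"] by auto
  have "D (ev mpol_const coords q') = 1" using D_coords[OF q'(1)] q(2) q'(2) z(2) by simp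
  moreover have "ev mpol_const coords q' \<in> B" using q'(1) coords_B by (rule B_ev)
  ultimately show ?thesis by blast
qed

lemma funpow_D:
  shows "f \<in> B \<Longrightarrow> (D ^^ k) f \<in> B" "(D ^^ k) (f + g) = (D ^^ k) f + (D ^^ k) g"
    "(D ^^ k) (mpol_const r * f) = mpol_const r * (D ^^ k) f"
    "cideal I \<Longrightarrow> f \<in> coeffs_in I \<Longrightarrow> (D ^^ k) f \<in> coeffs_in I"
  by (induction k) (simp_all add: D_B D_add D_const_mult D_coeffs_in)

text \<open>Modulo a prime the unit \<open>D G\<close> is a constant, so \<open>D\<close> lowers the
  degree in G. In the induction step k applications leave an error bz modulo I, and l further ones
  kill it.\<close>

lemma D_nilpotent_mod:
  assumes "cideal I" "f \<in> B"
  shows "\<exists>k. (D ^^ k) f \<in> coeffs_in I"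
proof -
  have "\<forall>f\<in>B. \<exists>k. (D ^^ k) f \<in> coeffs_in I"
    using noetherian assms(1)
  proof (induction I rule: noetherian_ideal_induct)
    case (prime P)
    note id = cprimeD(1)[OF prime(1)] and idc = cideal_coeffs_in[OF cprimeD(1)[OF prime(1)]]
    obtain z where z: "z * D G = 1" using D_G_unit by blast
    have "mpol_const 1 - D G * z \<in> coeffs_in P"
      using z by (simp add: mult.commute cideal_0[OF idc])
    then obtain r where r: "D G - mpol_const r \<in> coeffs_in P"
      using unit_mod_prime[OF prime(1) cprimeD(2)[OF prime(1)]] by blast
    \<comment> \<open>\<open>f\<close> is only required to be congruent to the polynomial in the
      coordinates, because replacing \<open>D G\<close> by the constant \<open>r\<close> is a
      congruence.\<close>
    have *: "(D ^^ d) f \<in> coeffs_in P"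
      if "\<forall>m\<in>keys q. lookup m (Suc n) < d" "q \<in> B"
        "f - ev mpol_const coords q \<in> coeffs_in P" for d f q
      using that
    proof (induction d arbitrary: f q)
      case 0
      then have "keys q = {}" by blast
      then show ?case using 0 by simp
    next
      case (Suc d)
      let ?q = "mpol_const r * pderivative (Suc n) q"
      have "D f - ev mpol_const coords ?q = D (f - ev mpol_const coords q) +
          ev mpol_const coords (pderivative (Suc n) q) * (D G - mpol_const r)"
        by (simp add: D_diff D_coords[OF Suc.prems(2)] mpol_const.ev_mult mpol_const.ev_const algebra_simps)
      also have "\<dots> \<in> coeffs_in P"
        by (intro cideal_add[OF idc] D_coeffs_in[OF id] cideal_mult[OF idc] Suc.prems r)
      finally have "D f - ev mpol_const coords ?q \<in> coeffs_in P" .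
      moreover have "\<forall>m\<in>keys ?q. lookup m (Suc n) < d"
      proof
        fix m assume "m \<in> keys ?q"
        then have "m + single (Suc n) 1 \<in> keys q"
          by (auto simp: in_keys_iff lookup_const_mult lookup_pderivative)
        then show "lookup m (Suc n) < d"
          using Suc.prems(1) by (force simp: lookup_add)
      qed
      moreover have "?q \<in> B" using Suc.prems(2) by (intro mpolys_mult mpolys_const mpolys_pderivative)
      ultimately have "(D ^^ d) (D f) \<in> coeffs_in P" by (intro Suc.IH)
      then show ?case by (simp add: funpow_swap1)
    qed
    show ?case
    proof
      fix f assume "f \<in> B"
      then obtain q where q: "q \<in> B" "f = ev mpol_const coords q" using B_coords by blast
      obtain d where "\<forall>m\<in>keys q. lookup m (Suc n) < d"
        using exponent_bound[of q "\<lambda>m. lookup m (Suc n)"] by blast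
      from *[OF this q(1), of f] show "\<exists>k. (D ^^ k) f \<in> coeffs_in P"
        using q(2) cideal_0[OF idc] by auto
    qed
  next
    case (step I b)
    note idc = cideal_coeffs_in[OF step(1)]
    show ?case
    proof
      fix f assume f: "f \<in> B"
      then obtain k where k: "(D ^^ k) f \<in> coeffs_in (iadjoin I b)" using step(2) by blast
      from coeffs_in_iadjoin[OF step(1) this funpow_D(1)[OF f]]
      obtain w z where wz: "w \<in> coeffs_in I" "z \<in> B" "(D ^^ k) f = w + mpol_const b * z" by blast
      obtain l where l: "(D ^^ l) z \<in> coeffs_in (iquot I b)" using step(3) wz(2) by blast
      have "(D ^^ (l + k)) f = (D ^^ l) w + mpol_const b * (D ^^ l) z"
        by (simp add: funpow_add wz(3) funpow_D)
      also have "\<dots> \<in> coeffs_in I"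
        using cideal_add[OF idc funpow_D(4)[OF step(1) wz(1)]] l by (simp add: const_mult_mem_coeffs_in)
      finally show "\<exists>k. (D ^^ k) f \<in> coeffs_in I" by blast
    qed
  qed simp
  then show ?thesis using assms(2) by blast
qed

end

end

section \<open>Localization\<close>

locale cring_localization = R?: cring D for D (structure) +
  fixes S
  assumes S_carrier: "S \<subseteq> carrier D" and S_one: "\<one> \<in> S"
    and S_mult: "s \<in> S \<Longrightarrow> t \<in> S \<Longrightarrow> s \<otimes> t \<in> S"
begin

abbreviation frac where "frac \<equiv> loc_frac D S"

lemma S_closed [simp, intro]: "s \<in> S \<Longrightarrow> s \<in> carrier D"
  using S_carrier by blast

lemma loc_rel_iff:
  "((a, s), (b, t)) \<in> loc_rel D S \<longleftrightarrow> a \<in> carrier D \<and> b \<in> carrier D \<and> s \<in> S \<and> t \<in> S \<and>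
    (\<exists>u\<in>S. u \<otimes> (a \<otimes> t) = u \<otimes> (b \<otimes> s))"
  by (simp add: loc_rel_def)

lemma equiv_loc_rel: "equiv (carrier D \<times> S) (loc_rel D S)"
proof (rule equivI)
  show "loc_rel D S \<subseteq> (carrier D \<times> S) \<times> carrier D \<times> S"
    by (auto simp: loc_rel_def)
  show "refl_on (carrier D \<times> S) (loc_rel D S)"
    using S_one by (auto simp: refl_on_def loc_rel_def)
  show "sym (loc_rel D S)"
    by (rule symI) (auto simp: loc_rel_def intro: sym)
  show "trans (loc_rel D S)"
  proof (rule transI)
    fix x y z assume xy: "(x, y) \<in> loc_rel D S" and yz: "(y, z) \<in> loc_rel D S"
    obtain a s b t c r where [simp]: "x = (a, s)" "y = (b, t)" "z = (c, r)" by (cases x, cases y, cases z) auto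
    obtain u w where 1: "a \<in> carrier D" "b \<in> carrier D" "c \<in> carrier D" "s \<in> S" "t \<in> S" "r \<in> S" "u \<in> S" "w \<in> S"
      "u \<otimes> (a \<otimes> t) = u \<otimes> (b \<otimes> s)" "w \<otimes> (b \<otimes> r) = w \<otimes> (c \<otimes> t)"
      using xy yz by (auto simp: loc_rel_iff)
    \<comment> \<open>The multiplier combines both witnesses with the middle denominator
      \<open>t\<close>, which has to be cancelled.\<close>
    have "(u \<otimes> w \<otimes> t) \<otimes> (a \<otimes> r) = (u \<otimes> (a \<otimes> t)) \<otimes> (w \<otimes> r)"
      using 1(1-8) by (simp add: m_ac)
    also have "\<dots> = (u \<otimes> s) \<otimes> (w \<otimes> (b \<otimes> r))"
      unfolding 1(9) using 1(1-8) by (simp add: m_ac)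
    also have "\<dots> = (u \<otimes> w \<otimes> t) \<otimes> (c \<otimes> s)"
      unfolding 1(10) using 1(1-8) by (simp add: m_ac)
    finally show "(x, z) \<in> loc_rel D S"
      using 1(1-8) by (auto simp: loc_rel_iff intro!: bexI[of _ "u \<otimes> w \<otimes> t"] S_mult)
  qed
qed

lemma frac_eq_iff:
  assumes "a \<in> carrier D" "b \<in> carrier D" "s \<in> S" "t \<in> S"
  shows "frac a s = frac b t \<longleftrightarrow> (\<exists>u\<in>S. u \<otimes> (a \<otimes> t) = u \<otimes> (b \<otimes> s))"
  unfolding loc_frac_def using assms
  by (subst eq_equiv_class_iff[OF equiv_loc_rel]) (auto simp: loc_rel_iff)

lemma frac_eqI:
  assumes "a \<in> carrier D" "b \<in> carrier D" "s \<in> S" "t \<in> S" "a \<otimes> t = b \<otimes> s"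
  shows "frac a s = frac b t"
  using assms S_one by (auto simp: frac_eq_iff)

lemma frac_carrier: "a \<in> carrier D \<Longrightarrow> s \<in> S \<Longrightarrow> frac a s \<in> carrier (localization D S)"
  by (auto simp: localization_def loc_frac_def intro: quotientI)

lemma carrier_frac:
  assumes "x \<in> carrier (localization D S)"
  obtains a s where "a \<in> carrier D" "s \<in> S" "x = frac a s"
  using assms by (auto simp: localization_def loc_frac_def quotient_def)

text \<open>The operations of \<open>localization\<close> are unions over all representatives of
  their operands; if every representative gives the same class, the union is that class.\<close>

lemma UN_frac:
  assumes "a \<in> carrier D" "s \<in> S" "\<And>b t. b \<in> carrier D \<Longrightarrow> t \<in> S \<Longrightarrow> frac b t = frac a s \<Longrightarrow> g b t = c"
  shows "(\<Union>(b, t)\<in>frac a s. g b t) = c"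
proof -
  have "(a, s) \<in> frac a s"
    using assms(1,2) equiv_class_self[OF equiv_loc_rel] by (auto simp: loc_frac_def)
  moreover have "g b t = c" if "(b, t) \<in> frac a s" for b t
  proof -
    have "((a, s), (b, t)) \<in> loc_rel D S" using that by (simp add: loc_frac_def)
    then show ?thesis
      using equiv_class_eq[OF equiv_loc_rel, of "(a, s)" "(b, t)"] assms(3)[of b t]
      by (auto simp: loc_frac_def loc_rel_iff)
  qed
  ultimately show ?thesis by fast
qed

lemma frac_mult:
  assumes "a \<in> carrier D" "b \<in> carrier D" "s \<in> S" "t \<in> S"
  shows "frac a s \<otimes>\<^bsub>localization D S\<^esub> frac b t = frac (a \<otimes> b) (s \<otimes> t)"
proof -
  have "(\<Union>(a', s')\<in>frac a s. \<Union>(b', t')\<in>frac b t. frac (a' \<otimes> b') (s' \<otimes> t')) = frac (a \<otimes> b) (s \<otimes> t)"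
  proof (intro UN_frac assms)
    fix a' s' b' t'
    assume *: "a' \<in> carrier D" "s' \<in> S" "b' \<in> carrier D" "t' \<in> S"
      and eq: "frac a' s' = frac a s" "frac b' t' = frac b t"
    obtain u w where uw: "u \<in> S" "u \<otimes> (a' \<otimes> s) = u \<otimes> (a \<otimes> s')" "w \<in> S" "w \<otimes> (b' \<otimes> t) = w \<otimes> (b \<otimes> t')"
      using eq assms * by (auto simp: frac_eq_iff)
    have "(u \<otimes> w) \<otimes> ((a' \<otimes> b') \<otimes> (s \<otimes> t)) = (u \<otimes> (a' \<otimes> s)) \<otimes> (w \<otimes> (b' \<otimes> t))"
      using assms * uw(1,3) by (simp add: m_ac)
    also have "\<dots> = (u \<otimes> w) \<otimes> ((a \<otimes> b) \<otimes> (s' \<otimes> t'))"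
      unfolding uw(2,4) using assms * uw(1,3) by (simp add: m_ac)
    finally show "frac (a' \<otimes> b') (s' \<otimes> t') = frac (a \<otimes> b) (s \<otimes> t)"
      using assms * uw(1,3) by (subst frac_eq_iff) (auto intro: S_mult)
  qed
  then show ?thesis by (simp add: localization_def)
qed

lemma frac_add:
  assumes "a \<in> carrier D" "b \<in> carrier D" "s \<in> S" "t \<in> S"
  shows "frac a s \<oplus>\<^bsub>localization D S\<^esub> frac b t = frac (a \<otimes> t \<oplus> b \<otimes> s) (s \<otimes> t)"
proof -
  have "(\<Union>(a', s')\<in>frac a s. \<Union>(b', t')\<in>frac b t. frac (a' \<otimes> t' \<oplus> b' \<otimes> s') (s' \<otimes> t')) =
      frac (a \<otimes> t \<oplus> b \<otimes> s) (s \<otimes> t)"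
  proof (intro UN_frac assms)
    fix a' s' b' t'
    assume *: "a' \<in> carrier D" "s' \<in> S" "b' \<in> carrier D" "t' \<in> S"
      and eq: "frac a' s' = frac a s" "frac b' t' = frac b t"
    obtain u w where uw: "u \<in> S" "u \<otimes> (a' \<otimes> s) = u \<otimes> (a \<otimes> s')" "w \<in> S" "w \<otimes> (b' \<otimes> t) = w \<otimes> (b \<otimes> t')"
      using eq assms * by (auto simp: frac_eq_iff)
    have "(u \<otimes> w) \<otimes> ((a' \<otimes> t' \<oplus> b' \<otimes> s') \<otimes> (s \<otimes> t)) =
        (u \<otimes> (a' \<otimes> s)) \<otimes> (w \<otimes> t \<otimes> t') \<oplus> (w \<otimes> (b' \<otimes> t)) \<otimes> (u \<otimes> s \<otimes> s')"
      using assms * uw(1,3) by (simp add: l_distr r_distr m_ac)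
    also have "\<dots> = (u \<otimes> w) \<otimes> ((a \<otimes> t \<oplus> b \<otimes> s) \<otimes> (s' \<otimes> t'))"
      unfolding uw(2,4) using assms * uw(1,3) by (simp add: l_distr r_distr m_ac)
    finally show "frac (a' \<otimes> t' \<oplus> b' \<otimes> s') (s' \<otimes> t') = frac (a \<otimes> t \<oplus> b \<otimes> s) (s \<otimes> t)"
      using assms * uw(1,3) by (subst frac_eq_iff) (auto intro: S_mult)
  qed
  then show ?thesis by (simp add: localization_def)
qed

lemma frac_zero: "\<zero>\<^bsub>localization D S\<^esub> = frac \<zero> \<one>" and frac_one: "\<one>\<^bsub>localization D S\<^esub> = frac \<one> \<one>"
  by (simp_all add: localization_def)

lemma cring_localization: "cring (localization D S)"
proof (rule cringI)
  let ?L = "localization D S"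
  note closed = S_one S_mult frac_mult frac_add frac_zero frac_one
  show "abelian_group ?L"
  proof (rule abelian_groupI)
    fix x y assume "x \<in> carrier ?L" "y \<in> carrier ?L"
    then obtain a s b t where *: "a \<in> carrier D" "s \<in> S" "x = frac a s" "b \<in> carrier D" "t \<in> S" "y = frac b t"
      by (metis carrier_frac)
    then show "x \<oplus>\<^bsub>?L\<^esub> y \<in> carrier ?L" by (auto simp: closed intro!: frac_carrier)
    show "x \<oplus>\<^bsub>?L\<^esub> y = y \<oplus>\<^bsub>?L\<^esub> x" using * by (simp add: closed m_comm[of s t] a_comm)
  next
    fix x y z assume "x \<in> carrier ?L" "y \<in> carrier ?L" "z \<in> carrier ?L"
    then obtain a s b t c r where *: "a \<in> carrier D" "s \<in> S" "x = frac a s" "b \<in> carrier D" "t \<in> S" "y = frac b t"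
      "c \<in> carrier D" "r \<in> S" "z = frac c r"
      by (metis carrier_frac)
    then show "(x \<oplus>\<^bsub>?L\<^esub> y) \<oplus>\<^bsub>?L\<^esub> z = x \<oplus>\<^bsub>?L\<^esub> (y \<oplus>\<^bsub>?L\<^esub> z)"
      by (simp add: closed l_distr r_distr m_ac a_assoc)
  next
    show "\<zero>\<^bsub>?L\<^esub> \<in> carrier ?L" by (auto simp: closed intro!: frac_carrier)
  next
    fix x assume "x \<in> carrier ?L"
    then obtain a s where *: "a \<in> carrier D" "s \<in> S" "x = frac a s" by (metis carrier_frac)
    then show "\<zero>\<^bsub>?L\<^esub> \<oplus>\<^bsub>?L\<^esub> x = x" by (simp add: closed)
    show "\<exists>y\<in>carrier ?L. y \<oplus>\<^bsub>?L\<^esub> x = \<zero>\<^bsub>?L\<^esub>"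
    proof (rule bexI[of _ "frac (\<ominus> a) s"])
      have "(\<ominus> a) \<otimes> s \<oplus> a \<otimes> s = \<zero>" using * by (simp add: l_minus l_neg)
      then show "frac (\<ominus> a) s \<oplus>\<^bsub>?L\<^esub> x = \<zero>\<^bsub>?L\<^esub>"
        using * by (simp add: closed) (rule frac_eqI, auto simp: closed)
    qed (use * in \<open>auto intro!: frac_carrier\<close>)
  qed
  show "comm_monoid ?L"
  proof (rule comm_monoidI)
    fix x y assume "x \<in> carrier ?L" "y \<in> carrier ?L"
    then obtain a s b t where *: "a \<in> carrier D" "s \<in> S" "x = frac a s" "b \<in> carrier D" "t \<in> S" "y = frac b t"
      by (metis carrier_frac)
    then show "x \<otimes>\<^bsub>?L\<^esub> y \<in> carrier ?L" by (auto simp: closed intro!: frac_carrier)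
    show "x \<otimes>\<^bsub>?L\<^esub> y = y \<otimes>\<^bsub>?L\<^esub> x" using * by (simp add: closed m_comm)
  next
    fix x y z assume "x \<in> carrier ?L" "y \<in> carrier ?L" "z \<in> carrier ?L"
    then obtain a s b t c r where *: "a \<in> carrier D" "s \<in> S" "x = frac a s" "b \<in> carrier D" "t \<in> S" "y = frac b t"
      "c \<in> carrier D" "r \<in> S" "z = frac c r"
      by (metis carrier_frac)
    then show "(x \<otimes>\<^bsub>?L\<^esub> y) \<otimes>\<^bsub>?L\<^esub> z = x \<otimes>\<^bsub>?L\<^esub> (y \<otimes>\<^bsub>?L\<^esub> z)"
      by (simp add: closed m_assoc)
  next
    show "\<one>\<^bsub>?L\<^esub> \<in> carrier ?L" by (auto simp: closed intro!: frac_carrier)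
  next
    fix x assume "x \<in> carrier ?L"
    then obtain a s where *: "a \<in> carrier D" "s \<in> S" "x = frac a s" by (metis carrier_frac)
    then show "\<one>\<^bsub>?L\<^esub> \<otimes>\<^bsub>?L\<^esub> x = x" by (simp add: closed)
  qed
  fix x y z assume "x \<in> carrier ?L" "y \<in> carrier ?L" "z \<in> carrier ?L"
  then obtain a s b t c r where *: "a \<in> carrier D" "s \<in> S" "x = frac a s" "b \<in> carrier D" "t \<in> S" "y = frac b t"
    "c \<in> carrier D" "r \<in> S" "z = frac c r"
    by (metis carrier_frac)
  then show "(x \<oplus>\<^bsub>?L\<^esub> y) \<otimes>\<^bsub>?L\<^esub> z = (x \<otimes>\<^bsub>?L\<^esub> z) \<oplus>\<^bsub>?L\<^esub> (y \<otimes>\<^bsub>?L\<^esub> z)"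
    by (simp add: closed) (rule frac_eqI, auto simp: closed l_distr r_distr m_ac)
qed

lemma frac_ring_hom: "(\<lambda>r. frac r \<one>) \<in> Ring.ring_hom D (localization D S)"
  by (rule ring_hom_memI) (auto simp: frac_carrier S_one frac_mult frac_add frac_one)

lemma frac_denominator:
  assumes "a \<in> carrier D" "s \<in> S"
  shows "frac s \<one> \<otimes>\<^bsub>localization D S\<^esub> frac a s = frac a \<one>"
  using assms S_one S_mult by (simp add: frac_mult) (rule frac_eqI, auto simp: m_comm)

end

text \<open>An \<open>R\<close>-algebra \<open>L\<close> (structure map \<open>g\<close>) of fractions modulo the prime ideal \<open>P\<close>; both the quotient
  field of \<open>R/P\<close> and the residue field at \<open>P\<close> are of this kind.\<close>

definition fractions_mod :: "'r::comm_ring_1 set \<Rightarrow> ('r \<Rightarrow> 'l) \<Rightarrow> 'l ring \<Rightarrow> bool" where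
  "fractions_mod P g L \<longleftrightarrow> cring L \<and> g \<in> Ring.ring_hom class_ring L \<and>
     (\<forall>l\<in>carrier L. \<exists>r s. s \<notin> P \<and> g s \<otimes>\<^bsub>L\<^esub> l = g r) \<and> (\<forall>r. g r = \<zero>\<^bsub>L\<^esub> \<longrightarrow> r \<in> P)"

lemma fractions_mod_quotient_field:
  fixes P :: "'r::comm_ring_1 set"
  assumes P: "cprime P"
  shows "fractions_mod P (to_quotient_field class_ring P) (quotient_field (class_ring Quot P))"
proof -
  let ?R = "class_ring :: 'r ring"
  interpret P: primeideal P ?R using P by (simp add: primeideal_class_ring_iff)
  interpret Q: "domain" "?R Quot P" by (rule P.quotient_is_domain)
  have hom: "(\<lambda>r. P +>\<^bsub>?R\<^esub> r) \<in> Ring.ring_hom ?R (?R Quot P)" by (rule P.rcos_ring_hom)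
  interpret L: cring_localization "?R Quot P" "carrier (?R Quot P) - {\<zero>\<^bsub>?R Quot P\<^esub>}"
    by unfold_locales (auto simp: Q.integral_iff)
  have car: "\<exists>r. x = P +>\<^bsub>?R\<^esub> r" if "x \<in> carrier (?R Quot P)" for x
    using that by (auto simp: FactRing_def A_RCOSETS_def' a_r_coset_def)
  have zero: "P +>\<^bsub>?R\<^esub> r = \<zero>\<^bsub>?R Quot P\<^esub> \<longleftrightarrow> r \<in> P" for r
  proof -
    have "\<zero>\<^bsub>?R Quot P\<^esub> = P" by (simp add: FactRing_def)
    then show ?thesis
      using ring.a_rcos_zero[OF cring.axioms(1)[OF cring_class_ring] P.is_ideal, of r] P.rcos_const_imp_mem[of r] by auto
  qed
  let ?g = "to_quotient_field ?R P"
  have g: "?g r = L.frac (P +>\<^bsub>?R\<^esub> r) \<one>\<^bsub>?R Quot P\<^esub>" for r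
    by (simp add: to_quotient_field_def)
  have car': "P +>\<^bsub>?R\<^esub> r \<in> carrier (?R Quot P)" for r
    using ring_hom_closed[OF hom, of r] by simp
  have "?g \<in> Ring.ring_hom ?R (localization (?R Quot P) (carrier (?R Quot P) - {\<zero>\<^bsub>?R Quot P\<^esub>}))"
    using ring_hom_trans[OF hom L.frac_ring_hom] by (simp add: comp_def g[abs_def])
  moreover have "\<exists>r s. s \<notin> P \<and> ?g s \<otimes>\<^bsub>localization (?R Quot P) (carrier (?R Quot P) - {\<zero>\<^bsub>?R Quot P\<^esub>})\<^esub> l = ?g r"
    if l: "l \<in> carrier (localization (?R Quot P) (carrier (?R Quot P) - {\<zero>\<^bsub>?R Quot P\<^esub>}))" for l
  proof -
    obtain a s where as: "a \<in> carrier (?R Quot P)" "s \<in> carrier (?R Quot P) - {\<zero>\<^bsub>?R Quot P\<^esub>}" "l = L.frac a s"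
      by (rule L.carrier_frac[OF l])
    then obtain r s' where [simp]: "a = P +>\<^bsub>?R\<^esub> r" "s = P +>\<^bsub>?R\<^esub> s'" using car by blast
    have "s' \<notin> P" using as(2) zero by auto
    then show ?thesis using L.frac_denominator[OF as(1,2)] as(3) by (auto simp: g)
  qed
  moreover have "r \<in> P" if "?g r = \<zero>\<^bsub>localization (?R Quot P) (carrier (?R Quot P) - {\<zero>\<^bsub>?R Quot P\<^esub>})\<^esub>" for r
  proof -
    have "L.frac (P +>\<^bsub>?R\<^esub> r) \<one>\<^bsub>?R Quot P\<^esub> = L.frac \<zero>\<^bsub>?R Quot P\<^esub> \<one>\<^bsub>?R Quot P\<^esub>"
      using that by (simp add: g L.frac_zero)
    then obtain u where "u \<in> carrier (?R Quot P) - {\<zero>\<^bsub>?R Quot P\<^esub>}"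
      "u \<otimes>\<^bsub>?R Quot P\<^esub> (P +>\<^bsub>?R\<^esub> r) = \<zero>\<^bsub>?R Quot P\<^esub>"
      using car' L.S_one by (subst (asm) L.frac_eq_iff) auto
    then show ?thesis using Q.integral_iff[of u] car' zero by auto
  qed
  ultimately show ?thesis
    using L.cring_localization by (simp add: fractions_mod_def quotient_field_def)
qed

lemma fractions_mod_residue_field:
  fixes P :: "'r::comm_ring_1 set"
  assumes P: "cprime P"
  shows "fractions_mod P (to_residue_field class_ring P) (residue_field class_ring P)"
proof -
  let ?R = "class_ring :: 'r ring"
  interpret R: cring ?R by (rule cring_class_ring)
  note id = cprimeD(1)[OF P]
  interpret L: cring_localization ?R "carrier ?R - P"
    by unfold_locales (auto simp: cprimeD(2)[OF P] cprime_mult[OF P])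
  let ?L = "localization ?R (carrier ?R - P)"
  interpret Lc: cring ?L by (rule L.cring_localization)
  let ?M = "local_max ?R P"
  have gens: "(\<lambda>r. L.frac r \<one>\<^bsub>?R\<^esub>) ` P \<subseteq> carrier ?L"
    using L.frac_carrier L.S_one by auto
  have M: "ideal ?M ?L" unfolding local_max_def by (rule Lc.genideal_ideal[OF gens])
  interpret M: ideal ?M ?L by (rule M)
  \<comment> \<open>Fractions with numerator in P form an ideal containing the generators of
    \<open>local_max\<close>, hence \<open>local_max\<close> itself. So r/1 in
    \<open>local_max\<close> forces r into P, and the map to k(P) has its kernel inside P.\<close>
  let ?I = "{L.frac p s | p s. p \<in> P \<and> s \<notin> P}"
  have I: "ideal ?I ?L"
  proof (rule idealI[OF Lc.ring_axioms])
    show "subgroup ?I (add_monoid ?L)"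
    proof (rule group.subgroupI[OF Lc.a_group])
      show "?I \<subseteq> carrier (add_monoid ?L)" using L.frac_carrier by auto
      show "?I \<noteq> {}" using cideal_0[OF id] cprimeD(2)[OF P] by blast
    next
      fix x assume "x \<in> ?I"
      then obtain p s where ps: "p \<in> P" "s \<notin> P" "x = L.frac p s" by blast
      have "inv\<^bsub>add_monoid ?L\<^esub> x = L.frac (- p) s"
      proof -
        have "L.frac (- p) s \<oplus>\<^bsub>?L\<^esub> x = L.frac 0 (s * s)"
          using ps L.frac_add[of "- p" p s s] by simp
        also have "\<dots> = \<zero>\<^bsub>?L\<^esub>"
          unfolding L.frac_zero using ps cprime_mult[OF P, of s s] cprimeD(2)[OF P]
          by (intro L.frac_eqI) auto
        finally have "L.frac (- p) s \<oplus>\<^bsub>?L\<^esub> x = \<zero>\<^bsub>?L\<^esub>" .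
        then have "\<ominus>\<^bsub>?L\<^esub> x = L.frac (- p) s"
          using ps L.frac_carrier[of p s] L.frac_carrier[of "- p" s] by (intro Lc.minus_equality) auto
        then show ?thesis by (simp add: a_inv_def)
      qed
      then show "inv\<^bsub>add_monoid ?L\<^esub> x \<in> ?I" using ps cideal_uminus[OF id] by auto
    next
      fix x y assume "x \<in> ?I" "y \<in> ?I"
      then obtain p s q t where ps: "p \<in> P" "s \<notin> P" "x = L.frac p s" "q \<in> P" "t \<notin> P" "y = L.frac q t" by blast
      have "x \<oplus>\<^bsub>?L\<^esub> y = L.frac (p * t + q * s) (s * t)"
        using ps L.frac_add[of p q s t] by simp
      moreover have "p * t + q * s \<in> P" "s * t \<notin> P"
        using ps by (auto intro!: cideal_add[OF id] cideal_mult2[OF id] simp: cprime_mult[OF P])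
      ultimately show "x \<otimes>\<^bsub>add_monoid ?L\<^esub> y \<in> ?I" by auto
    qed
    fix x y assume "x \<in> ?I" "y \<in> carrier ?L"
    then obtain p s where 1: "p \<in> P" "s \<notin> P" "x = L.frac p s" by blast
    obtain q t where "t \<notin> P" "y = L.frac q t"
      using L.carrier_frac[OF \<open>y \<in> carrier ?L\<close>] by blast
    note ps = 1 this
    have "y \<otimes>\<^bsub>?L\<^esub> x = L.frac (q * p) (t * s)" "x \<otimes>\<^bsub>?L\<^esub> y = L.frac (p * q) (s * t)"
      using ps L.frac_mult[of q p t s] L.frac_mult[of p q s t] by simp_all
    moreover have "q * p \<in> P" "t * s \<notin> P" "p * q \<in> P" "s * t \<notin> P"
      using ps cideal_mult[OF id ps(1)] cideal_mult2[OF id ps(1)] by (auto simp: cprime_mult[OF P])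
    ultimately show "y \<otimes>\<^bsub>?L\<^esub> x \<in> ?I" "x \<otimes>\<^bsub>?L\<^esub> y \<in> ?I" by auto
  qed
  have "(\<lambda>r. L.frac r \<one>\<^bsub>?R\<^esub>) ` P \<subseteq> ?I" using cprimeD(2)[OF P] by auto
  then have MI: "?M \<subseteq> ?I" unfolding local_max_def by (rule Lc.genideal_minimal[OF I])
  have hom: "(\<lambda>x. ?M +>\<^bsub>?L\<^esub> x) \<in> Ring.ring_hom ?L (?L Quot ?M)" by (rule M.rcos_ring_hom)
  let ?g = "to_residue_field ?R P"
  have g: "?g r = ?M +>\<^bsub>?L\<^esub> L.frac r \<one>\<^bsub>?R\<^esub>" for r by (simp add: to_residue_field_def)
  have "?g \<in> Ring.ring_hom ?R (?L Quot ?M)"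
    using ring_hom_trans[OF L.frac_ring_hom hom] by (simp add: comp_def g[abs_def])
  moreover have "\<exists>r s. s \<notin> P \<and> ?g s \<otimes>\<^bsub>?L Quot ?M\<^esub> l = ?g r" if l: "l \<in> carrier (?L Quot ?M)" for l
  proof -
    obtain x where x: "x \<in> carrier ?L" "l = ?M +>\<^bsub>?L\<^esub> x"
      using l by (auto simp: FactRing_def A_RCOSETS_def' a_r_coset_def)
    obtain a s where as: "s \<notin> P" "x = L.frac a s" using L.carrier_frac[OF x(1)] by blast
    have "?g s \<otimes>\<^bsub>?L Quot ?M\<^esub> l = ?M +>\<^bsub>?L\<^esub> (L.frac s \<one>\<^bsub>?R\<^esub> \<otimes>\<^bsub>?L\<^esub> x)"
      using ring_hom_mult[OF hom] x L.frac_carrier[of s] L.S_one by (simp add: g)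
    then show ?thesis using L.frac_denominator[of a s] as by (auto simp: g)
  qed
  moreover have "r \<in> P" if r: "?g r = \<zero>\<^bsub>?L Quot ?M\<^esub>" for r
  proof -
    have "?M +>\<^bsub>?L\<^esub> L.frac r \<one>\<^bsub>?R\<^esub> = ?M" using r by (simp add: g FactRing_def)
    moreover have "L.frac r \<one>\<^bsub>?R\<^esub> \<in> carrier ?L"
      by (rule L.frac_carrier) (simp_all add: cprimeD(2)[OF P])
    ultimately have "L.frac r \<one>\<^bsub>?R\<^esub> \<in> ?M" by (intro M.rcos_const_imp_mem)
    then obtain p s where ps: "p \<in> P" "s \<notin> P" "L.frac r \<one>\<^bsub>?R\<^esub> = L.frac p s" using MI by blast
    then obtain u where "u \<notin> P" "u * (r * s) = u * p"
      using L.frac_eq_iff[of r p 1 s] cprimeD(2)[OF P] by auto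
    then show ?thesis using cideal_mult[OF id ps(1), of u] cprimeD(3)[OF P] ps(2) by metis
  qed
  ultimately show ?thesis
    using M.quotient_is_cring[OF Lc.cring_axioms] by (simp add: fractions_mod_def residue_field_def)
qed

section \<open>Tensor products\<close>

text \<open>The homomorphism from the free abelian group extending \<open>\<beta>\<close>, in
  multiplicative notation; in the application the target is the additive group of a ring
  record.\<close>

definition frag_lift :: "('g, 'm) monoid_scheme \<Rightarrow> ('k \<Rightarrow> 'g) \<Rightarrow> ('k \<Rightarrow>\<^sub>0 int) \<Rightarrow> 'g" where
  "frag_lift M \<beta> z = finprod M (\<lambda>k. \<beta> k [^]\<^bsub>M\<^esub> lookup z k) (keys z)"

context comm_group
begin

lemma frag_lift_superset:
  assumes "finite S" "keys z \<subseteq> S" "\<beta> \<in> S \<rightarrow> carrier G"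
  shows "frag_lift G \<beta> z = finprod G (\<lambda>k. \<beta> k [^] lookup z k) S"
  unfolding frag_lift_def using assms
  by (intro finprod_mono_neutral_cong_left) (auto simp: in_keys_iff)

lemma frag_lift_closed: "\<beta> \<in> keys z \<rightarrow> carrier G \<Longrightarrow> frag_lift G \<beta> z \<in> carrier G"
  unfolding frag_lift_def by (intro finprod_closed) auto

lemma frag_lift_0: "frag_lift G \<beta> 0 = \<one>"
  by (simp add: frag_lift_def)

lemma frag_lift_of: "\<beta> k \<in> carrier G \<Longrightarrow> frag_lift G \<beta> (frag_of k) = \<beta> k"
  by (simp add: frag_lift_def keys_frag_of)

lemma frag_lift_add:
  assumes "\<beta> \<in> K \<rightarrow> carrier G" "keys x \<subseteq> K" "keys y \<subseteq> K"
  shows "frag_lift G \<beta> (x + y) = frag_lift G \<beta> x \<otimes> frag_lift G \<beta> y"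
proof -
  let ?S = "keys x \<union> keys y"
  have \<beta>: "\<beta> \<in> ?S \<rightarrow> carrier G" using assms by auto
  have "keys (x + y) \<subseteq> ?S" by (rule Poly_Mapping.keys_add)
  then have "frag_lift G \<beta> (x + y) = finprod G (\<lambda>k. \<beta> k [^] lookup (x + y) k) ?S"
    by (intro frag_lift_superset \<beta>) auto
  also have "\<dots> = finprod G (\<lambda>k. \<beta> k [^] lookup x k \<otimes> \<beta> k [^] lookup y k) ?S"
    using \<beta> by (intro finprod_cong') (auto simp: lookup_add int_pow_mult Pi_iff)
  also have "\<dots> = finprod G (\<lambda>k. \<beta> k [^] lookup x k) ?S \<otimes>
      finprod G (\<lambda>k. \<beta> k [^] lookup y k) ?S"
    using \<beta> by (intro finprod_multf) auto
  finally show ?thesis by (simp add: frag_lift_superset[OF _ _ \<beta>])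
qed

lemma frag_lift_diff:
  assumes "\<beta> \<in> K \<rightarrow> carrier G" "keys x \<subseteq> K" "keys y \<subseteq> K"
  shows "frag_lift G \<beta> (x - y) = frag_lift G \<beta> x \<otimes> inv frag_lift G \<beta> y"
proof -
  have k: "keys (x - y) \<subseteq> K" using assms keys_diff[of x y] by blast
  have c: "frag_lift G \<beta> z \<in> carrier G" if "keys z \<subseteq> K" for z
    using assms(1) that by (intro frag_lift_closed) auto
  have "frag_lift G \<beta> x = frag_lift G \<beta> (x - y) \<otimes> frag_lift G \<beta> y"
    using frag_lift_add[OF assms(1) k assms(3)] by simp
  then show ?thesis using c k assms by (simp add: m_assoc)
qed

end

locale tensor_product = B: cring B + C: cring C
  for R :: "('r, 'l) ring_scheme" and f and B :: "('b, 'm) ring_scheme" and g and C :: "('c, 'k) ring_scheme" +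
  assumes f_hom: "f \<in> Ring.ring_hom R B" and g_hom: "g \<in> Ring.ring_hom R C"
begin

abbreviation PR where "PR \<equiv> pair_ring B C"
abbreviation I where "I \<equiv> tensor_ideal R f B g C"
abbreviation AL where "AL \<equiv> tensor R f B g C"
abbreviation pure where "pure \<equiv> pure_tensor R f B g C"

definition K :: "('b \<times> 'c) set" where "K = carrier B \<times> carrier C"

definition pmul :: "('b \<times> 'c \<Rightarrow>\<^sub>0 int) \<Rightarrow> ('b \<times> 'c \<Rightarrow>\<^sub>0 int) \<Rightarrow> ('b \<times> 'c \<Rightarrow>\<^sub>0 int)" where
  "pmul x y = frag_extend (\<lambda>(b, c). frag_extend (\<lambda>(b', c'). frag_of (b \<otimes>\<^bsub>B\<^esub> b', c \<otimes>\<^bsub>C\<^esub> c')) y) x"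

lemma PR_simps:
  "carrier PR = {x. keys x \<subseteq> K}" "x \<otimes>\<^bsub>PR\<^esub> y = pmul x y" "\<one>\<^bsub>PR\<^esub> = frag_of (\<one>\<^bsub>B\<^esub>, \<one>\<^bsub>C\<^esub>)"
  "\<zero>\<^bsub>PR\<^esub> = 0" "x \<oplus>\<^bsub>PR\<^esub> y = x + y"
  by (simp_all add: pair_ring_def K_def pmul_def)

lemma pmul_of: "pmul (frag_of (b, c)) (frag_of (b', c')) = frag_of (b \<otimes>\<^bsub>B\<^esub> b', c \<otimes>\<^bsub>C\<^esub> c')"
  by (simp add: pmul_def)

lemma pmul_diff_left: "pmul (x - x') y = pmul x y - pmul x' y"
  by (simp add: pmul_def frag_extend_diff)

lemma pmul_add_left: "pmul (x + x') y = pmul x y + pmul x' y"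
  by (simp add: pmul_def frag_extend_add)

lemma pmul_diff_right: "pmul x (y - y') = pmul x y - pmul x y'"
proof -
  have "frag_cmul k (u - w) = frag_cmul k u - frag_cmul k w" for k and u w :: "'b \<times> 'c \<Rightarrow>\<^sub>0 int"
    by (rule poly_mapping_eqI) (simp add: lookup_minus right_diff_distrib)
  then show ?thesis
    by (simp add: pmul_def frag_extend_diff split_def) (simp add: frag_extend_def sum_subtractf)
qed

lemma pmul_0: "pmul 0 y = 0" "pmul x 0 = 0"
  using pmul_diff_left[of 0 0 y] pmul_diff_right[of x 0 0] by simp_all

lemma pmul_closed: "keys x \<subseteq> K \<Longrightarrow> keys y \<subseteq> K \<Longrightarrow> keys (pmul x y) \<subseteq> K"
proof (induction x rule: frag_induction)
  case zero
  then show ?case by (simp add: pmul_0)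
next
  case (one p)
  from one(2) show ?case
  proof (induction y rule: frag_induction)
    case zero
    then show ?case by (simp add: pmul_0)
  next
    case (one q)
    then show ?case using \<open>p \<in> K\<close> by (cases p, cases q) (auto simp: pmul_of keys_frag_of K_def)
  next
    case (diff a b)
    then show ?case using keys_diff[of "pmul (frag_of p) a" "pmul (frag_of p) b"]
      by (auto simp: pmul_diff_right)
  qed
next
  case (diff a b)
  then show ?case using keys_diff[of "pmul a y" "pmul b y"] by (auto simp: pmul_diff_left)
qed

lemma pmul_comm: "keys x \<subseteq> K \<Longrightarrow> keys y \<subseteq> K \<Longrightarrow> pmul x y = pmul y x"
proof (induction x rule: frag_induction)
  case (one p)
  from one(2) show ?case
  proof (induction y rule: frag_induction)
    case (one q)
    then show ?case using \<open>p \<in> K\<close>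
      by (cases p, cases q) (auto simp: pmul_of K_def B.m_comm C.m_comm)
  qed (simp_all add: pmul_0 pmul_diff_left pmul_diff_right)
qed (simp_all add: pmul_0 pmul_diff_left pmul_diff_right)

lemma pmul_assoc:
  "keys x \<subseteq> K \<Longrightarrow> keys y \<subseteq> K \<Longrightarrow> keys z \<subseteq> K \<Longrightarrow>
    pmul (pmul x y) z = pmul x (pmul y z)"
proof (induction x rule: frag_induction)
  case (one p)
  from one(2) show ?case
  proof (induction y rule: frag_induction)
    case (one q)
    from \<open>keys z \<subseteq> K\<close> show ?case
    proof (induction z rule: frag_induction)
      case (one r)
      then show ?case using \<open>p \<in> K\<close> \<open>q \<in> K\<close>
        by (cases p, cases q, cases r) (auto simp: pmul_of K_def B.m_assoc C.m_assoc)
    qed (simp_all add: pmul_0 pmul_diff_left pmul_diff_right)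
  qed (simp_all add: pmul_0 pmul_diff_left pmul_diff_right)
qed (simp_all add: pmul_0 pmul_diff_left pmul_diff_right)

lemma pmul_one: "keys x \<subseteq> K \<Longrightarrow> pmul (frag_of (\<one>\<^bsub>B\<^esub>, \<one>\<^bsub>C\<^esub>)) x = x"
proof (induction x rule: frag_induction)
  case (one p)
  then show ?case by (cases p) (auto simp: pmul_of K_def)
qed (simp_all add: pmul_0 pmul_diff_left pmul_diff_right)

lemma cring_PR: "cring PR"
proof (rule cringI)
  show "abelian_group PR"
  proof (rule abelian_groupI)
    fix x y assume "x \<in> carrier PR" "y \<in> carrier PR"
    then show "x \<oplus>\<^bsub>PR\<^esub> y \<in> carrier PR"
      using Poly_Mapping.keys_add[of x y] by (auto simp: PR_simps)
  next
    fix x assume "x \<in> carrier PR"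
    then show "\<exists>y\<in>carrier PR. y \<oplus>\<^bsub>PR\<^esub> x = \<zero>\<^bsub>PR\<^esub>"
      by (intro bexI[of _ "- x"]) (auto simp: PR_simps)
  qed (auto simp: PR_simps add_ac)
  show "comm_monoid PR"
    by (rule comm_monoidI)
      (auto simp: PR_simps pmul_closed pmul_one pmul_assoc intro: pmul_comm, auto simp: keys_frag_of K_def)
  show "(x \<oplus>\<^bsub>PR\<^esub> y) \<otimes>\<^bsub>PR\<^esub> z = x \<otimes>\<^bsub>PR\<^esub> z \<oplus>\<^bsub>PR\<^esub> y \<otimes>\<^bsub>PR\<^esub> z" for x y z
    by (simp add: PR_simps pmul_add_left)
qed

sublocale PR: cring PR by (rule cring_PR)

definition relations :: "('b \<times> 'c \<Rightarrow>\<^sub>0 int) set" where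
  "relations =
     {frag_of (b \<oplus>\<^bsub>B\<^esub> b', c) - frag_of (b, c) - frag_of (b', c) | b b' c.
         b \<in> carrier B \<and> b' \<in> carrier B \<and> c \<in> carrier C} \<union>
      {frag_of (b, c \<oplus>\<^bsub>C\<^esub> c') - frag_of (b, c) - frag_of (b, c') | b c c'.
         b \<in> carrier B \<and> c \<in> carrier C \<and> c' \<in> carrier C} \<union>
      {frag_of (f r \<otimes>\<^bsub>B\<^esub> b, c) - frag_of (b, g r \<otimes>\<^bsub>C\<^esub> c) | r b c.
         r \<in> carrier R \<and> b \<in> carrier B \<and> c \<in> carrier C}"

lemma relationsI:
  "b \<in> carrier B \<Longrightarrow> b' \<in> carrier B \<Longrightarrow> c \<in> carrier C \<Longrightarrow>
    frag_of (b \<oplus>\<^bsub>B\<^esub> b', c) - frag_of (b, c) - frag_of (b', c) \<in> relations"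
  "b \<in> carrier B \<Longrightarrow> c \<in> carrier C \<Longrightarrow> c' \<in> carrier C \<Longrightarrow>
    frag_of (b, c \<oplus>\<^bsub>C\<^esub> c') - frag_of (b, c) - frag_of (b, c') \<in> relations"
  "r \<in> carrier R \<Longrightarrow> b \<in> carrier B \<Longrightarrow> c \<in> carrier C \<Longrightarrow>
    frag_of (f r \<otimes>\<^bsub>B\<^esub> b, c) - frag_of (b, g r \<otimes>\<^bsub>C\<^esub> c) \<in> relations"
  unfolding relations_def by blast+

lemma relationsE:
  assumes "z \<in> relations"
  obtains (1) b b' c where "b \<in> carrier B" "b' \<in> carrier B" "c \<in> carrier C"
      "z = frag_of (b \<oplus>\<^bsub>B\<^esub> b', c) - frag_of (b, c) - frag_of (b', c)"
    | (2) b c c' where "b \<in> carrier B" "c \<in> carrier C" "c' \<in> carrier C"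
      "z = frag_of (b, c \<oplus>\<^bsub>C\<^esub> c') - frag_of (b, c) - frag_of (b, c')"
    | (3) r b c where "r \<in> carrier R" "b \<in> carrier B" "c \<in> carrier C"
      "z = frag_of (f r \<otimes>\<^bsub>B\<^esub> b, c) - frag_of (b, g r \<otimes>\<^bsub>C\<^esub> c)"
  using assms unfolding relations_def
proof (elim UnE CollectE exE conjE)
  fix b b' c assume "z = frag_of (b \<oplus>\<^bsub>B\<^esub> b', c) - frag_of (b, c) - frag_of (b', c)"
    "b \<in> carrier B" "b' \<in> carrier B" "c \<in> carrier C"
  then show thesis by (intro that(1)[of b b' c])
next
  fix b c c' assume "z = frag_of (b, c \<oplus>\<^bsub>C\<^esub> c') - frag_of (b, c) - frag_of (b, c')"
    "b \<in> carrier B" "c \<in> carrier C" "c' \<in> carrier C"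
  then show thesis by (intro that(2)[of b c c'])
next
  fix r b c assume "z = frag_of (f r \<otimes>\<^bsub>B\<^esub> b, c) - frag_of (b, g r \<otimes>\<^bsub>C\<^esub> c)"
    "r \<in> carrier R" "b \<in> carrier B" "c \<in> carrier C"
  then show thesis by (intro that(3)[of r b c])
qed

lemma I_def: "I = genideal PR relations"
  by (simp add: tensor_ideal_def relations_def)

lemma f_closed: "r \<in> carrier R \<Longrightarrow> f r \<in> carrier B" and g_closed: "r \<in> carrier R \<Longrightarrow> g r \<in> carrier C"
  using f_hom g_hom by (auto dest: ring_hom_closed)

lemma frag_of_carrier: "b \<in> carrier B \<Longrightarrow> c \<in> carrier C \<Longrightarrow> frag_of (b, c) \<in> carrier PR"
  by (simp add: PR_simps keys_frag_of K_def)

lemma diff_carrier: "x \<in> carrier PR \<Longrightarrow> y \<in> carrier PR \<Longrightarrow> x - y \<in> carrier PR"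
  using keys_diff[of x y] by (auto simp: PR_simps)

lemma add_carrier: "x \<in> carrier PR \<Longrightarrow> y \<in> carrier PR \<Longrightarrow> x + y \<in> carrier PR"
  using PR.a_closed[of x y] by (simp add: PR_simps(5))

lemma relations_carrier: "relations \<subseteq> carrier PR"
  unfolding relations_def
  by (auto intro!: diff_carrier frag_of_carrier B.m_closed C.m_closed B.a_closed C.a_closed f_closed g_closed)

lemma ideal_I: "ideal I PR"
  unfolding I_def by (rule PR.genideal_ideal[OF relations_carrier])

sublocale I: ideal I PR by (rule ideal_I)

lemma relations_I: "relations \<subseteq> I"
  unfolding I_def by (rule PR.genideal_self[OF relations_carrier])

sublocale AL: cring AL
  unfolding tensor_def by (rule I.quotient_is_cring[OF cring_PR])

definition cls where "cls x = I +>\<^bsub>PR\<^esub> x"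

lemma cls_hom: "cls \<in> Ring.ring_hom PR AL"
  unfolding tensor_def cls_def[abs_def] by (rule I.rcos_ring_hom)

lemma pure_cls: "pure b c = cls (frag_of (b, c))"
  by (simp add: pure_tensor_def cls_def)

lemma carrier_cls: "X \<in> carrier AL \<Longrightarrow> \<exists>x\<in>carrier PR. X = cls x"
  by (auto simp: tensor_def FactRing_def A_RCOSETS_def' a_r_coset_def cls_def)

lemma cls_eq_iff: "x \<in> carrier PR \<Longrightarrow> y \<in> carrier PR \<Longrightarrow> cls x = cls y \<longleftrightarrow> x - y \<in> I"
proof -
  assume xy: "x \<in> carrier PR" "y \<in> carrier PR"
  have "\<ominus>\<^bsub>PR\<^esub> y = - y"
    using xy by (intro PR.minus_equality) (auto simp: PR_simps)
  then have "x \<ominus>\<^bsub>PR\<^esub> y = x - y" by (simp add: a_minus_def PR_simps)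
  then show ?thesis
    using PR.quotient_eq_iff_same_a_r_cos[OF ideal_I xy] by (simp add: cls_def)
qed

lemma cls_add: "x \<in> carrier PR \<Longrightarrow> y \<in> carrier PR \<Longrightarrow> cls (x + y) = cls x \<oplus>\<^bsub>AL\<^esub> cls y"
  using ring_hom_add[OF cls_hom, of x y] by (simp add: PR_simps)

lemma cls_diff: "x \<in> carrier PR \<Longrightarrow> y \<in> carrier PR \<Longrightarrow> cls (x - y) = cls x \<ominus>\<^bsub>AL\<^esub> cls y"
proof -
  assume xy: "x \<in> carrier PR" "y \<in> carrier PR"
  have "cls (x - y) \<oplus>\<^bsub>AL\<^esub> cls y = cls x"
    using cls_add[OF diff_carrier[OF xy] xy(2)] by simp
  moreover have "cls (x - y) \<in> carrier AL" "cls x \<in> carrier AL" "cls y \<in> carrier AL"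
    using xy diff_carrier ring_hom_closed[OF cls_hom] by blast+
  ultimately show ?thesis
    by (metis AL.minus_closed AL.r_neg2 AL.a_comm a_minus_def AL.a_inv_closed)
qed

lemma cls_0: "cls 0 = \<zero>\<^bsub>AL\<^esub>"
proof -
  have "cls 0 = cls 0 \<ominus>\<^bsub>AL\<^esub> cls 0" using cls_diff[of 0 0] by (simp add: PR_simps)
  moreover have "cls 0 \<in> carrier AL" using ring_hom_closed[OF cls_hom, of 0] by (simp add: PR_simps)
  ultimately show ?thesis by (simp add: a_minus_def AL.r_neg)
qed

lemma pure_closed: "b \<in> carrier B \<Longrightarrow> c \<in> carrier C \<Longrightarrow> pure b c \<in> carrier AL"
  unfolding pure_cls by (rule ring_hom_closed[OF cls_hom frag_of_carrier])

lemma pure_mult: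
  "b \<in> carrier B \<Longrightarrow> c \<in> carrier C \<Longrightarrow> b' \<in> carrier B \<Longrightarrow> c' \<in> carrier C \<Longrightarrow>
    pure b c \<otimes>\<^bsub>AL\<^esub> pure b' c' = pure (b \<otimes>\<^bsub>B\<^esub> b') (c \<otimes>\<^bsub>C\<^esub> c')"
  unfolding pure_cls using ring_hom_mult[OF cls_hom frag_of_carrier frag_of_carrier]
  by (simp add: PR_simps pmul_of)

lemma pure_one: "\<one>\<^bsub>AL\<^esub> = pure \<one>\<^bsub>B\<^esub> \<one>\<^bsub>C\<^esub>"
  unfolding pure_cls using ring_hom_one[OF cls_hom] by (simp add: PR_simps)

lemma pure_add_left:
  assumes "b \<in> carrier B" "b' \<in> carrier B" "c \<in> carrier C"
  shows "pure (b \<oplus>\<^bsub>B\<^esub> b') c = pure b c \<oplus>\<^bsub>AL\<^esub> pure b' c"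
proof -
  have "frag_of (b \<oplus>\<^bsub>B\<^esub> b', c) - frag_of (b, c) - frag_of (b', c) \<in> I"
    using relations_I relationsI(1)[OF assms] by blast
  then have "cls (frag_of (b \<oplus>\<^bsub>B\<^esub> b', c)) = cls (frag_of (b, c) + frag_of (b', c))"
    using assms by (subst cls_eq_iff) (simp_all add: frag_of_carrier add_carrier diff_diff_eq)
  then show ?thesis using assms by (simp add: pure_cls cls_add frag_of_carrier)
qed

lemma pure_add_right:
  assumes "b \<in> carrier B" "c \<in> carrier C" "c' \<in> carrier C"
  shows "pure b (c \<oplus>\<^bsub>C\<^esub> c') = pure b c \<oplus>\<^bsub>AL\<^esub> pure b c'"
proof -
  have "frag_of (b, c \<oplus>\<^bsub>C\<^esub> c') - frag_of (b, c) - frag_of (b, c') \<in> I"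
    using relations_I relationsI(2)[OF assms] by blast
  then have "cls (frag_of (b, c \<oplus>\<^bsub>C\<^esub> c')) = cls (frag_of (b, c) + frag_of (b, c'))"
    using assms by (subst cls_eq_iff) (simp_all add: frag_of_carrier add_carrier diff_diff_eq)
  then show ?thesis using assms by (simp add: pure_cls cls_add frag_of_carrier)
qed

lemma pure_balanced:
  assumes "r \<in> carrier R" "b \<in> carrier B" "c \<in> carrier C"
  shows "pure (f r \<otimes>\<^bsub>B\<^esub> b) c = pure b (g r \<otimes>\<^bsub>C\<^esub> c)"
proof -
  have "frag_of (f r \<otimes>\<^bsub>B\<^esub> b, c) - frag_of (b, g r \<otimes>\<^bsub>C\<^esub> c) \<in> I"
    using relations_I relationsI(3)[OF assms] by blast
  then show ?thesis using assms
    by (simp add: pure_cls cls_eq_iff frag_of_carrier f_closed g_closed)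
qed

lemma pure_zero: "c \<in> carrier C \<Longrightarrow> pure \<zero>\<^bsub>B\<^esub> c = \<zero>\<^bsub>AL\<^esub>"
proof -
  assume c: "c \<in> carrier C"
  let ?x = "pure \<zero>\<^bsub>B\<^esub> c"
  have x: "?x \<in> carrier AL" using c by (simp add: pure_closed)
  have "?x \<oplus>\<^bsub>AL\<^esub> ?x = ?x" using pure_add_left[of "\<zero>\<^bsub>B\<^esub>" "\<zero>\<^bsub>B\<^esub>" c] c by simp
  then have "\<ominus>\<^bsub>AL\<^esub> ?x \<oplus>\<^bsub>AL\<^esub> (?x \<oplus>\<^bsub>AL\<^esub> ?x) = \<ominus>\<^bsub>AL\<^esub> ?x \<oplus>\<^bsub>AL\<^esub> ?x" by simp
  then show ?thesis using x by (simp only: AL.r_neg1 AL.l_neg)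
qed

lemma pure_uminus: "b \<in> carrier B \<Longrightarrow> c \<in> carrier C \<Longrightarrow> pure (\<ominus>\<^bsub>B\<^esub> b) c = \<ominus>\<^bsub>AL\<^esub> pure b c"
  using pure_add_left[of "\<ominus>\<^bsub>B\<^esub> b" b c]
  by (intro AL.minus_equality[symmetric]) (auto simp: B.l_neg pure_zero pure_closed)

lemma tensor_induct [consumes 1, case_names pure add]:
  assumes "X \<in> carrier AL"
    and pure: "\<And>b c. b \<in> carrier B \<Longrightarrow> c \<in> carrier C \<Longrightarrow> P (pure b c)"
    and add: "\<And>X Y. X \<in> carrier AL \<Longrightarrow> Y \<in> carrier AL \<Longrightarrow> P X \<Longrightarrow> P Y \<Longrightarrow> P (X \<oplus>\<^bsub>AL\<^esub> Y)"
  shows "P X"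
proof -
  have 0: "P \<zero>\<^bsub>AL\<^esub>" using pure[of "\<zero>\<^bsub>B\<^esub>" "\<zero>\<^bsub>C\<^esub>"] pure_zero[of "\<zero>\<^bsub>C\<^esub>"] by simp
  obtain x where x: "keys x \<subseteq> K" "X = cls x"
    using carrier_cls[OF assms(1)] by (auto simp: PR_simps)
  \<comment> \<open>The free group is built up by differences, while \<open>P\<close> is known to
    respect sums; the claim therefore includes negatives, and the negative of a pure tensor is
    pure.\<close>
  have "cls x \<in> carrier AL \<and> x \<in> carrier PR \<and> P (cls x) \<and> P (\<ominus>\<^bsub>AL\<^esub> cls x)"
    using x(1)
  proof (induction x rule: frag_induction)
    case zero
    then show ?case by (simp add: cls_0 0 PR_simps)
  next
    case (one p)
    then obtain b c where p: "p = (b, c)" "b \<in> carrier B" "c \<in> carrier C" by (auto simp: K_def)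
    then show ?case
      using pure[of b c] pure[of "\<ominus>\<^bsub>B\<^esub> b" c]
      by (simp add: pure_uminus flip: pure_cls) (simp add: pure_closed frag_of_carrier)
  next
    case (diff a b)
    then have c: "cls a \<in> carrier AL" "cls b \<in> carrier AL" "a \<in> carrier PR" "b \<in> carrier PR" by auto
    have "P (cls a \<oplus>\<^bsub>AL\<^esub> \<ominus>\<^bsub>AL\<^esub> cls b)" "P (\<ominus>\<^bsub>AL\<^esub> cls a \<oplus>\<^bsub>AL\<^esub> cls b)"
      using diff c by (auto intro!: add)
    moreover have "\<ominus>\<^bsub>AL\<^esub> (cls a \<oplus>\<^bsub>AL\<^esub> \<ominus>\<^bsub>AL\<^esub> cls b) = \<ominus>\<^bsub>AL\<^esub> cls a \<oplus>\<^bsub>AL\<^esub> cls b"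
      using c by (simp add: AL.minus_add)
    ultimately show ?case
      using c by (simp add: cls_diff a_minus_def) (simp add: diff_carrier)
  qed
  then show ?thesis by (simp add: x(2))
qed

text \<open>The universal property of the tensor product for balanced biadditive maps. It is stated
  for abelian groups because it serves for coefficient functionals, which are not
  multiplicative.\<close>

lemma additive_functional:
  fixes E :: "('e, 'n) ring_scheme"
  assumes E: "abelian_group E"
    and closed: "\<And>b c. b \<in> carrier B \<Longrightarrow> c \<in> carrier C \<Longrightarrow> \<beta> b c \<in> carrier E"
    and left: "\<And>b b' c. b \<in> carrier B \<Longrightarrow> b' \<in> carrier B \<Longrightarrow> c \<in> carrier C \<Longrightarrow>
      \<beta> (b \<oplus>\<^bsub>B\<^esub> b') c = \<beta> b c \<oplus>\<^bsub>E\<^esub> \<beta> b' c"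
    and right: "\<And>b c c'. b \<in> carrier B \<Longrightarrow> c \<in> carrier C \<Longrightarrow> c' \<in> carrier C \<Longrightarrow>
      \<beta> b (c \<oplus>\<^bsub>C\<^esub> c') = \<beta> b c \<oplus>\<^bsub>E\<^esub> \<beta> b c'"
    and balanced: "\<And>r b c. r \<in> carrier R \<Longrightarrow> b \<in> carrier B \<Longrightarrow> c \<in> carrier C \<Longrightarrow>
      \<beta> (f r \<otimes>\<^bsub>B\<^esub> b) c = \<beta> b (g r \<otimes>\<^bsub>C\<^esub> c)"
  obtains \<phi> where "\<And>X. X \<in> carrier AL \<Longrightarrow> \<phi> X \<in> carrier E"
    "\<And>X Y. X \<in> carrier AL \<Longrightarrow> Y \<in> carrier AL \<Longrightarrow> \<phi> (X \<oplus>\<^bsub>AL\<^esub> Y) = \<phi> X \<oplus>\<^bsub>E\<^esub> \<phi> Y"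
    "\<And>b c. b \<in> carrier B \<Longrightarrow> c \<in> carrier C \<Longrightarrow> \<phi> (pure b c) = \<beta> b c"
proof -
  interpret E: abelian_group E by (rule E)
  note M = E.a_comm_group
  define l where "l = frag_lift (add_monoid E) (\<lambda>(b, c). \<beta> b c)"
  have \<beta>: "(\<lambda>(b, c). \<beta> b c) \<in> K \<rightarrow> carrier (add_monoid E)" by (auto simp: K_def closed)
  have l_closed: "l x \<in> carrier E" if "x \<in> carrier PR" for x
    using comm_group.frag_lift_closed[OF M, of "\<lambda>(b, c). \<beta> b c" x] \<beta> that by (auto simp: l_def PR_simps)
  have l_add: "l (x + y) = l x \<oplus>\<^bsub>E\<^esub> l y" if "x \<in> carrier PR" "y \<in> carrier PR" for x y
    using comm_group.frag_lift_add[OF M \<beta>, of x y] that by (simp add: l_def PR_simps)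
  have l_diff: "l (x - y) = l x \<ominus>\<^bsub>E\<^esub> l y" if "x \<in> carrier PR" "y \<in> carrier PR" for x y
    using comm_group.frag_lift_diff[OF M \<beta>, of x y] that by (simp add: l_def PR_simps a_minus_def a_inv_def)
  have l_of: "l (frag_of (b, c)) = \<beta> b c" if "b \<in> carrier B" "c \<in> carrier C" for b c
    using comm_group.frag_lift_of[OF M, of "\<lambda>(b, c). \<beta> b c" "(b, c)"] closed[OF that] by (simp add: l_def)
  have l_0: "l 0 = \<zero>\<^bsub>E\<^esub>" using comm_group.frag_lift_0[OF M] by (simp add: l_def)
  \<comment> \<open>The relations generate \<open>I\<close> as an ideal, so vanishing on them is not
    enough. \<open>N\<close> is the largest ideal on which the additive map \<open>l\<close>
    vanishes, and it contains the relations because a relation times a pair is again a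
    relation.\<close>
  define N where "N = {z \<in> carrier PR. \<forall>w\<in>carrier PR. l (pmul w z) = \<zero>\<^bsub>E\<^esub>}"
  have pm: "pmul x y \<in> carrier PR" if "x \<in> carrier PR" "y \<in> carrier PR" for x y
    using pmul_closed that by (auto simp: PR_simps)
  have "ideal N PR"
  proof (rule idealI[OF PR.ring_axioms])
    show "subgroup N (add_monoid PR)"
    proof (rule group.subgroupI[OF PR.a_group])
      show "N \<subseteq> carrier (add_monoid PR)" by (auto simp: N_def)
      have "0 \<in> N" by (simp add: N_def PR_simps pmul_0 l_0)
      then show "N \<noteq> {}" by blast
    next
      fix x assume x: "x \<in> N"
      have "\<ominus>\<^bsub>PR\<^esub> x = - x"
        using x by (intro PR.minus_equality) (auto simp: PR_simps N_def)
      moreover have "- x \<in> N"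
      proof -
        have "l (pmul w (- x)) = \<zero>\<^bsub>E\<^esub>" if "w \<in> carrier PR" for w
        proof -
          have "pmul w (- x) = 0 - pmul w x" using pmul_diff_right[of w 0 x] by (simp add: pmul_0)
          then show ?thesis
            using x that l_diff[of 0 "pmul w x"] pm[of w x]
            by (simp add: N_def l_0 PR_simps(1) a_minus_def)
        qed
        then show ?thesis using x by (simp add: N_def PR_simps)
      qed
      ultimately show "inv\<^bsub>add_monoid PR\<^esub> x \<in> N" by (simp add: a_inv_def)
    next
      fix x y assume xy: "x \<in> N" "y \<in> N"
      have "pmul w (x + y) = pmul w x + pmul w y" for w
        using pmul_diff_right[of w "x + y" y] by (simp add: eq_diff_eq)
      then show "x \<otimes>\<^bsub>add_monoid PR\<^esub> y \<in> N"
        using xy PR.a_closed[of x y] by (auto simp: N_def PR_simps(5) l_add pm)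
    qed
    fix x z assume x: "x \<in> N" and z: "z \<in> carrier PR"
    then have xc: "x \<in> carrier PR" by (simp add: N_def)
    have "l (pmul w (pmul z x)) = \<zero>\<^bsub>E\<^esub>" if "w \<in> carrier PR" for w
    proof -
      have "l (pmul (pmul w z) x) = \<zero>\<^bsub>E\<^esub>" using x pm[OF that z] by (simp add: N_def)
      moreover have "pmul (pmul w z) x = pmul w (pmul z x)"
        using z xc that by (intro pmul_assoc) (simp_all add: PR_simps(1))
      ultimately show ?thesis by simp
    qed
    then have "pmul z x \<in> N" using z xc by (simp add: N_def pm)
    moreover have "pmul x z = pmul z x" using z xc by (intro pmul_comm) (auto simp: PR_simps)
    ultimately show "z \<otimes>\<^bsub>PR\<^esub> x \<in> N" "x \<otimes>\<^bsub>PR\<^esub> z \<in> N" by (simp_all add: PR_simps)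
  qed
  moreover have "relations \<subseteq> N"
  proof
    fix z assume z: "z \<in> relations"
    then have zc: "z \<in> carrier PR" using relations_carrier by blast
    have pure_case: "l (pmul (frag_of p) z) = \<zero>\<^bsub>E\<^esub>" if p: "p \<in> K" for p
    proof -
      obtain b0 c0 where [simp]: "p = (b0, c0)" and bc0: "b0 \<in> carrier B" "c0 \<in> carrier C"
        using p by (auto simp: K_def)
      have zero: "u \<ominus>\<^bsub>E\<^esub> u = \<zero>\<^bsub>E\<^esub>" "u \<oplus>\<^bsub>E\<^esub> w \<ominus>\<^bsub>E\<^esub> u \<ominus>\<^bsub>E\<^esub> w = \<zero>\<^bsub>E\<^esub>" if "u \<in> carrier E" "w \<in> carrier E" for u w
        using that by (simp_all add: a_minus_def E.r_neg E.a_ac)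
          (metis E.a_assoc E.a_comm E.a_inv_closed E.add.m_closed E.r_neg E.r_neg1)
      from z show ?thesis
      proof (cases rule: relationsE)
        case (1 b b' c)
        have "l (pmul (frag_of p) z) = \<beta> (b0 \<otimes>\<^bsub>B\<^esub> b \<oplus>\<^bsub>B\<^esub> b0 \<otimes>\<^bsub>B\<^esub> b') (c0 \<otimes>\<^bsub>C\<^esub> c) \<ominus>\<^bsub>E\<^esub>
            \<beta> (b0 \<otimes>\<^bsub>B\<^esub> b) (c0 \<otimes>\<^bsub>C\<^esub> c) \<ominus>\<^bsub>E\<^esub> \<beta> (b0 \<otimes>\<^bsub>B\<^esub> b') (c0 \<otimes>\<^bsub>C\<^esub> c)"
          using 1 bc0 by (simp add: pmul_diff_right pmul_of l_diff diff_carrier frag_of_carrier l_of B.r_distr)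
        then show ?thesis using 1 bc0 by (simp add: left closed zero)
      next
        case (2 b c c')
        have "l (pmul (frag_of p) z) = \<beta> (b0 \<otimes>\<^bsub>B\<^esub> b) (c0 \<otimes>\<^bsub>C\<^esub> c \<oplus>\<^bsub>C\<^esub> c0 \<otimes>\<^bsub>C\<^esub> c') \<ominus>\<^bsub>E\<^esub>
            \<beta> (b0 \<otimes>\<^bsub>B\<^esub> b) (c0 \<otimes>\<^bsub>C\<^esub> c) \<ominus>\<^bsub>E\<^esub> \<beta> (b0 \<otimes>\<^bsub>B\<^esub> b) (c0 \<otimes>\<^bsub>C\<^esub> c')"
          using 2 bc0 by (simp add: pmul_diff_right pmul_of l_diff diff_carrier frag_of_carrier l_of C.r_distr)
        then show ?thesis using 2 bc0 by (simp add: right closed zero)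
      next
        case (3 r b c)
        have "l (pmul (frag_of p) z) = \<beta> (f r \<otimes>\<^bsub>B\<^esub> (b0 \<otimes>\<^bsub>B\<^esub> b)) (c0 \<otimes>\<^bsub>C\<^esub> c) \<ominus>\<^bsub>E\<^esub>
            \<beta> (b0 \<otimes>\<^bsub>B\<^esub> b) (g r \<otimes>\<^bsub>C\<^esub> (c0 \<otimes>\<^bsub>C\<^esub> c))"
          using 3 bc0
          by (simp add: pmul_diff_right pmul_of l_diff frag_of_carrier l_of f_closed g_closed B.m_lcomm C.m_lcomm)
        then show ?thesis using 3 bc0 by (simp add: balanced closed g_closed zero)
      qed
    qed
    have "l (pmul w z) = \<zero>\<^bsub>E\<^esub> \<and> w \<in> carrier PR" if "keys w \<subseteq> K" for w
      using that
    proof (induction w rule: frag_induction)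
      case zero
      then show ?case by (simp add: pmul_0 l_0 PR_simps)
    next
      case (one p)
      then show ?case using pure_case[OF one] by (simp add: PR_simps keys_frag_of)
    next
      case (diff a b)
      then show ?case using zc by (simp add: pmul_diff_left l_diff pm diff_carrier a_minus_def)
    qed
    then show "z \<in> N" using zc by (auto simp: N_def PR_simps)
  qed
  ultimately have "I \<subseteq> N" unfolding I_def by (rule PR.genideal_minimal)
  have l_I: "l z = \<zero>\<^bsub>E\<^esub>" if "z \<in> I" for z
  proof -
    have "z \<in> N" using \<open>I \<subseteq> N\<close> that by blast
    then have "l (pmul \<one>\<^bsub>PR\<^esub> z) = \<zero>\<^bsub>E\<^esub>" "z \<in> carrier PR" using PR.one_closed by (simp_all add: N_def)
    then show ?thesis using pmul_one[of z] by (simp add: PR_simps)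
  qed
  define \<phi> where "\<phi> X = l (SOME x. x \<in> carrier PR \<and> cls x = X)" for X
  have \<phi>: "\<phi> (cls x) = l x" if x: "x \<in> carrier PR" for x
  proof -
    let ?y = "SOME y. y \<in> carrier PR \<and> cls y = cls x"
    have y: "?y \<in> carrier PR" "cls ?y = cls x"
      using someI[of "\<lambda>y. y \<in> carrier PR \<and> cls y = cls x" x] x by auto
    then have "l (?y - x) = \<zero>\<^bsub>E\<^esub>" using cls_eq_iff[OF y(1) x] l_I by blast
    then have "l ?y = l x"
      using l_add[OF diff_carrier[OF y(1) x] x] l_closed[OF x] by simp
    then show ?thesis by (simp add: \<phi>_def)
  qed
  show ?thesis
  proof (rule that[of \<phi>])
    show "\<phi> X \<in> carrier E" if "X \<in> carrier AL" for X
      using carrier_cls[OF that] \<phi> l_closed by auto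
    show "\<phi> (X \<oplus>\<^bsub>AL\<^esub> Y) = \<phi> X \<oplus>\<^bsub>E\<^esub> \<phi> Y" if XY: "X \<in> carrier AL" "Y \<in> carrier AL" for X Y
    proof -
      obtain x y where xy: "x \<in> carrier PR" "X = cls x" "y \<in> carrier PR" "Y = cls y"
        using carrier_cls XY by blast
      have "x + y \<in> carrier PR" using xy PR.a_closed[of x y] by (simp add: PR_simps(5))
      then show ?thesis using xy by (simp add: \<phi> l_add flip: cls_add)
    qed
    show "\<phi> (pure b c) = \<beta> b c" if "b \<in> carrier B" "c \<in> carrier C" for b c
      using that by (simp add: pure_cls \<phi> frag_of_carrier l_of)
  qed
qed

end

section \<open>The map of tensor products induced by a subring\<close>

locale tensor_subring = tensor_product R f B g C
  for R :: "('r, 'l) ring_scheme" and f and B :: "('b, 'm) ring_scheme" and g and C :: "('c, 'k) ring_scheme" +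
  fixes S assumes S: "subring S B" and f_S: "f ` carrier R \<subseteq> S"
begin

lemma S_closed: "s \<in> S \<Longrightarrow> s \<in> carrier B"
  using subringE(1)[OF S] by blast

sublocale Sub: tensor_product R f "B\<lparr>carrier := S\<rparr>" g C
proof (intro tensor_product.intro tensor_product_axioms.intro)
  show "cring (B\<lparr>carrier := S\<rparr>)"
    using B.subcring_iff[OF subringE(1)[OF S]] B.subcringI'[OF S] by simp
  show "f \<in> Ring.ring_hom R (B\<lparr>carrier := S\<rparr>)"
    using f_S ring_hom_mult[OF f_hom] ring_hom_add[OF f_hom] ring_hom_one[OF f_hom]
    by (intro ring_hom_memI) auto
qed (use C.cring_axioms g_hom in auto)

abbreviation incl where "incl \<equiv> tensor_incl R f B g C"

lemma sub_simps: "carrier (B\<lparr>carrier := S\<rparr>) = S" "\<one>\<^bsub>B\<lparr>carrier := S\<rparr>\<^esub> = \<one>\<^bsub>B\<^esub>" "b \<otimes>\<^bsub>B\<lparr>carrier := S\<rparr>\<^esub> b' = b \<otimes>\<^bsub>B\<^esub> b'"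
  "b \<oplus>\<^bsub>B\<lparr>carrier := S\<rparr>\<^esub> b' = b \<oplus>\<^bsub>B\<^esub> b'"
  by simp_all

lemma Sub_carrier: "x \<in> carrier Sub.PR \<Longrightarrow> x \<in> carrier PR"
  using S_closed by (auto simp: PR_simps Sub.PR_simps K_def Sub.K_def)

lemma Sub_pmul: "Sub.pmul x y = pmul x y"
  by (simp add: pmul_def Sub.pmul_def)

text \<open>Intersecting the larger relation ideal with the smaller pair ring gives an ideal there
  that contains the smaller relations.\<close>

lemma Sub_I: "Sub.I \<subseteq> I"
proof -
  let ?N = "I \<inter> carrier Sub.PR"
  have "ideal ?N Sub.PR"
  proof (rule idealI[OF Sub.PR.ring_axioms])
    show "subgroup ?N (add_monoid Sub.PR)"
    proof (rule group.subgroupI[OF Sub.PR.a_group])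
      have "0 \<in> ?N" using I.zero_closed by (simp add: PR_simps Sub.PR_simps)
      then show "?N \<noteq> {}" by blast
    next
      fix x assume x: "x \<in> ?N"
      have "\<ominus>\<^bsub>Sub.PR\<^esub> x = - x"
        using x by (intro Sub.PR.minus_equality) (auto simp: Sub.PR_simps)
      moreover have "\<ominus>\<^bsub>PR\<^esub> x = - x"
        using x Sub_carrier[of x] by (intro PR.minus_equality) (auto simp: PR_simps)
      ultimately show "inv\<^bsub>add_monoid Sub.PR\<^esub> x \<in> ?N"
        using x I.a_inv_closed[of x] by (simp add: a_inv_def) (simp add: Sub.PR_simps)
    next
      fix x y assume "x \<in> ?N" "y \<in> ?N"
      then show "x \<otimes>\<^bsub>add_monoid Sub.PR\<^esub> y \<in> ?N"
        using I.a_closed[of x y] Sub.PR.a_closed[of x y] by (simp add: PR_simps(5) Sub.PR_simps(5))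
    qed simp
    fix x z assume xz: "x \<in> ?N" "z \<in> carrier Sub.PR"
    then show "z \<otimes>\<^bsub>Sub.PR\<^esub> x \<in> ?N"
      using I.I_l_closed[of x z] Sub.PR.m_closed[of z x] Sub_carrier[of z]
      by (simp add: PR_simps(2) Sub.PR_simps(2) Sub_pmul)
    show "x \<otimes>\<^bsub>Sub.PR\<^esub> z \<in> ?N"
      using xz I.I_r_closed[of x z] Sub.PR.m_closed[of x z] Sub_carrier[of z]
      by (simp add: PR_simps(2) Sub.PR_simps(2) Sub_pmul)
  qed
  moreover have "Sub.relations \<subseteq> relations"
    unfolding Sub.relations_def relations_def sub_simps
    by (intro Un_mono Collect_mono impI; elim exE conjE; intro exI conjI; (assumption | erule S_closed))
  then have "Sub.relations \<subseteq> ?N" using relations_I Sub.relations_carrier by blast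
  ultimately show ?thesis using Sub.PR.genideal_minimal unfolding Sub.I_def by blast
qed

text \<open>All elements of a coset of the smaller ideal lie in one coset of the larger, so the
  union defining \<open>tensor_incl\<close> runs over copies of a single set.\<close>

lemma incl_cls:
  assumes x: "x \<in> carrier Sub.PR"
  shows "incl (Sub.cls x) = cls x"
proof -
  have eq: "cls z = cls x" if z: "z \<in> Sub.cls x" for z
  proof -
    obtain i where i: "i \<in> Sub.I" "z = i + x"
      using z by (auto simp: Sub.cls_def a_r_coset_def' Sub.PR_simps(5))
    have ic: "i \<in> carrier PR" using i(1) Sub_I I.a_Hcarr by blast
    then have "z \<in> carrier PR" using i(2) PR.a_closed[OF ic Sub_carrier[OF x]] by (simp add: PR_simps(5))
    then show ?thesis using i Sub_I Sub_carrier[OF x] by (subst cls_eq_iff) auto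
  qed
  have "x \<in> Sub.cls x"
    using Sub.I.zero_closed by (auto simp: Sub.cls_def a_r_coset_def' Sub.PR_simps(4,5) intro!: bexI[of _ 0])
  then have ne: "Sub.cls x \<noteq> {}" by blast
  show ?thesis unfolding tensor_incl_def cls_def[symmetric] by (rule SUP_eq_const[OF ne eq])
qed

lemma incl_pure: "b \<in> S \<Longrightarrow> c \<in> carrier C \<Longrightarrow> incl (Sub.pure b c) = pure b c"
  unfolding pure_cls Sub.pure_cls by (rule incl_cls) (simp add: Sub.frag_of_carrier)

lemma incl_hom: "incl \<in> Ring.ring_hom Sub.AL AL"
proof (rule ring_hom_memI)
  fix X Y assume "X \<in> carrier Sub.AL" "Y \<in> carrier Sub.AL"
  then obtain x y where xy: "x \<in> carrier Sub.PR" "X = Sub.cls x" "y \<in> carrier Sub.PR" "Y = Sub.cls y"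
    using Sub.carrier_cls by blast
  note c = xy(1,3)[THEN Sub_carrier]
  show "incl X \<in> carrier AL" using xy c ring_hom_closed[OF cls_hom] by (simp add: incl_cls)
  have "X \<otimes>\<^bsub>Sub.AL\<^esub> Y = Sub.cls (pmul x y)"
    using xy ring_hom_mult[OF Sub.cls_hom, of x y] by (simp add: Sub.PR_simps(2) Sub_pmul)
  moreover have "pmul x y \<in> carrier Sub.PR"
    using xy Sub.PR.m_closed[of x y] by (simp add: Sub.PR_simps(2) Sub_pmul)
  ultimately show "incl (X \<otimes>\<^bsub>Sub.AL\<^esub> Y) = incl X \<otimes>\<^bsub>AL\<^esub> incl Y"
    using xy ring_hom_mult[OF cls_hom c] by (simp add: incl_cls PR_simps(2))
  have "X \<oplus>\<^bsub>Sub.AL\<^esub> Y = Sub.cls (x + y)"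
    using xy by (simp add: Sub.cls_add)
  moreover have "x + y \<in> carrier Sub.PR"
    using xy Sub.PR.a_closed[of x y] by (simp add: Sub.PR_simps(5))
  ultimately show "incl (X \<oplus>\<^bsub>Sub.AL\<^esub> Y) = incl X \<oplus>\<^bsub>AL\<^esub> incl Y"
    using xy c by (simp add: incl_cls cls_add)
next
  show "incl \<one>\<^bsub>Sub.AL\<^esub> = \<one>\<^bsub>AL\<^esub>"
    using incl_pure[of "\<one>\<^bsub>B\<^esub>" "\<one>\<^bsub>C\<^esub>"] subringE(3)[OF S] by (simp add: Sub.pure_one pure_one)
qed

end

section \<open>Subrings of a type as ring records\<close>

abbreviation (input) subring_record :: "'a::comm_ring_1 set \<Rightarrow> 'a ring" where
  "subring_record A \<equiv> \<lparr>carrier = A, monoid.mult = (*), one = 1, zero = 0, add = (+)\<rparr>"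

definition csubring :: "'a::comm_ring_1 set \<Rightarrow> bool" where
  "csubring A \<longleftrightarrow> 1 \<in> A \<and> (\<forall>x\<in>A. - x \<in> A) \<and> (\<forall>x\<in>A. \<forall>y\<in>A. x + y \<in> A \<and> x * y \<in> A)"

lemma csubringD:
  assumes "csubring A"
  shows "1 \<in> A" "0 \<in> A" "x \<in> A \<Longrightarrow> - x \<in> A" "x \<in> A \<Longrightarrow> y \<in> A \<Longrightarrow> x + y \<in> A"
    "x \<in> A \<Longrightarrow> y \<in> A \<Longrightarrow> x * y \<in> A"
proof -
  have "1 + - 1 \<in> A" using assms unfolding csubring_def by blast
  then show "0 \<in> A" by simp
qed (use assms in \<open>auto simp: csubring_def\<close>)

lemma cring_subring_record:
  assumes A: "csubring A"
  shows "cring (subring_record A)"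
proof (rule cringI)
  show "abelian_group (subring_record A)"
  proof (rule abelian_groupI)
    show "\<exists>y\<in>carrier (subring_record A). y \<oplus>\<^bsub>subring_record A\<^esub> x = \<zero>\<^bsub>subring_record A\<^esub>"
      if "x \<in> carrier (subring_record A)" for x
      using that csubringD[OF A] by (intro bexI[of _ "- x"]) auto
  qed (use csubringD[OF A] in \<open>auto simp: add_ac\<close>)
  show "comm_monoid (subring_record A)"
    by (rule comm_monoidI) (use csubringD[OF A] in \<open>auto simp: mult_ac\<close>)
qed (auto simp: distrib_right)

lemma subring_record_a_inv:
  assumes A: "csubring A" and "x \<in> A"
  shows "\<ominus>\<^bsub>subring_record A\<^esub> x = - x"
proof -
  interpret cring "subring_record A" by (rule cring_subring_record[OF A])
  show ?thesis using assms csubringD[OF A] by (intro minus_equality) auto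
qed

lemma finsum_subring_record:
  assumes A: "csubring A" and "finite I" "\<And>i. i \<in> I \<Longrightarrow> f i \<in> A"
  shows "finsum (subring_record A) f I = sum f I"
proof -
  interpret cring "subring_record A" by (rule cring_subring_record[OF A])
  show ?thesis using assms(2,3)
    by (induction I) (simp_all add: finsum_insert Pi_def)
qed

lemma finprod_subring_record:
  assumes A: "csubring A" and "finite I" "\<And>i. i \<in> I \<Longrightarrow> f i \<in> A"
  shows "finprod (subring_record A) f I = prod f I"
proof -
  interpret cring "subring_record A" by (rule cring_subring_record[OF A])
  show ?thesis using assms(2,3)
    by (induction I) (simp_all add: finprod_insert Pi_def)
qed

lemma pow_subring_record: "x [^]\<^bsub>subring_record A\<^esub> (k::nat) = x ^ k"
  by (induction k) (simp_all add: nat_pow_def mult.commute)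

lemma csubring_power: "csubring A \<Longrightarrow> x \<in> A \<Longrightarrow> x ^ k \<in> A"
  by (induction k) (auto simp: csubringD)

lemma mon_subring_record:
  assumes A: "csubring A" and G: "\<And>i. i \<in> keys m \<Longrightarrow> G i \<in> A"
  shows "finprod (subring_record A) (\<lambda>i. G i [^]\<^bsub>subring_record A\<^esub> lookup m i) (keys m) = mon G m"
  unfolding pow_subring_record mon_def
  by (rule finprod_subring_record[OF A]) (auto intro: csubring_power[OF A] G)

lemma poly_eval_subring_record:
  assumes A: "csubring A" and p: "p \<in> mpolys n" and h: "\<And>m. h (lookup p m) \<in> A"
    and G: "\<And>i. i < n \<Longrightarrow> G i \<in> A"
  shows "poly_eval (subring_record S) h (subring_record A) G (lookup p) = ev h G p"
proof -
  have mon: "mon G m \<in> A" if "m \<in> keys p" for m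
    using that by (intro mon_closed) (auto simp: csubringD[OF A] dest: mpolysD[OF p] intro!: G)
  have mon': "finprod (subring_record A) (\<lambda>i. G i [^]\<^bsub>subring_record A\<^esub> lookup m i) (keys m) = mon G m"
    if "m \<in> keys p" for m
    using that by (intro mon_subring_record[OF A] G) (auto dest: mpolysD[OF p])
  interpret cring "subring_record A" by (rule cring_subring_record[OF A])
  have "{m. lookup p m \<noteq> 0} = keys p" by (auto simp: in_keys_iff)
  then have "poly_eval (subring_record S) h (subring_record A) G (lookup p) =
      finsum (subring_record A) (\<lambda>m. h (lookup p m) * mon G m) (keys p)"
    unfolding poly_eval_def
    by (intro finsum_cong') (auto simp: mon' mon h csubringD[OF A])
  also have "\<dots> = ev h G p"
    unfolding ev_def by (rule finsum_subring_record[OF A]) (auto simp: mon h csubringD[OF A])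
  finally show ?thesis .
qed

lemma poly_coeffs_subring_record:
  assumes "0 \<in> S"
  shows "poly_coeffs (subring_record S) n = lookup ` {p \<in> mpolys n. \<forall>m. lookup p m \<in> S}"
proof (intro equalityI subsetI)
  fix c assume c: "c \<in> poly_coeffs (subring_record S) n"
  then have fin: "finite {m. c m \<noteq> 0}" by (simp add: poly_coeffs_def)
  have "lookup (Abs_poly_mapping c) = c" using fin by (rule lookup_Abs_poly_mapping)
  then obtain p where p: "c = lookup p" by metis
  have "p \<in> mpolys n" using c by (intro mpolysI) (auto simp: poly_coeffs_def p)
  moreover have "\<forall>m. lookup p m \<in> S" using c by (simp add: poly_coeffs_def p)
  ultimately show "c \<in> lookup ` {p \<in> mpolys n. \<forall>m. lookup p m \<in> S}"
    unfolding p by blast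
next
  fix c assume "c \<in> lookup ` {p \<in> mpolys n. \<forall>m. lookup p m \<in> S}"
  then show "c \<in> poly_coeffs (subring_record S) n"
    by (auto simp: poly_coeffs_def mpolys_def in_keys_iff)
qed

text \<open>Coefficient families of finite support are exactly the functions
  \<open>lookup p\<close>; bijectivity of \<open>poly_eval\<close> thereby becomes a statement about
  \<open>ev\<close>.\<close>

lemma poly_eval_subring_record_transfer:
  assumes A: "csubring A" and S: "0 \<in> S" and h: "\<And>s. s \<in> S \<Longrightarrow> h s \<in> A" and G: "\<And>i. i < n \<Longrightarrow> G i \<in> A"
  shows "inj_on (poly_eval (subring_record S) h (subring_record A) G) (poly_coeffs (subring_record S) n) \<longleftrightarrow>
      inj_on (ev h G) {p \<in> mpolys n. \<forall>m. lookup p m \<in> S}" (is ?inj)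
    and "poly_eval (subring_record S) h (subring_record A) G ` poly_coeffs (subring_record S) n =
      ev h G ` {p \<in> mpolys n. \<forall>m. lookup p m \<in> S}" (is ?image)
proof -
  let ?P = "{p \<in> mpolys n. \<forall>m. lookup p m \<in> S}"
  let ?e = "poly_eval (subring_record S) h (subring_record A) G"
  have eq: "(?e \<circ> lookup) p = ev h G p" if "p \<in> ?P" for p
    using that by (auto intro!: poly_eval_subring_record[OF A] h G)
  have inj: "inj_on (?e \<circ> lookup) ?P = inj_on (ev h G) ?P"
    by (rule inj_on_cong) (rule eq)
  have "inj_on lookup ?P" by (auto simp: inj_on_def intro: poly_mapping_eqI)
  from comp_inj_on_iff[OF this, of ?e] show ?inj
    unfolding poly_coeffs_subring_record[OF S] by (simp only: inj)
  show ?image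
    unfolding poly_coeffs_subring_record[OF S] image_comp by (rule image_cong[OF refl eq])
qed

lemma poly_eval_in_subring:
  assumes C: "cring C" and W: "subring W C" and c: "c \<in> poly_coeffs S n"
    and h: "\<And>s. s \<in> carrier S \<Longrightarrow> h s \<in> W" and G: "\<And>i. i < n \<Longrightarrow> G i \<in> W"
  shows "poly_eval S h C G c \<in> W"
proof -
  interpret C: cring C by (rule C)
  note W' = subringE[OF W]
  have pow: "x [^]\<^bsub>C\<^esub> k \<in> W" if "x \<in> W" for x and k :: nat
    using that by (induction k) (simp_all add: W'(3,6))
  have prod: "finprod C f I \<in> W \<and> finprod C f I \<in> carrier C" if "finite I" "\<And>i. i \<in> I \<Longrightarrow> f i \<in> W" for f and I :: "nat set"
    using that
  proof (induction I)
    case (insert x I)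
    then have "finprod C f (insert x I) = f x \<otimes>\<^bsub>C\<^esub> finprod C f I"
      using W'(1) by (intro C.finprod_insert) auto
    then show ?case using insert W'(1,6) by auto
  qed (simp_all add: W'(3))
  have sum: "finsum C f I \<in> W \<and> finsum C f I \<in> carrier C" if "finite I" "\<And>i. i \<in> I \<Longrightarrow> f i \<in> W" for f and I :: "(nat \<Rightarrow>\<^sub>0 nat) set"
    using that
  proof (induction I)
    case (insert x I)
    then have "finsum C f (insert x I) = f x \<oplus>\<^bsub>C\<^esub> finsum C f I"
      using W'(1) by (intro C.finsum_insert) auto
    then show ?case using insert W'(1,7) by auto
  qed (simp_all add: W'(2))
  have summand: "h (c m) \<otimes>\<^bsub>C\<^esub> finprod C (\<lambda>i. G i [^]\<^bsub>C\<^esub> lookup m i) (keys m) \<in> W"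
    if "m \<in> {m. c m \<noteq> \<zero>\<^bsub>S\<^esub>}" for m
  proof (rule W'(6))
    show "h (c m) \<in> W" using c by (intro h) (simp add: poly_coeffs_def)
    have "keys m \<subseteq> {..<n}" using c that by (auto simp: poly_coeffs_def)
    then show "finprod C (\<lambda>i. G i [^]\<^bsub>C\<^esub> lookup m i) (keys m) \<in> W"
      by (intro conjunct1[OF prod] pow G) auto
  qed
  have "finite {m. c m \<noteq> \<zero>\<^bsub>S\<^esub>}" using c by (simp add: poly_coeffs_def)
  from conjunct1[OF sum[OF this summand]] show ?thesis unfolding poly_eval_def .
qed

lemma genideal_image:
  fixes M :: nat
  assumes B: "csubring B" and s: "\<And>k. k < M \<Longrightarrow> s k \<in> B"
  shows "genideal (subring_record B) (s ` {..<M}) = {\<Sum>k<M. a k * s k | a. \<forall>k. a k \<in> B}" (is "_ = ?X")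
proof -
  interpret cring "subring_record B" by (rule cring_subring_record[OF B])
  note Bc = csubringD[OF B]
  have sum: "(\<Sum>k\<in>K. f k) \<in> B" if "\<And>k. k \<in> K \<Longrightarrow> f k \<in> B" for f and K :: "nat set"
    using that by (induction K rule: infinite_finite_induct) (simp_all add: Bc)
  have gens: "s ` {..<M} \<subseteq> carrier (subring_record B)" using s by auto
  have X: "(\<Sum>k<M. a k * s k) \<in> ?X" if "\<And>k. a k \<in> B" for a using that by blast
  have "ideal ?X (subring_record B)"
  proof (rule idealI[OF ring_axioms])
    show "subgroup ?X (add_monoid (subring_record B))"
    proof (rule group.subgroupI[OF a_group])
      have "(\<Sum>k<M. a k * s k) \<in> B" if "\<And>k. a k \<in> B" for a
        by (rule sum) (simp add: that s Bc)
      then show "?X \<subseteq> carrier (add_monoid (subring_record B))" by auto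
      show "?X \<noteq> {}" using X[of "\<lambda>_. 0"] Bc by blast
    next
      fix x assume x: "x \<in> ?X"
      then obtain a where a: "\<And>k. a k \<in> B" "x = (\<Sum>k<M. a k * s k)" by blast
      have "x \<in> B" unfolding a(2) by (intro sum Bc a s) auto
      then have "inv\<^bsub>add_monoid (subring_record B)\<^esub> x = - x"
        using subring_record_a_inv[OF B] by (simp add: a_inv_def)
      also have "\<dots> = (\<Sum>k<M. - a k * s k)" by (simp add: a(2) sum_negf)
      also have "\<dots> \<in> ?X" by (rule X) (simp add: a(1) Bc)
      finally show "inv\<^bsub>add_monoid (subring_record B)\<^esub> x \<in> ?X" .
    next
      fix x y assume "x \<in> ?X" "y \<in> ?X"
      then obtain a b where a: "\<And>k. a k \<in> B" "x = (\<Sum>k<M. a k * s k)" and b: "\<And>k. b k \<in> B" "y = (\<Sum>k<M. b k * s k)"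
        by blast
      have "x + y = (\<Sum>k<M. (a k + b k) * s k)" by (simp add: a(2) b(2) distrib_right sum.distrib)
      also have "\<dots> \<in> ?X" by (rule X) (simp add: a(1) b(1) Bc)
      finally show "x \<otimes>\<^bsub>add_monoid (subring_record B)\<^esub> y \<in> ?X" by simp
    qed
    fix x z assume "x \<in> ?X" "z \<in> carrier (subring_record B)"
    then obtain a where a: "\<And>k. a k \<in> B" "x = (\<Sum>k<M. a k * s k)" and z: "z \<in> B" by auto
    have "z * x = (\<Sum>k<M. (z * a k) * s k)" by (simp add: a(2) sum_distrib_left mult.assoc)
    also have "\<dots> \<in> ?X" by (rule X) (simp add: a(1) z Bc)
    finally have "z * x \<in> ?X" .
    then show "z \<otimes>\<^bsub>subring_record B\<^esub> x \<in> ?X" "x \<otimes>\<^bsub>subring_record B\<^esub> z \<in> ?X"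
      by (simp_all add: mult.commute)
  qed
  moreover have "s ` {..<M} \<subseteq> ?X"
  proof
    fix x assume "x \<in> s ` {..<M}"
    then obtain i where i: "i < M" "x = s i" by blast
    have "(\<Sum>k<M. (if k = i then 1 else 0) * s k) = (\<Sum>k<M. if k = i then s k else 0)"
      by (rule sum.cong) auto
    then have "x = (\<Sum>k<M. (if k = i then 1 else 0) * s k)" using i by simp
    also have "\<dots> \<in> ?X" by (rule X) (simp add: Bc)
    finally show "x \<in> ?X" .
  qed
  ultimately have "genideal (subring_record B) (s ` {..<M}) \<subseteq> ?X" by (rule genideal_minimal)
  moreover have "?X \<subseteq> genideal (subring_record B) (s ` {..<M})"
  proof
    interpret G: ideal "genideal (subring_record B) (s ` {..<M})" "subring_record B"
      by (rule genideal_ideal[OF gens])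
    fix x assume "x \<in> ?X"
    then obtain a where a: "\<And>k. a k \<in> B" "x = (\<Sum>k<M. a k * s k)" by blast
    have "(\<Sum>k\<in>K. a k * s k) \<in> genideal (subring_record B) (s ` {..<M})" if "finite K" "K \<subseteq> {..<M}" for K
      using that
    proof (induction K)
      case empty
      then show ?case using G.zero_closed by simp
    next
      case (insert k K)
      have "s k \<in> genideal (subring_record B) (s ` {..<M})" using genideal_self[OF gens] insert by blast
      then have "a k * s k \<in> genideal (subring_record B) (s ` {..<M})"
        using G.I_l_closed[of "s k" "a k"] a(1) by simp
      then show ?case using insert G.a_closed[of "a k * s k" "\<Sum>k\<in>K. a k * s k"] by simp
    qed
    then show "x \<in> genideal (subring_record B) (s ` {..<M})" by (simp add: a(2))
  qed
  ultimately show ?thesis by blast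
qed

lemma genideal_eq_carrier_iff:
  assumes B: "csubring B" and X: "X \<subseteq> B"
  shows "genideal (subring_record B) X = B \<longleftrightarrow> 1 \<in> genideal (subring_record B) X"
proof -
  interpret cring "subring_record B" by (rule cring_subring_record[OF B])
  have "ideal (genideal (subring_record B) X) (subring_record B)" using X by (intro genideal_ideal) simp
  from ideal.one_imp_carrier[OF this] show ?thesis using csubringD[OF B] by auto
qed

lemma csubring_mpolys: "csubring (mpolys N)"
  by (auto simp: csubring_def mpolys_closed)

lemma mpol_ring_eq: "mpol_ring N = subring_record (mpolys N)"
  by (simp add: mpol_ring_def mpolys_def)

lemma genideal_image_eq_carrier_iff:
  fixes M :: nat
  assumes B: "csubring B" and s: "\<And>k. k < M \<Longrightarrow> s k \<in> B"
  shows "genideal (subring_record B) (s ` {..<M}) = B \<longleftrightarrow> (\<exists>a. (\<forall>k. a k \<in> B) \<and> (\<Sum>k<M. a k * s k) = 1)"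
proof -
  have "s ` {..<M} \<subseteq> B" using s by auto
  note carrier_iff = genideal_eq_carrier_iff[OF B this]
  have "genideal (subring_record B) (s ` {..<M}) = {\<Sum>k<M. a k * s k | a. \<forall>k. a k \<in> B}"
    using B s by (rule genideal_image)
  then show ?thesis
    unfolding carrier_iff by (simp only: mem_Collect_eq)
 (intro iff_exI; rule iffI; elim conjE; simp)
qed

section \<open>Fibres\<close>

context stably_polynomial
begin

lemma csubring_A: "csubring A"
  using A_1 A_uminus A_add A_mult by (auto simp: csubring_def)

lemma const_ring_hom: "mpol_const \<in> Ring.ring_hom class_ring (subring_record A)"
  by (rule ring_hom_memI) (auto simp: A_const mpol_const.hom_mult mpol_const.hom_add)

lemma tensor_product_A:
  "cring L \<Longrightarrow> g \<in> Ring.ring_hom class_ring L \<Longrightarrow>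
    tensor_product (class_ring :: 'r ring) mpol_const (subring_record A) g L"
  by (intro tensor_product.intro tensor_product_axioms.intro cring_subring_record csubring_A const_ring_hom)

text \<open>The coefficient functionals \<open>a \<otimes> l \<mapsto> g(a\<^sub>m) l\<close> detect polynomials with coefficients outside \<open>P\<close>.\<close>

lemma generates_modI:
  fixes L :: "'l ring"
  assumes P: "cprime P" and L: "fractions_mod P g L"
    and Y: "Y \<in> carrier (tensor class_ring mpol_const (subring_record A) g L)"
    and gen: "\<And>W. subring W (tensor class_ring mpol_const (subring_record A) g L) \<Longrightarrow>
      (\<And>q l. q \<in> mpolys 1 \<Longrightarrow> l \<in> carrier L \<Longrightarrow>
        pure_tensor class_ring mpol_const (subring_record A) g L (evF q) l \<in> W) \<Longrightarrow>
      Y \<in> W \<Longrightarrow> carrier (tensor class_ring mpol_const (subring_record A) g L) \<subseteq> W"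
  shows "\<exists>G. generates_mod P G"
proof -
  have L_cring: "cring L" and g: "g \<in> Ring.ring_hom class_ring L"
    and frac: "\<And>l. l \<in> carrier L \<Longrightarrow> \<exists>r s. s \<notin> P \<and> g s \<otimes>\<^bsub>L\<^esub> l = g r"
    and ker: "\<And>r. g r = \<zero>\<^bsub>L\<^esub> \<Longrightarrow> r \<in> P"
    using L by (auto simp: fractions_mod_def)
  interpret tensor_product "class_ring :: 'r ring" mpol_const "subring_record A" g L
    by (rule tensor_product_A[OF L_cring g])
  have g_closed': "g r \<in> carrier L" for r using g_closed[of r] by simp
  have const_pure: "pure (mpol_const s) \<one>\<^bsub>L\<^esub> \<otimes>\<^bsub>AL\<^esub> pure b l = pure (mpol_const s * b) l"
    if "b \<in> A" "l \<in> carrier L" for s b l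
    using that pure_mult[of "mpol_const s" "\<one>\<^bsub>L\<^esub>" b l] by (simp add: A_const)
  have move: "pure (mpol_const r * b) l = pure b (g r \<otimes>\<^bsub>L\<^esub> l)" if "b \<in> A" "l \<in> carrier L" for r b l
    using that pure_balanced[of r b l] by simp
  have clear_pure: "\<exists>r s. s \<notin> P \<and> pure (mpol_const s) \<one>\<^bsub>L\<^esub> \<otimes>\<^bsub>AL\<^esub> pure b l = pure (mpol_const r * b) \<one>\<^bsub>L\<^esub>"
    if bl: "b \<in> A" "l \<in> carrier L" for b l
  proof -
    obtain r s where "s \<notin> P" "g s \<otimes>\<^bsub>L\<^esub> l = g r" using frac[OF bl(2)] by blast
    then show ?thesis
      using bl by (intro exI[of _ r] exI[of _ s]) (simp add: const_pure move g_closed')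
  qed
  have cp: "pure (mpol_const s) \<one>\<^bsub>L\<^esub> \<in> carrier AL" for s by (simp add: pure_closed A_const)
  \<comment> \<open>Multiplication by a constant outside \<open>P\<close> turns \<open>t\<close>
    into the image of an element of \<open>Z\<close>. This is used with A as \<open>Z\<close> and
    with the subalgebra generated by F and \<open>G0\<close>.\<close>
  define cleared where "cleared Z t \<longleftrightarrow> t \<in> carrier AL \<and>
      (\<exists>s\<in>-P. \<exists>b\<in>Z. pure (mpol_const s) \<one>\<^bsub>L\<^esub> \<otimes>\<^bsub>AL\<^esub> t = pure b \<one>\<^bsub>L\<^esub>)" for Z t
  have cleared_add: "cleared Z (t \<oplus>\<^bsub>AL\<^esub> t')"
    if Z: "Z \<subseteq> A" "\<And>x y r. x \<in> Z \<Longrightarrow> y \<in> Z \<Longrightarrow> x + y \<in> Z" "\<And>x r. x \<in> Z \<Longrightarrow> mpol_const r * x \<in> Z"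
      and t: "cleared Z t" "cleared Z t'" for Z t t'
  proof -
    obtain s b s' b' where *: "t \<in> carrier AL" "s \<notin> P" "b \<in> Z" "pure (mpol_const s) \<one>\<^bsub>L\<^esub> \<otimes>\<^bsub>AL\<^esub> t = pure b \<one>\<^bsub>L\<^esub>"
      "t' \<in> carrier AL" "s' \<notin> P" "b' \<in> Z" "pure (mpol_const s') \<one>\<^bsub>L\<^esub> \<otimes>\<^bsub>AL\<^esub> t' = pure b' \<one>\<^bsub>L\<^esub>"
      using t by (auto simp: cleared_def)
    have bA: "b \<in> A" "b' \<in> A" using * Z(1) by auto
    have ss: "pure (mpol_const (s * s')) \<one>\<^bsub>L\<^esub> = pure (mpol_const s) \<one>\<^bsub>L\<^esub> \<otimes>\<^bsub>AL\<^esub> pure (mpol_const s') \<one>\<^bsub>L\<^esub>"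
      using const_pure[of "mpol_const s'" "\<one>\<^bsub>L\<^esub>" s] by (simp add: A_const mpol_const.hom_mult)
    have "pure (mpol_const (s * s')) \<one>\<^bsub>L\<^esub> \<otimes>\<^bsub>AL\<^esub> (t \<oplus>\<^bsub>AL\<^esub> t') =
        pure (mpol_const s') \<one>\<^bsub>L\<^esub> \<otimes>\<^bsub>AL\<^esub> (pure (mpol_const s) \<one>\<^bsub>L\<^esub> \<otimes>\<^bsub>AL\<^esub> t) \<oplus>\<^bsub>AL\<^esub>
        pure (mpol_const s) \<one>\<^bsub>L\<^esub> \<otimes>\<^bsub>AL\<^esub> (pure (mpol_const s') \<one>\<^bsub>L\<^esub> \<otimes>\<^bsub>AL\<^esub> t')"
      unfolding ss using *(1,5) cp by (simp add: AL.l_distr AL.r_distr AL.m_ac)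
    also have "\<dots> = pure (mpol_const s' * b + mpol_const s * b') \<one>\<^bsub>L\<^esub>"
      unfolding *(4,8) using bA pure_add_left[of "mpol_const s' * b" "mpol_const s * b'" "\<one>\<^bsub>L\<^esub>"]
      by (simp add: const_pure A_mult A_const)
    finally have "pure (mpol_const (s * s')) \<one>\<^bsub>L\<^esub> \<otimes>\<^bsub>AL\<^esub> (t \<oplus>\<^bsub>AL\<^esub> t') =
        pure (mpol_const s' * b + mpol_const s * b') \<one>\<^bsub>L\<^esub>" .
    moreover have "s * s' \<in> - P" using *(2,6) cprime_mult[OF P] by auto
    ultimately show ?thesis using *(1,3,5,7) Z unfolding cleared_def by blast
  qed
  have "cleared A X" if "X \<in> carrier AL" for X
    using that
  proof (induction X rule: tensor_induct)
    case (pure b l)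
    then show ?case
      using clear_pure[of b l] pure_closed[of b l] A_mult[OF A_const]
      by (auto simp: cleared_def)
  next
    case (add X Y)
    then show ?case by (intro cleared_add) (auto simp: A_add A_mult A_const)
  qed
  \<comment> \<open>\<open>G0\<close> is the given generator \<open>Y\<close> with its denominators
    cleared.\<close>
  from this[OF Y] obtain s0 G0 where G0: "s0 \<notin> P" "G0 \<in> A" "pure (mpol_const s0) \<one>\<^bsub>L\<^esub> \<otimes>\<^bsub>AL\<^esub> Y = pure G0 \<one>\<^bsub>L\<^esub>"
    by (auto simp: cleared_def)
  define Z where "Z = evFG G0 ` mpolys 2"
  have ZI: "evFG G0 q \<in> Z" if "q \<in> mpolys 2" for q using that by (simp add: Z_def)
  have Z_A: "Z \<subseteq> A" using G0(2) by (auto simp: Z_def evFG_A)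
  have Z_add: "x + y \<in> Z" and Z_mult: "x * y \<in> Z" if xy: "x \<in> Z" "y \<in> Z" for x y
  proof -
    obtain p q where "p \<in> mpolys 2" "x = evFG G0 p" "q \<in> mpolys 2" "y = evFG G0 q" using xy by (auto simp: Z_def)
    then show "x + y \<in> Z" "x * y \<in> Z"
      using ZI[OF mpolys_add, of p q] ZI[OF mpolys_mult, of p q] by (simp_all add: mpol_const.ev_add mpol_const.ev_mult)
  qed
  have Z_const: "mpol_const r \<in> Z" for r
    using ZI[OF mpolys_const, of r] by (simp add: mpol_const.ev_const)
  have Z_G0: "G0 \<in> Z" using ZI[OF mpolys_mvar, of 1] by (simp add: mpol_const.ev_mvar)
  have Z_evF: "evF q \<in> Z" if "q \<in> mpolys 1" for q
  proof -
    have "q \<in> mpolys 2" using that mpolys_mono[of 1 2] by auto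
    from ZI[OF this] show ?thesis by (simp only: evFG_evF[OF that])
  qed
  \<comment> \<open>The elements that become polynomials in F and \<open>G0\<close> after clearing
    denominators form a subring containing the images of R[F] and L and the element
    \<open>Y\<close>, so by \<open>gen\<close> they are the whole tensor product.\<close>
  define W where "W = {t. cleared Z t}"
  have pure_W: "pure b l \<in> W" if "b \<in> Z" "l \<in> carrier L" for b l
  proof -
    have "b \<in> A" using that Z_A by blast
    then show ?thesis
      using clear_pure[of b l] that pure_closed[of b l] Z_mult[OF Z_const that(1)]
      by (auto simp: W_def cleared_def)
  qed
  have W_mult: "t \<otimes>\<^bsub>AL\<^esub> t' \<in> W" if tt: "t \<in> W" "t' \<in> W" for t t'
  proof -
    obtain s b s' b' where *: "t \<in> carrier AL" "s \<notin> P" "b \<in> Z" "pure (mpol_const s) \<one>\<^bsub>L\<^esub> \<otimes>\<^bsub>AL\<^esub> t = pure b \<one>\<^bsub>L\<^esub>"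
      "t' \<in> carrier AL" "s' \<notin> P" "b' \<in> Z" "pure (mpol_const s') \<one>\<^bsub>L\<^esub> \<otimes>\<^bsub>AL\<^esub> t' = pure b' \<one>\<^bsub>L\<^esub>"
      using tt by (auto simp: cleared_def W_def)
    have ss: "pure (mpol_const (s * s')) \<one>\<^bsub>L\<^esub> = pure (mpol_const s) \<one>\<^bsub>L\<^esub> \<otimes>\<^bsub>AL\<^esub> pure (mpol_const s') \<one>\<^bsub>L\<^esub>"
      using const_pure[of "mpol_const s'" "\<one>\<^bsub>L\<^esub>" s] by (simp add: A_const mpol_const.hom_mult)
    have "pure (mpol_const (s * s')) \<one>\<^bsub>L\<^esub> \<otimes>\<^bsub>AL\<^esub> (t \<otimes>\<^bsub>AL\<^esub> t') =
        (pure (mpol_const s) \<one>\<^bsub>L\<^esub> \<otimes>\<^bsub>AL\<^esub> t) \<otimes>\<^bsub>AL\<^esub> (pure (mpol_const s') \<one>\<^bsub>L\<^esub> \<otimes>\<^bsub>AL\<^esub> t')"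
      unfolding ss using *(1,5) cp by (simp add: AL.m_ac)
    also have "\<dots> = pure (b * b') \<one>\<^bsub>L\<^esub>"
      unfolding *(4,8) using pure_mult[of b "\<one>\<^bsub>L\<^esub>" b' "\<one>\<^bsub>L\<^esub>"] *(3,7) Z_A by auto
    finally have "pure (mpol_const (s * s')) \<one>\<^bsub>L\<^esub> \<otimes>\<^bsub>AL\<^esub> (t \<otimes>\<^bsub>AL\<^esub> t') = pure (b * b') \<one>\<^bsub>L\<^esub>" .
    moreover have "s * s' \<in> - P" using *(2,6) cprime_mult[OF P] by auto
    ultimately show ?thesis using *(1,3,5,7) Z_mult unfolding W_def cleared_def by blast
  qed
  have "subring W AL"
  proof (rule AL.subringI)
    show "W \<subseteq> carrier AL" by (auto simp: W_def cleared_def)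
    show one: "\<one>\<^bsub>AL\<^esub> \<in> W" using pure_W[of 1 "\<one>\<^bsub>L\<^esub>"] Z_const[of 1] by (simp add: pure_one)
    show "t \<otimes>\<^bsub>AL\<^esub> t' \<in> W" if "t \<in> W" "t' \<in> W" for t t' using that by (rule W_mult)
    show "t \<oplus>\<^bsub>AL\<^esub> t' \<in> W" if "t \<in> W" "t' \<in> W" for t t'
      using that unfolding W_def mem_Collect_eq
      by (intro cleared_add) (auto simp: Z_A Z_add intro: Z_mult Z_const)
    show "\<ominus>\<^bsub>AL\<^esub> t \<in> W" if "t \<in> W" for t
    proof -
      have t: "t \<in> carrier AL" using that by (simp add: W_def cleared_def)
      have "pure (- 1) \<one>\<^bsub>L\<^esub> = \<ominus>\<^bsub>AL\<^esub> \<one>\<^bsub>AL\<^esub>"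
        using pure_uminus[of 1 "\<one>\<^bsub>L\<^esub>"] by (simp add: subring_record_a_inv[OF csubring_A A_1] A_1 pure_one)
      then have "\<ominus>\<^bsub>AL\<^esub> t = pure (- 1) \<one>\<^bsub>L\<^esub> \<otimes>\<^bsub>AL\<^esub> t" using t by (simp add: AL.l_minus)
      moreover have "pure (- 1) \<one>\<^bsub>L\<^esub> \<in> W"
        using pure_W[of "- 1" "\<one>\<^bsub>L\<^esub>"] Z_const[of "- 1"] by (simp add: mpol_const.hom_uminus)
      ultimately show ?thesis using W_mult that by simp
    qed
  qed
  moreover have "pure (evF q) l \<in> W" if "q \<in> mpolys 1" "l \<in> carrier L" for q l
    using that by (intro pure_W Z_evF)
  moreover have "Y \<in> W" using Y G0 Z_G0 by (auto simp: W_def cleared_def)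
  ultimately have W: "carrier AL \<subseteq> W" by (rule gen)
  have "\<exists>c q. c \<notin> P \<and> q \<in> mpolys 2 \<and> mpol_const c * y - evFG G0 q \<in> coeffs_in P" if y: "y \<in> A" for y
  proof -
    have "pure y \<one>\<^bsub>L\<^esub> \<in> W" using W y by (auto intro!: pure_closed)
    then obtain c q where cq: "c \<notin> P" "q \<in> mpolys 2"
      "pure (mpol_const c) \<one>\<^bsub>L\<^esub> \<otimes>\<^bsub>AL\<^esub> pure y \<one>\<^bsub>L\<^esub> = pure (evFG G0 q) \<one>\<^bsub>L\<^esub>"
      by (auto simp: W_def cleared_def Z_def)
    have eq: "pure (mpol_const c * y) \<one>\<^bsub>L\<^esub> = pure (evFG G0 q) \<one>\<^bsub>L\<^esub>"
      using cq(3) const_pure[OF y C.one_closed] by simp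
    have qA: "evFG G0 q \<in> A" using G0(2) cq(2) by (rule evFG_A)
    have "lookup (mpol_const c * y - evFG G0 q) m \<in> P" for m
    proof -
      have "abelian_group L" using C.is_abelian_group .
      then obtain \<phi> where \<phi>: "\<And>b l. b \<in> A \<Longrightarrow> l \<in> carrier L \<Longrightarrow> \<phi> (pure b l) = g (lookup b m) \<otimes>\<^bsub>L\<^esub> l"
        using additive_functional[of L "\<lambda>b l. g (lookup b m) \<otimes>\<^bsub>L\<^esub> l"]
          ring_hom_add[OF g] ring_hom_mult[OF g] g_closed'
        by (simp add: C.l_distr C.r_distr lookup_add lookup_const_mult C.m_ac) metis
      have "g (lookup (mpol_const c * y) m) = g (lookup (evFG G0 q) m)"
        using \<phi>[of "mpol_const c * y" "\<one>\<^bsub>L\<^esub>"] \<phi>[OF qA C.one_closed] y g_closed' eq by (simp add: A_mult A_const)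
      moreover have "g (x - z) = \<zero>\<^bsub>L\<^esub>" if "g x = g z" for x z
        using ring_hom_add[OF g, of "x - z" z] that g_closed'[of x] g_closed'[of "x - z"]
        by (simp add: C.add.r_cancel_one')
      ultimately show ?thesis by (intro ker) (simp add: lookup_minus)
    qed
    then show ?thesis using cq by (auto simp: coeffs_in_def)
  qed
  then show ?thesis using G0(2) by (auto simp: generates_mod_def)
qed

lemma evF_1: "evF 1 = 1"
  using mpol_const.ev_const[of "\<lambda>_. F" 1] by simp

definition RF :: "'r mpol set" where "RF = evF ` mpolys 1"

lemma csubring_RF: "csubring RF"
proof -
  have RFI: "evF q \<in> RF" if "q \<in> mpolys 1" for q using that by (simp add: RF_def)
  have "1 \<in> RF" using RFI[OF mpolys_1] by (simp add: evF_1)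
  moreover have "- x \<in> RF" "x + y \<in> RF" "x * y \<in> RF" if xy: "x \<in> RF" "y \<in> RF" for x y
  proof -
    obtain p q where pq: "p \<in> mpolys 1" "x = evF p" "q \<in> mpolys 1" "y = evF q" using xy by (auto simp: RF_def)
    have "evF (mpol_const (- 1) * p) = mpol_const (- 1) * x"
      by (simp only: mpol_const.ev_mult mpol_const.ev_const pq)
    also have "\<dots> = - x" by (simp add: mpol_const.hom_uminus)
    finally have "evF (mpol_const (- 1) * p) = - x" .
    then show "- x \<in> RF" using RFI[OF mpolys_mult[OF mpolys_const pq(1)], of "- 1"] by simp
    show "x + y \<in> RF" "x * y \<in> RF"
      using RFI[OF mpolys_add[OF pq(1,3)]] RFI[OF mpolys_mult[OF pq(1,3)]]
      by (simp_all add: mpol_const.ev_add mpol_const.ev_mult pq)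
  qed
  ultimately show ?thesis by (auto simp: csubring_def)
qed

lemma RF_const: "mpol_const r \<in> RF"
  unfolding RF_def by (rule image_eqI[of _ _ "mpol_const r"]) (simp_all add: mpol_const.ev_const mpolys_const)

lemma RF_F: "F \<in> RF"
  unfolding RF_def by (rule image_eqI[of _ _ "mvar 0"]) (simp_all add: mpol_const.ev_mvar mpolys_mvar)

lemma RF_A: "RF \<subseteq> A"
  by (auto simp: RF_def evF_A)

lemma subring_subring_record:
  assumes "csubring S" "S \<subseteq> A"
  shows "subring S (subring_record A)"
proof -
  interpret cring "subring_record A" by (rule cring_subring_record[OF csubring_A])
  show ?thesis
    using assms csubringD[OF assms(1)]
    by (intro subringI) (auto simp: subring_record_a_inv[OF csubring_A])
qed

lemma adjoin_eq: "adjoin (class_ring :: 'r ring) mpol_const (subring_record A) F = subring_record RF"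
proof -
  interpret cring "subring_record A" by (rule cring_subring_record[OF csubring_A])
  let ?H = "insert F (range mpol_const)"
  have H: "?H \<subseteq> carrier (subring_record A)" using F_A A_const by auto
  have "generate_ring (subring_record A) ?H \<subseteq> RF"
    using RF_F RF_const by (intro generate_ring_min_subring1 subring_subring_record csubring_RF RF_A H) auto
  moreover have "evF q \<in> generate_ring (subring_record A) ?H" if "q \<in> mpolys 1" for q
    using that
  proof (induction q rule: mpolys_ring_induct)
    case (const a)
    show ?case using generate_ring.incl[of "mpol_const a" ?H "subring_record A"] by (simp add: mpol_const.ev_const)
  next
    case (var i)
    show ?case using generate_ring.incl[of F ?H "subring_record A"] by (simp add: mpol_const.ev_mvar)
  next
    case (add p q)
    then show ?case using generate_ring.eng_add[of "evF p" "subring_record A" ?H "evF q"]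
      by (simp add: mpol_const.ev_add)
  next
    case (mult p q)
    then show ?case using generate_ring.eng_mult[of "evF p" "subring_record A" ?H "evF q"]
      by (simp add: mpol_const.ev_mult)
  qed
  ultimately have "generate_ring (subring_record A) ?H = RF" by (auto simp: RF_def)
  then show ?thesis by (simp add: adjoin_def)
qed

lemma tensor_subring_RF:
  assumes "cring L" "g \<in> Ring.ring_hom class_ring L"
  shows "tensor_subring (class_ring :: 'r ring) mpol_const (subring_record A) g L RF"
proof (intro tensor_subring.intro tensor_subring_axioms.intro tensor_product_A assms)
  show "subring RF (subring_record A)" by (rule subring_subring_record[OF csubring_RF RF_A])
  show "mpol_const ` carrier (class_ring :: 'r ring) \<subseteq> RF" using RF_const by auto
qed

text \<open>A subring containing the images of R[F] and L contains the adjoined coefficient ring;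
  together with the variable \<open>Y 0\<close> it contains every value of a polynomial over that
  ring.\<close>

lemma poly_over_adjoined_generates_mod:
  assumes P: "cprime P" and L: "fractions_mod P g L"
    and F: "poly_over_adjoined class_ring mpol_const (subring_record A) g L F"
  shows "\<exists>G. generates_mod P G"
proof -
  have L_cring: "cring L" and g: "g \<in> Ring.ring_hom class_ring L"
    using L by (auto simp: fractions_mod_def)
  interpret tensor_product "class_ring :: 'r ring" mpol_const "subring_record A" g L
    by (rule tensor_product_A[OF L_cring g])
  let ?H = "insert (pure F \<one>\<^bsub>L\<^esub>) (pure \<one>\<^bsub>subring_record A\<^esub> ` carrier L)"
  let ?S = "generate_ring AL ?H"
  obtain Y where Y: "poly_algebra_in (AL\<lparr>carrier := ?S\<rparr>) id AL 1 Y"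
    using F by (auto simp: poly_over_adjoined_def poly_algebra_def Let_def)
  have Y0: "Y 0 \<in> carrier AL" using Y by (auto simp: poly_algebra_in_def)
  have H: "?H \<subseteq> carrier AL" using F_A A_1 by (auto intro!: pure_closed)
  show ?thesis
  proof (rule generates_modI[OF P L Y0])
    fix W assume W: "subring W AL" "Y 0 \<in> W"
      and pW: "\<And>q l. q \<in> mpolys 1 \<Longrightarrow> l \<in> carrier L \<Longrightarrow> pure (evF q) l \<in> W"
    have "pure F \<one>\<^bsub>L\<^esub> \<in> W" using pW[of "mvar 0" "\<one>\<^bsub>L\<^esub>"] by (simp add: mpol_const.ev_mvar mpolys_mvar)
    moreover have "pure 1 l \<in> W" if "l \<in> carrier L" for l
      using pW[OF mpolys_1 that] by (simp add: evF_1)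
    ultimately have S: "?S \<subseteq> W" by (intro AL.generate_ring_min_subring1[OF H W(1)]) auto
    show "carrier AL \<subseteq> W"
    proof
      fix X assume X: "X \<in> carrier AL"
      have "poly_eval (AL\<lparr>carrier := ?S\<rparr>) id AL Y ` poly_coeffs (AL\<lparr>carrier := ?S\<rparr>) 1 = carrier AL"
        using Y by (simp add: poly_algebra_in_def bij_betw_def)
      then obtain c where c: "c \<in> poly_coeffs (AL\<lparr>carrier := ?S\<rparr>) 1"
        "X = poly_eval (AL\<lparr>carrier := ?S\<rparr>) id AL Y c"
        using X by blast
      show "X \<in> W" unfolding c(2)
        by (rule poly_eval_in_subring[OF AL.cring_axioms W(1) c(1)]) (use S W(2) in auto)
    qed
  qed
qed

text \<open>The coefficient ring is now the fibre of R[F]. It is generated additively by pure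
  tensors, whose images in the fibre of A lie in any subring containing the pure tensors of
  polynomials in F.\<close>

lemma residual_coordinate_generates_mod:
  assumes P: "cprime P" and res: "residual_coordinate class_ring mpol_const (subring_record A) F"
  shows "\<exists>G. generates_mod P G"
proof -
  let ?g = "to_residue_field class_ring P" and ?L = "residue_field class_ring P"
  have L: "fractions_mod P ?g ?L" by (rule fractions_mod_residue_field[OF P])
  then have L_cring: "cring ?L" and g: "?g \<in> Ring.ring_hom class_ring ?L"
    by (auto simp: fractions_mod_def)
  interpret tensor_subring "class_ring :: 'r ring" mpol_const "subring_record A" ?g ?L RF
    rewrites "(subring_record A)\<lparr>carrier := RF\<rparr> = subring_record RF"
  proof -
    show "tensor_subring (class_ring :: 'r ring) mpol_const (subring_record A) ?g ?L RF"
      by (rule tensor_subring_RF[OF L_cring g])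
  qed simp
  have "poly_algebra Sub.AL incl AL 1"
    using res P by (auto simp: residual_coordinate_def adjoin_eq primeideal_class_ring_iff)
  then obtain Y where Y: "poly_algebra_in Sub.AL incl AL 1 Y"
    by (auto simp: poly_algebra_def)
  have Y0: "Y 0 \<in> carrier AL" using Y by (auto simp: poly_algebra_in_def)
  show ?thesis
  proof (rule generates_modI[OF P L Y0])
    fix W assume W: "subring W AL" "Y 0 \<in> W"
      and pW: "\<And>q l. q \<in> mpolys 1 \<Longrightarrow> l \<in> carrier ?L \<Longrightarrow> pure (evF q) l \<in> W"
    have incl_W: "incl t \<in> W" if "t \<in> carrier Sub.AL" for t
      using that
    proof (induction t rule: Sub.tensor_induct)
      case (pure b l)
      then obtain q where "q \<in> mpolys 1" "b = evF q" unfolding RF_def by auto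
      then show ?case using pW[of q l] pure incl_pure[of b l] by simp
    next
      case (add X Y)
      then show ?case using ring_hom_add[OF incl_hom, of X Y] subringE(7)[OF W(1)] by simp
    qed
    show "carrier AL \<subseteq> W"
    proof
      fix X assume X: "X \<in> carrier AL"
      have "poly_eval Sub.AL incl AL Y ` poly_coeffs Sub.AL 1 = carrier AL"
        using Y by (simp add: poly_algebra_in_def bij_betw_def)
      then obtain c where c: "c \<in> poly_coeffs Sub.AL 1" "X = poly_eval Sub.AL incl AL Y c"
        using X by blast
      show "X \<in> W" unfolding c(2)
        by (rule poly_eval_in_subring[OF AL.cring_axioms W(1) c(1)]) (use incl_W W(2) in auto)
    qed
  qed
qed

text \<open>A is free over R[F] with the powers of G as basis, and this survives tensoring: the
  coefficient maps of A extend to functionals on the tensor product that recover the coefficients of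
  a polynomial in \<open>\<Gamma>\<close>.\<close>

lemma base_change:
  fixes L :: "'l ring"
  assumes G: "G \<in> A" "bij_betw (evFG G) (mpolys 2) A"
    and L_cring: "cring L" and g: "g \<in> Ring.ring_hom class_ring L"
  shows "poly_algebra (tensor class_ring mpol_const (subring_record RF) g L)
    (tensor_incl class_ring mpol_const (subring_record A) g L)
    (tensor class_ring mpol_const (subring_record A) g L) 1"
proof -
  interpret tensor_subring "class_ring :: 'r ring" mpol_const "subring_record A" g L RF
    rewrites "(subring_record A)\<lparr>carrier := RF\<rparr> = subring_record RF"
  proof -
    show "tensor_subring (class_ring :: 'r ring) mpol_const (subring_record A) g L RF"
      by (rule tensor_subring_RF[OF L_cring g])
  qed simp
  note RFc = csubringD[OF csubring_RF]
  define \<Gamma> where "\<Gamma> = pure G \<one>\<^bsub>L\<^esub>"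
  have \<Gamma>_closed: "\<Gamma> \<in> carrier AL" using G by (simp add: \<Gamma>_def pure_closed)
  have \<Gamma>_pow: "\<Gamma> [^]\<^bsub>AL\<^esub> k = pure (G ^ k) \<one>\<^bsub>L\<^esub>" for k :: nat
  proof (induction k)
    case 0
    then show ?case by (simp add: pure_one)
  next
    case (Suc k)
    then show ?case
      using G pure_mult[of "G ^ k" "\<one>\<^bsub>L\<^esub>" G "\<one>\<^bsub>L\<^esub>"] by (simp add: \<Gamma>_def A_power mult.commute)
  qed
  interpret cc: comm_ring_hom "\<lambda>r :: 'r. mpol_const (mpol_const r)"
    by unfold_locales (simp_all add: mpol_const.hom_add mpol_const.hom_mult)
  \<comment> \<open>\<open>E\<close> regards a polynomial in two variables as one in the second
    variable with coefficients in R[F]: variable 0 becomes the constant F and variable 1 becomes the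
    only variable.\<close>
  define E where "E = ev (\<lambda>r :: 'r. mpol_const (mpol_const r)) (\<lambda>i. if i = 0 then mpol_const F else mvar 0)"
  interpret E: comm_ring_hom E unfolding E_def by (rule cc.ev_hom)
  define cf where "cf j b = lookup (E (inv_into (mpolys 2) (evFG G) b)) (single 0 j)" for j b
  have cf_ev: "cf j (evFG G q) = lookup (E q) (single 0 j)" if "q \<in> mpolys 2" for j q
    using bij_betw_inv_into_left[OF G(2) that] by (simp add: cf_def)
  have A_evFG: "\<exists>q\<in>mpolys 2. b = evFG G q" if "b \<in> A" for b
    using that G(2) by (auto simp: bij_betw_def)
  have cf_add: "cf j (b + b') = cf j b + cf j b'" if bb: "b \<in> A" "b' \<in> A" for j b b'
  proof -
    obtain p q where "p \<in> mpolys 2" "b = evFG G p" "q \<in> mpolys 2" "b' = evFG G q" using A_evFG bb by metis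
    then show ?thesis
      using cf_ev[OF mpolys_add, of p q j] by (simp add: cf_ev mpol_const.ev_add E.hom_add lookup_add)
  qed
  have cf_const: "cf j (mpol_const r * b) = mpol_const r * cf j b" if b: "b \<in> A" for j r b
  proof -
    obtain q where q: "q \<in> mpolys 2" "b = evFG G q" using A_evFG b by metis
    moreover have "E (mpol_const r) = mpol_const (mpol_const r)" by (simp add: E_def cc.ev_const)
    ultimately show ?thesis
      using cf_ev[OF mpolys_mult[OF mpolys_const[of r] q(1)], of j]
      by (simp add: cf_ev mpol_const.ev_mult mpol_const.ev_const E.hom_mult lookup_const_mult)
  qed
  have cf_RF: "cf j b \<in> RF" if b: "b \<in> A" for j b
  proof -
    have sum: "sum f I \<in> RF" if "\<And>i. i \<in> I \<Longrightarrow> f i \<in> RF" for f and I :: "((nat \<Rightarrow>\<^sub>0 nat) \<times> (nat \<Rightarrow>\<^sub>0 nat)) set"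
      using that by (induction I rule: infinite_finite_induct) (simp_all add: RFc)
    obtain q where q: "q \<in> mpolys 2" "b = evFG G q" using A_evFG b by metis
    from q(1) have "\<forall>m. lookup (E q) m \<in> RF"
    proof (induction q rule: mpolys_ring_induct)
      case (const a)
      then show ?case by (simp add: E_def cc.ev_const lookup_const RF_const RFc)
    next
      case (var i)
      then show ?case by (simp add: E_def cc.ev_mvar lookup_const RF_F RFc) (simp add: mvar_def lookup_single when_def RFc)
    next
      case (add p q)
      then show ?case by (simp add: E.hom_add lookup_add RFc)
    next
      case (mult p q)
      then show ?case unfolding E.hom_mult lookup_mult_sum by (auto intro!: sum RFc)
    qed
    then show ?thesis using cf_ev[OF q(1)] q(2) by simp
  qed
  have mvar_pow: "mvar 0 ^ k = single (single 0 k) (1 :: 'r mpol)" for k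
    by (induction k) (simp_all add: mvar_def mult_single single_add[symmetric])
  have cf_RF_G: "cf j (b * G ^ k) = (if j = k then b else 0)" if b: "b \<in> RF" for j k b
  proof -
    obtain q where q: "q \<in> mpolys 1" "b = evF q" using b by (auto simp: RF_def)
    have q2: "q \<in> mpolys 2" using q(1) mpolys_mono[of 1 2] by auto
    have "E q = ev (\<lambda>r. mpol_const (mpol_const r)) (\<lambda>_. mpol_const F) q"
      unfolding E_def using q(1) by (rule ev_cong) simp
    also have "\<dots> = mpol_const (evF q)"
      using hom_ev_const[OF q(1), of "\<lambda>q. mpol_const (evF q)" "\<lambda>r. mpol_const (mpol_const r)"]
      by (simp add: mpol_const.ev_const mpol_const.ev_mvar mpol_const.ev_add mpol_const.ev_mult
          mpol_const.hom_add mpol_const.hom_mult cc.comm_ring_hom_axioms)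
    finally have "E q = mpol_const b" by (simp add: q)
    moreover have "E (mvar 1) = mvar 0" by (simp add: E_def cc.ev_mvar)
    ultimately have "E (q * mvar 1 ^ k) = mpol_const b * mvar 0 ^ k"
      by (simp add: E.hom_mult E.hom_power)
    moreover have "evFG G (q * mvar 1 ^ k) = b * G ^ k"
    proof -
      interpret e: comm_ring_hom "evFG G" by (rule mpol_const.ev_hom)
      show ?thesis by (simp add: e.hom_mult e.hom_power evFG_evF[OF q(1)] q(2) mpol_const.ev_mvar)
    qed
    moreover have "q * mvar 1 ^ k \<in> mpolys 2" using q2 by (intro mpolys_mult mpolys_power mpolys_mvar) auto
    moreover have "single (0::nat) k = single 0 j \<longleftrightarrow> j = k"
      by (metis lookup_single_eq)
    ultimately show ?thesis
      using cf_ev[of "q * mvar 1 ^ k" j]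
      by (auto simp: lookup_const_mult mvar_pow lookup_single when_def)
  qed
  \<comment> \<open>\<open>cf j\<close> is R-linear, so it may be applied to the left factor of a
    tensor.\<close>
  have "\<exists>\<phi>. (\<forall>X\<in>carrier AL. \<phi> X \<in> carrier Sub.AL) \<and>
      (\<forall>X\<in>carrier AL. \<forall>Y\<in>carrier AL. \<phi> (X \<oplus>\<^bsub>AL\<^esub> Y) = \<phi> X \<oplus>\<^bsub>Sub.AL\<^esub> \<phi> Y) \<and>
      (\<forall>b\<in>A. \<forall>l\<in>carrier L. \<phi> (pure b l) = Sub.pure (cf j b) l)" (is "\<exists>\<phi>. ?Q \<phi>") for j
  proof (rule additive_functional[of Sub.AL "\<lambda>b l. Sub.pure (cf j b) l"])
    show "abelian_group Sub.AL" by (rule Sub.AL.is_abelian_group)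
    show "Sub.pure (cf j b) l \<in> carrier Sub.AL" if "b \<in> carrier (subring_record A)" "l \<in> carrier L" for b l
      using that by (simp add: Sub.pure_closed cf_RF)
    show "Sub.pure (cf j (b \<oplus>\<^bsub>subring_record A\<^esub> b')) l = Sub.pure (cf j b) l \<oplus>\<^bsub>Sub.AL\<^esub> Sub.pure (cf j b') l"
      if "b \<in> carrier (subring_record A)" "b' \<in> carrier (subring_record A)" "l \<in> carrier L" for b b' l
      using that Sub.pure_add_left[of "cf j b" "cf j b'" l] by (simp add: cf_add cf_RF)
    show "Sub.pure (cf j b) (l \<oplus>\<^bsub>L\<^esub> l') = Sub.pure (cf j b) l \<oplus>\<^bsub>Sub.AL\<^esub> Sub.pure (cf j b) l'"
      if "b \<in> carrier (subring_record A)" "l \<in> carrier L" "l' \<in> carrier L" for b l l'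
      using that Sub.pure_add_right[of "cf j b" l l'] by (simp add: cf_RF)
    show "Sub.pure (cf j (mpol_const r \<otimes>\<^bsub>subring_record A\<^esub> b)) l = Sub.pure (cf j b) (g r \<otimes>\<^bsub>L\<^esub> l)"
      if "b \<in> carrier (subring_record A)" "l \<in> carrier L" for r b l
      using that Sub.pure_balanced[of r "cf j b" l] by (simp add: cf_const cf_RF)
    show "\<exists>\<phi>. ?Q \<phi>" if "\<And>X. X \<in> carrier AL \<Longrightarrow> \<phi> X \<in> carrier Sub.AL"
      "\<And>X Y. X \<in> carrier AL \<Longrightarrow> Y \<in> carrier AL \<Longrightarrow> \<phi> (X \<oplus>\<^bsub>AL\<^esub> Y) = \<phi> X \<oplus>\<^bsub>Sub.AL\<^esub> \<phi> Y"
      "\<And>b l. b \<in> carrier (subring_record A) \<Longrightarrow> l \<in> carrier L \<Longrightarrow> \<phi> (pure b l) = Sub.pure (cf j b) l" for \<phi>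
      using that by (intro exI[of _ \<phi>] conjI ballI) simp_all
  qed
  then obtain \<Theta> where \<Theta>: "\<And>j X. X \<in> carrier AL \<Longrightarrow> \<Theta> j X \<in> carrier Sub.AL"
    "\<And>j X Y. X \<in> carrier AL \<Longrightarrow> Y \<in> carrier AL \<Longrightarrow> \<Theta> j (X \<oplus>\<^bsub>AL\<^esub> Y) = \<Theta> j X \<oplus>\<^bsub>Sub.AL\<^esub> \<Theta> j Y"
    "\<And>j b l. b \<in> A \<Longrightarrow> l \<in> carrier L \<Longrightarrow> \<Theta> j (pure b l) = Sub.pure (cf j b) l"
    by metis
  have incl_closed: "incl t \<in> carrier AL" if "t \<in> carrier Sub.AL" for t
    using ring_hom_closed[OF incl_hom that] .
  have pow_closed: "\<Gamma> [^]\<^bsub>AL\<^esub> k \<in> carrier AL" for k :: nat using \<Gamma>_closed by simp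
  have \<Theta>_0: "\<Theta> j \<zero>\<^bsub>AL\<^esub> = \<zero>\<^bsub>Sub.AL\<^esub>" for j
  proof -
    have "cf j 0 = 0" using cf_RF_G[OF RFc(2), of j 0] by simp
    then show ?thesis
      using \<Theta>(3)[of 0 "\<one>\<^bsub>L\<^esub>" j] pure_zero[of "\<one>\<^bsub>L\<^esub>"] Sub.pure_zero[of "\<one>\<^bsub>L\<^esub>"] by (simp add: A_0)
  qed
  \<comment> \<open>The functionals are dual to the powers of \<open>\<Gamma>\<close>, with
    coefficients in the smaller tensor product; this yields injectivity of the evaluation.\<close>
  have \<Theta>_term: "\<Theta> j (incl t \<otimes>\<^bsub>AL\<^esub> \<Gamma> [^]\<^bsub>AL\<^esub> k) = (if j = k then t else \<zero>\<^bsub>Sub.AL\<^esub>)" if "t \<in> carrier Sub.AL" for t j k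
    using that
  proof (induction t rule: Sub.tensor_induct)
    case (pure b l)
    then have b: "b \<in> RF" "b \<in> A" "l \<in> carrier L" using RF_A by auto
    have "incl (Sub.pure b l) \<otimes>\<^bsub>AL\<^esub> \<Gamma> [^]\<^bsub>AL\<^esub> k = pure (b * G ^ k) l"
      using b G pure_mult[of b l "G ^ k" "\<one>\<^bsub>L\<^esub>"] by (simp add: incl_pure \<Gamma>_pow A_power)
    then show ?case
      using b G \<Theta>(3)[of "b * G ^ k" l j] Sub.pure_zero[of l] by (simp add: A_mult A_power cf_RF_G)
  next
    case (add X Y)
    have "incl (X \<oplus>\<^bsub>Sub.AL\<^esub> Y) \<otimes>\<^bsub>AL\<^esub> \<Gamma> [^]\<^bsub>AL\<^esub> k =
        incl X \<otimes>\<^bsub>AL\<^esub> \<Gamma> [^]\<^bsub>AL\<^esub> k \<oplus>\<^bsub>AL\<^esub> incl Y \<otimes>\<^bsub>AL\<^esub> \<Gamma> [^]\<^bsub>AL\<^esub> k"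
      using add pow_closed by (simp add: ring_hom_add[OF incl_hom] AL.l_distr incl_closed)
    then show ?case using add pow_closed by (simp add: \<Theta>(2) incl_closed)
  qed
  let ?PE = "poly_eval Sub.AL incl AL (\<lambda>_. \<Gamma>)" and ?pc = "poly_coeffs Sub.AL 1"
  have pcD: "c m \<in> carrier Sub.AL" "finite {m. c m \<noteq> \<zero>\<^bsub>Sub.AL\<^esub>}"
      "c m \<noteq> \<zero>\<^bsub>Sub.AL\<^esub> \<Longrightarrow> keys m \<subseteq> {..<1}" if "c \<in> ?pc" for c m
    using that by (auto simp: poly_coeffs_def)
  have term_closed: "incl (c m) \<otimes>\<^bsub>AL\<^esub> \<Gamma> [^]\<^bsub>AL\<^esub> lookup m 0 \<in> carrier AL" if "c \<in> ?pc" for c m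
    using pcD(1)[OF that] pow_closed incl_closed by simp
  have incl_0: "incl \<zero>\<^bsub>Sub.AL\<^esub> = \<zero>\<^bsub>AL\<^esub>"
    using incl_pure[OF RFc(2), of "\<zero>\<^bsub>L\<^esub>"] pure_zero[of "\<zero>\<^bsub>L\<^esub>"] Sub.pure_zero[of "\<zero>\<^bsub>L\<^esub>"] by simp
  have mon1: "finprod AL (\<lambda>i. \<Gamma> [^]\<^bsub>AL\<^esub> lookup m i) (keys m) = \<Gamma> [^]\<^bsub>AL\<^esub> lookup m 0"
    if m: "keys m \<subseteq> {..<1}" for m :: "nat \<Rightarrow>\<^sub>0 nat"
  proof (cases "0 \<in> keys m")
    case True
    then have "keys m = {0}" using m by auto
    then show ?thesis using pow_closed by simp
  next
    case False
    then have "keys m = {}" using m by (auto simp del: keys_eq_empty)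
    then show ?thesis using False by (simp add: in_keys_iff)
  qed
  have PE: "?PE c = finsum AL (\<lambda>m. incl (c m) \<otimes>\<^bsub>AL\<^esub> \<Gamma> [^]\<^bsub>AL\<^esub> lookup m 0) S"
    if c: "c \<in> ?pc" and S: "finite S" "{m. c m \<noteq> \<zero>\<^bsub>Sub.AL\<^esub>} \<subseteq> S" for c S
    unfolding poly_eval_def using S
  proof (rule AL.add.finprod_mono_neutral_cong_left)
    show "(\<lambda>m. incl (c m) \<otimes>\<^bsub>AL\<^esub> \<Gamma> [^]\<^bsub>AL\<^esub> lookup m 0) \<in> S \<rightarrow> carrier AL"
      using term_closed[OF c] by blast
  qed (auto simp: incl_0 pow_closed mon1[OF pcD(3)[OF c]])
  have PE_closed: "?PE c \<in> carrier AL" if "c \<in> ?pc" for c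
    using PE[OF that pcD(2)[OF that] subset_refl] term_closed[OF that] by (auto intro!: AL.finsum_closed)
  have \<Theta>_sum: "\<Theta> j (finsum AL t S) = finsum Sub.AL (\<lambda>m. \<Theta> j (t m)) S"
    if "finite S" "\<And>m. m \<in> S \<Longrightarrow> t m \<in> carrier AL" for j t and S :: "(nat \<Rightarrow>\<^sub>0 nat) set"
    using that
  proof (induction S)
    case empty
    then show ?case by (simp add: \<Theta>_0)
  next
    case (insert x S)
    then have "finsum AL t (insert x S) = t x \<oplus>\<^bsub>AL\<^esub> finsum AL t S"
      "finsum Sub.AL (\<lambda>m. \<Theta> j (t m)) (insert x S) = \<Theta> j (t x) \<oplus>\<^bsub>Sub.AL\<^esub> finsum Sub.AL (\<lambda>m. \<Theta> j (t m)) S"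
      by (intro AL.finsum_insert Sub.AL.finsum_insert; simp add: \<Theta>(1))+
    moreover have "finsum AL t S \<in> carrier AL" using insert by (intro AL.finsum_closed) auto
    ultimately show ?case using insert by (simp add: \<Theta>(2))
  qed
  have key1: "m' = m \<longleftrightarrow> lookup m' 0 = lookup m 0"
    if "keys m \<subseteq> {..<1}" "keys m' \<subseteq> {..<1}" for m m' :: "nat \<Rightarrow>\<^sub>0 nat"
  proof
    assume *: "lookup m' 0 = lookup m 0"
    show "m' = m"
    proof (rule poly_mapping_eqI)
      fix k show "lookup m' k = lookup m k"
      proof (cases "k = 0")
        case False
        then have "k \<notin> keys m" "k \<notin> keys m'" using that by auto
        then show ?thesis by (simp add: in_keys_iff)
      qed (use * in simp)
    qed
  qed simp
  have coeff: "\<Theta> (lookup m 0) (?PE c) = c m" if c: "c \<in> ?pc" and m: "keys m \<subseteq> {..<1}" for c m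
  proof -
    let ?S = "insert m {m. c m \<noteq> \<zero>\<^bsub>Sub.AL\<^esub>}"
    have fin: "finite ?S" using pcD(2)[OF c] by simp
    have "\<Theta> (lookup m 0) (?PE c) =
        finsum Sub.AL (\<lambda>m'. \<Theta> (lookup m 0) (incl (c m') \<otimes>\<^bsub>AL\<^esub> \<Gamma> [^]\<^bsub>AL\<^esub> lookup m' 0)) ?S"
      unfolding PE[OF c fin subset_insertI] by (rule \<Theta>_sum[OF fin]) (rule term_closed[OF c])
    also have "\<dots> = finsum Sub.AL (\<lambda>m'. if m = m' then c m' else \<zero>\<^bsub>Sub.AL\<^esub>) ?S"
    proof (rule Sub.AL.finsum_cong'[OF refl])
      fix m' assume "m' \<in> ?S"
      then have "keys m' \<subseteq> {..<1}" using m pcD(3)[OF c] by blast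
      then have "m = m' \<longleftrightarrow> lookup m 0 = lookup m' 0"
        using key1[OF m] by metis
      then show "\<Theta> (lookup m 0) (incl (c m') \<otimes>\<^bsub>AL\<^esub> \<Gamma> [^]\<^bsub>AL\<^esub> lookup m' 0) =
          (if m = m' then c m' else \<zero>\<^bsub>Sub.AL\<^esub>)"
        using pcD(1)[OF c, of m'] by (simp add: \<Theta>_term)
    qed (use pcD(1)[OF c] in auto)
    also have "\<dots> = c m" using fin pcD(1)[OF c] by (intro Sub.AL.finsum_singleton) auto
    finally show ?thesis .
  qed
  have inj: "inj_on ?PE ?pc"
  proof (rule inj_onI, rule ext)
    fix c c' m assume *: "c \<in> ?pc" "c' \<in> ?pc" "?PE c = ?PE c'"
    show "c m = c' m"
    proof (cases "keys m \<subseteq> {..<1}")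
      case True
      then show ?thesis using coeff[OF *(1) True] coeff[OF *(2) True] *(3) by simp
    next
      case False
      then show ?thesis using pcD(3)[OF *(1), of m] pcD(3)[OF *(2), of m] by metis
    qed
  qed
  have surj: "\<exists>c\<in>?pc. ?PE c = X" if "X \<in> carrier AL" for X
  proof -
    have sum: "\<exists>c\<in>?pc. ?PE c = X \<oplus>\<^bsub>AL\<^esub> Y" if XY: "\<exists>c\<in>?pc. ?PE c = X" "\<exists>c\<in>?pc. ?PE c = Y" for X Y
    proof -
      obtain c c' where c: "c \<in> ?pc" "?PE c = X" "c' \<in> ?pc" "?PE c' = Y" using XY by blast
      let ?d = "\<lambda>m. c m \<oplus>\<^bsub>Sub.AL\<^esub> c' m"
      let ?S = "{m. c m \<noteq> \<zero>\<^bsub>Sub.AL\<^esub>} \<union> {m. c' m \<noteq> \<zero>\<^bsub>Sub.AL\<^esub>}"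
      have fin: "finite ?S" using pcD(2)[OF c(1)] pcD(2)[OF c(3)] by simp
      have sub: "{m. ?d m \<noteq> \<zero>\<^bsub>Sub.AL\<^esub>} \<subseteq> ?S" by auto
      have d: "?d \<in> ?pc"
        using finite_subset[OF sub fin] sub pcD(1,3)[OF c(1)] pcD(1,3)[OF c(3)]
        unfolding poly_coeffs_def by blast
      have "?PE ?d = finsum AL (\<lambda>m. incl (c m) \<otimes>\<^bsub>AL\<^esub> \<Gamma> [^]\<^bsub>AL\<^esub> lookup m 0 \<oplus>\<^bsub>AL\<^esub>
          incl (c' m) \<otimes>\<^bsub>AL\<^esub> \<Gamma> [^]\<^bsub>AL\<^esub> lookup m 0) ?S"
        unfolding PE[OF d fin sub]
      proof (rule AL.finsum_cong'[OF refl])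
        show "(\<lambda>m. incl (c m) \<otimes>\<^bsub>AL\<^esub> \<Gamma> [^]\<^bsub>AL\<^esub> lookup m 0 \<oplus>\<^bsub>AL\<^esub>
            incl (c' m) \<otimes>\<^bsub>AL\<^esub> \<Gamma> [^]\<^bsub>AL\<^esub> lookup m 0) \<in> ?S \<rightarrow> carrier AL"
          using term_closed[OF c(1)] term_closed[OF c(3)] by simp
        show "incl (c m \<oplus>\<^bsub>Sub.AL\<^esub> c' m) \<otimes>\<^bsub>AL\<^esub> \<Gamma> [^]\<^bsub>AL\<^esub> lookup m 0 =
            incl (c m) \<otimes>\<^bsub>AL\<^esub> \<Gamma> [^]\<^bsub>AL\<^esub> lookup m 0 \<oplus>\<^bsub>AL\<^esub>
            incl (c' m) \<otimes>\<^bsub>AL\<^esub> \<Gamma> [^]\<^bsub>AL\<^esub> lookup m 0" for m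
          using pcD(1)[OF c(1)] pcD(1)[OF c(3)] pow_closed
          by (simp add: ring_hom_add[OF incl_hom] AL.l_distr incl_closed)
      qed
      also have "\<dots> = X \<oplus>\<^bsub>AL\<^esub> Y"
        using PE[OF c(1) fin] PE[OF c(3) fin] c term_closed[OF c(1)] term_closed[OF c(3)]
        by (subst AL.finsum_addf) auto
      finally show ?thesis using d by blast
    qed
    have monomial: "\<exists>c\<in>?pc. ?PE c = incl t \<otimes>\<^bsub>AL\<^esub> \<Gamma> [^]\<^bsub>AL\<^esub> k" if t: "t \<in> carrier Sub.AL" for t and k :: nat
    proof -
      let ?m = "single 0 k :: nat \<Rightarrow>\<^sub>0 nat"
      let ?c = "\<lambda>m. if m = ?m then t else \<zero>\<^bsub>Sub.AL\<^esub>"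
      have sub: "{m. ?c m \<noteq> \<zero>\<^bsub>Sub.AL\<^esub>} \<subseteq> {?m}" by auto
      have c: "?c \<in> ?pc" using t finite_subset[OF sub] by (auto simp: poly_coeffs_def)
      have "?PE ?c = incl t \<otimes>\<^bsub>AL\<^esub> \<Gamma> [^]\<^bsub>AL\<^esub> k"
        unfolding PE[OF c _ sub, simplified] using t pow_closed by (simp add: incl_closed)
      then show ?thesis using c by blast
    qed
    have pure_case: "\<exists>c\<in>?pc. ?PE c = pure (evFG G q) l" if "q \<in> mpolys 2" and l: "l \<in> carrier L" for q l
      using that(1)
    proof (induction q rule: mpolys_induct)
      case zero
      have "pure (evFG G 0) l = incl \<zero>\<^bsub>Sub.AL\<^esub> \<otimes>\<^bsub>AL\<^esub> \<Gamma> [^]\<^bsub>AL\<^esub> (0::nat)"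
        using pure_zero[OF l] by (simp add: incl_0)
      then show ?case using monomial[OF Sub.AL.zero_closed, of 0] by simp
    next
      case (single m r)
      let ?b = "mpol_const r * F ^ lookup m 0"
      have "mon ((!) [F, G]) m = (\<Prod>i\<in>{..<2}. [F, G] ! i ^ lookup m i)"
        using single by (intro mon_superset) auto
      then have ev: "evFG G (single m r) = ?b * G ^ lookup m 1"
        by (simp add: mpol_const.ev_single numeral_2_eq_2 mult.assoc)
      have b: "?b \<in> RF" by (intro RFc csubring_power[OF csubring_RF] RF_const RF_F)
      have "pure (?b * G ^ lookup m 1) l =
          incl (Sub.pure ?b l) \<otimes>\<^bsub>AL\<^esub> \<Gamma> [^]\<^bsub>AL\<^esub> lookup m 1"
        using b RF_A l G pure_mult[of ?b l "G ^ lookup m 1" "\<one>\<^bsub>L\<^esub>"]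
        by (auto simp: incl_pure \<Gamma>_pow A_power)
      then show ?case
        unfolding ev using monomial[OF Sub.pure_closed[of ?b l]] b l by simp
    next
      case (add p q)
      then show ?case
        using sum[of "pure (evFG G p) l" "pure (evFG G q) l"] pure_add_left[of "evFG G p" "evFG G q" l] l G
        by (simp add: mpol_const.ev_add evFG_A)
    qed
    show ?thesis
      using that
    proof (induction X rule: tensor_induct)
      case (pure b l)
      then show ?case using A_evFG[of b] pure_case[of _ l] by auto
    next
      case (add X Y)
      then show ?case by (intro sum)
    qed
  qed
  have "?PE ` ?pc = carrier AL"
  proof (intro equalityI subsetI)
    fix X assume "X \<in> ?PE ` ?pc"
    then show "X \<in> carrier AL" using PE_closed by (elim imageE) simp
  next
    fix X assume "X \<in> carrier AL"
    from surj[OF this] obtain c where "c \<in> ?pc" "?PE c = X" ..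
    then show "X \<in> ?PE ` ?pc" by (intro image_eqI[of X _ c]) simp_all
  qed
  with inj have "bij_betw ?PE ?pc (carrier AL)" by (simp only: bij_betw_def)
  then have "poly_algebra_in Sub.AL incl AL 1 (\<lambda>_. \<Gamma>)"
    unfolding poly_algebra_in_def using incl_hom \<Gamma>_closed by (intro conjI) simp_all
  then show ?thesis unfolding poly_algebra_def by (intro exI[of _ "\<lambda>_. \<Gamma>"])
qed

lemma unimodular_gradient_iff:
  "genideal (subring_record B) ((\<lambda>i. pderivative i F) ` {..<N}) = B \<longleftrightarrow>
    (\<exists>a. (\<forall>k. a k \<in> B) \<and> (\<Sum>k<N. a k * pderivative k F) = 1)"
  using csubring_mpolys by (rule genideal_image_eq_carrier_iff) (rule mpolys_pderivative[OF A_B[OF F_A]])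

text \<open>The signs relating the minors to \<open>\<kappa>\<close> are units and are moved into
  the coefficients.\<close>

lemma minors_iff:
  "genideal (subring_record B) (minors (Suc n) (jacobian N (F # map T [0..<n]))) = B \<longleftrightarrow>
    (\<exists>a. (\<forall>k. a k \<in> B) \<and> (\<Sum>k<N. a k * \<kappa> k) = 1)"
proof -
  let ?s = "\<lambda>k. (-1) ^ (Suc n + k) * \<kappa> k"
  have "jacobian N (F # map T [0..<n]) = mat (Suc n) (Suc (Suc n)) (\<lambda>(i, k). J i k)"
    by (simp add: jacobian_def J_def)
  from minors_eq[OF this]
  have minors: "minors (Suc n) (jacobian N (F # map T [0..<n])) = ?s ` {..<N}" by (simp only: \<kappa>_def)
  have sB: "?s k \<in> B" for k by (intro mpolys_closed \<kappa>_B)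
  have "genideal (subring_record B) (?s ` {..<N}) = B \<longleftrightarrow> (\<exists>a. (\<forall>k. a k \<in> B) \<and> (\<Sum>k<N. a k * ?s k) = 1)"
    using csubring_mpolys sB by (rule genideal_image_eq_carrier_iff)
  also have "\<dots> \<longleftrightarrow> (\<exists>a. (\<forall>k. a k \<in> B) \<and> (\<Sum>k<N. a k * \<kappa> k) = 1)"
  proof
    assume "\<exists>a. (\<forall>k. a k \<in> B) \<and> (\<Sum>k<N. a k * ?s k) = 1"
    then obtain a where a: "\<And>k. a k \<in> B" "(\<Sum>k<N. a k * ?s k) = 1" by blast
    show "\<exists>a. (\<forall>k. a k \<in> B) \<and> (\<Sum>k<N. a k * \<kappa> k) = 1"
      by (rule exI[of _ "\<lambda>k. a k * (-1) ^ (Suc n + k)"]) (use a in \<open>auto simp: mult.assoc intro!: mpolys_closed\<close>)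
  next
    assume "\<exists>a. (\<forall>k. a k \<in> B) \<and> (\<Sum>k<N. a k * \<kappa> k) = 1"
    then obtain a where a: "\<And>k. a k \<in> B" "(\<Sum>k<N. a k * \<kappa> k) = 1" by blast
    have "a k * (-1) ^ (Suc n + k) * ?s k = a k * \<kappa> k" for k
    proof -
      have "(-1) ^ (Suc n + k) * (-1) ^ (Suc n + k) = (1 :: 'r mpol)"
        by (simp add: power_mult_distrib[symmetric])
      then show ?thesis by (metis mult.assoc mult.left_neutral)
    qed
    then have "(\<Sum>k<N. a k * (-1) ^ (Suc n + k) * ?s k) = 1" using a(2) by (simp only:)
    then show "\<exists>a. (\<forall>k. a k \<in> B) \<and> (\<Sum>k<N. a k * ?s k) = 1"
      by (intro exI[of _ "\<lambda>k. a k * (-1) ^ (Suc n + k)"] conjI allI mpolys_mult a(1) mpolys_power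
          mpolys_uminus mpolys_1)
  qed
  finally show ?thesis by (simp only: minors)
qed

text \<open>Since the \<open>\<kappa>\<close> are values of \<open>D\<close>, this carries a
  relation expressing 1 by maximal minors over to the gradient of F.\<close>

lemma combination_D_unimodular:
  assumes "finite K" "\<And>i. i \<in> K \<Longrightarrow> c i \<in> B" "\<And>i. i \<in> K \<Longrightarrow> g i \<in> B"
  shows "\<exists>a. (\<forall>k. a k \<in> B) \<and> (\<Sum>i\<in>K. c i * D (g i)) = (\<Sum>k<N. a k * pderivative k F)"
  using assms
proof (induction K)
  case empty
  then show ?case by (intro exI[of _ "\<lambda>_. 0"]) (auto simp: mpolys_0)
next
  case (insert i K)
  then obtain a where a: "\<And>k. a k \<in> B" "(\<Sum>i\<in>K. c i * D (g i)) = (\<Sum>k<N. a k * pderivative k F)" by auto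
  obtain b where b: "\<And>k. b k \<in> B" "D (g i) = (\<Sum>k<N. pderivative k F * b k)"
    using D_gradient_F[of "g i"] insert.prems by auto
  have "c i * D (g i) = (\<Sum>k<N. c i * b k * pderivative k F)"
    by (simp only: b(2) sum_distrib_left mult_ac)
  then have "(\<Sum>i\<in>insert i K. c i * D (g i)) = (\<Sum>k<N. (c i * b k + a k) * pderivative k F)"
    using insert.hyps by (simp add: a(2) distrib_right sum.distrib del: sum.lessThan_Suc)
  moreover have "c i * b k + a k \<in> B" for k using a b insert.prems by (intro mpolys_closed) auto
  ultimately show ?case by (intro exI[of _ "\<lambda>k. c i * b k + a k"]) simp
qed

lemma coordinate_iff:
  assumes "G \<in> A"
  shows "poly_algebra_in (class_ring :: 'r ring) mpol_const (subring_record A) 2 ((!) [F, G]) \<longleftrightarrow>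
    bij_betw (evFG G) (mpolys 2) A"
proof -
  let ?e = "poly_eval (class_ring :: 'r ring) mpol_const (subring_record A) ((!) [F, G])"
  let ?P = "{p \<in> mpolys 2. \<forall>m. lookup p m \<in> (UNIV :: 'r set)}"
  have tr: "inj_on ?e (poly_coeffs class_ring 2) \<longleftrightarrow> inj_on (evFG G) ?P"
    "?e ` poly_coeffs class_ring 2 = evFG G ` ?P"
    using poly_eval_subring_record_transfer[OF csubring_A UNIV_I A_const nth_FG_A[OF assms], of 2 "\<lambda>a. a" "\<lambda>i. i"]
    by simp_all
  have "(!) [F, G] \<in> {..<2} \<rightarrow> carrier (subring_record A)" using nth_FG_A[OF assms] by auto
  then show ?thesis
    using const_ring_hom tr by (simp add: poly_algebra_in_def bij_betw_def)
qed

lemma residual_coordinateI: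
  assumes G: "G \<in> A" "bij_betw (evFG G) (mpolys 2) A"
  shows "residual_coordinate (class_ring :: 'r ring) mpol_const (subring_record A) F"
  unfolding residual_coordinate_def
proof (intro conjI allI impI)
  have tr: "inj_on (poly_eval (class_ring :: 'r ring) mpol_const (subring_record A) (\<lambda>_. F)) (poly_coeffs class_ring 1) \<longleftrightarrow>
      inj_on evF {p \<in> mpolys 1. \<forall>m. lookup p m \<in> UNIV}"
    by (rule poly_eval_subring_record_transfer(1)[OF csubring_A UNIV_I A_const F_A])
  have "inj_on evF (mpolys 1)"
  proof (rule inj_onI)
    fix p q assume pq: "p \<in> mpolys 1" "q \<in> mpolys 1" "evF p = evF q"
    have "p \<in> mpolys 2" "q \<in> mpolys 2" using pq mpolys_mono[of 1 2] by auto
    moreover have "evFG G p = evFG G q" using pq by (simp only: evFG_evF)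
    ultimately show "p = q" using G(2) by (metis bij_betw_imp_inj_on inj_onD)
  qed
  then show "alg_independent (class_ring :: 'r ring) mpol_const (subring_record A) 1 (\<lambda>_. F)"
    unfolding alg_independent_def tr by simp
next
  fix P assume "primeideal P (class_ring :: 'r ring)"
  then have "fractions_mod P (to_residue_field class_ring P) (residue_field class_ring P)"
    by (intro fractions_mod_residue_field) (simp add: primeideal_class_ring_iff)
  then show "poly_algebra
      (tensor class_ring mpol_const (adjoin class_ring mpol_const (subring_record A) F)
        (to_residue_field class_ring P) (residue_field class_ring P))
      (tensor_incl class_ring mpol_const (subring_record A) (to_residue_field class_ring P) (residue_field class_ring P))
      (tensor class_ring mpol_const (subring_record A) (to_residue_field class_ring P) (residue_field class_ring P)) 1"
    unfolding adjoin_eq using G by (intro base_change) (auto simp: fractions_mod_def)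
qed

lemma D_derivation: "R_derivation (class_ring :: 'r ring) mpol_const (subring_record B) D"
  by (auto simp: R_derivation_def D_B D_add D_mult D_const)

end

section \<open>Equivalence of the gradient, coordinate and derivation conditions\<close>

theorem corollaryB:
  fixes n :: nat
    and A :: "'r::comm_ring_1 mpol set"
    and T :: "nat \<Rightarrow> 'r mpol"
    and F :: "'r mpol"
  defines "R \<equiv> (class_ring :: 'r ring)"
    and "RX \<equiv> (mpol_ring (n + 2) :: 'r mpol ring)"
    and "AR \<equiv> (mpol_ring (n + 2) :: 'r mpol ring)\<lparr>carrier := A\<rparr>"
    and "D \<equiv> jacobian_derivation (n + 2) (F # map T [0..<n])"
  assumes noetherian: "noetherian_ring R"
    and contains_Q: "\<exists>\<phi>. \<phi> \<in> Ring.ring_hom (class_ring :: rat ring) R \<and> inj \<phi>"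
    and subalgebra: "subring A RX" "range mpol_const \<subseteq> A"
    and A_T_eq_R_X: "poly_algebra_in AR id RX n T"
    and F_in_A: "F \<in> A"
    and generic: "\<And>P. minimal_prime R P \<Longrightarrow>
      poly_over_adjoined R mpol_const AR (to_quotient_field R P) (quotient_field (R Quot P)) F"
  shows
    "let I = (genideal RX ((\<lambda>i. pderivative i F) ` {..<n + 2}) = carrier RX);
         II = residual_coordinate R mpol_const AR F;
         III = (\<exists>G \<in> A. poly_algebra_in R mpol_const AR 2 ((!) [F, G]));
         IV = (R_LND R mpol_const RX D \<and> has_slice RX D);
         V = (R_LND R mpol_const RX D \<and> fixed_point_free RX D);
         VI = (genideal RX (minors (n + 1) (jacobian (n + 2) (F # map T [0..<n]))) = carrier RX)
     in (I \<longleftrightarrow> II) \<and> (II \<longleftrightarrow> III) \<and> (III \<longleftrightarrow> IV) \<and> (IV \<longleftrightarrow> V) \<and> (V \<longleftrightarrow> VI)"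
proof -
  have N: "n + 2 = Suc (Suc n)" "n + 1 = Suc n" by simp_all
  let ?B = "mpolys (Suc (Suc n)) :: 'r mpol set"
  have RX: "RX = subring_record ?B" by (simp add: RX_def mpol_ring_eq)
  have AR: "AR = subring_record A" by (simp add: AR_def mpol_ring_eq)
  have BI: "csubring ?B" by (rule csubring_mpolys)
  interpret B: cring "subring_record ?B" by (rule cring_subring_record[OF BI])
  have rational: "\<exists>c::'r. of_nat (Suc k) * c = 1" for k
  proof -
    obtain \<phi> where \<phi>: "\<phi> \<in> Ring.ring_hom (class_ring :: rat ring) (class_ring :: 'r ring)"
      using contains_Q unfolding R_def by blast
    have "\<phi> 0 = 0"
      using ring_hom_add[OF \<phi>, of 0 0] by simp
    then have "\<phi> (of_nat m) = of_nat m" for m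
      using ring_hom_add[OF \<phi>] ring_hom_one[OF \<phi>] by (induction m) simp_all
    \<comment> \<open>The inverse of a positive integer in R is the image of its rational
      inverse.\<close>
    then have "of_nat (Suc k) * \<phi> (1 / of_nat (Suc k)) = \<phi> (of_nat (Suc k) * (1 / of_nat (Suc k)))"
      using ring_hom_mult[OF \<phi>, of "of_nat (Suc k)" "1 / of_nat (Suc k)"] by (simp del: of_nat_Suc)
    also have "\<dots> = 1" using ring_hom_one[OF \<phi>] by (simp del: of_nat_Suc)
    finally show ?thesis by blast
  qed
  have sub: "subring A (subring_record ?B)" using subalgebra(1) by (simp add: RX)
  note subE = subringE[OF sub, simplified]
  have A_0: "0 \<in> A" using subE by simp
  have T: "T i \<in> ?B" if "i < n" for i
    using A_T_eq_R_X that by (auto simp: poly_algebra_in_def RX)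
  have tr: "inj_on (ev id T) {p \<in> mpolys n. \<forall>m. lookup p m \<in> A} \<and>
      ev id T ` {p \<in> mpolys n. \<forall>m. lookup p m \<in> A} = ?B"
  proof -
    let ?e = "poly_eval (subring_record A) id (subring_record ?B) T"
    let ?P = "{p \<in> mpolys n. \<forall>m. lookup p m \<in> A}"
    have A_B: "id s \<in> ?B" if "s \<in> A" for s using that subE(1) by auto
    have tr: "inj_on ?e (poly_coeffs (subring_record A) n) \<longleftrightarrow> inj_on (ev id T) ?P"
      "?e ` poly_coeffs (subring_record A) n = ev id T ` ?P"
      by (rule poly_eval_subring_record_transfer[OF BI A_0 A_B T]; assumption)+
    have "bij_betw (poly_eval (subring_record A) id (subring_record ?B) T) (poly_coeffs (subring_record A) n) ?B"
      using A_T_eq_R_X by (simp add: poly_algebra_in_def AR RX)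
    then show ?thesis unfolding bij_betw_def tr .
  qed
  have const: "mpol_const r \<in> A" for r using subalgebra(2) by auto
  interpret S: stably_polynomial n A T F
  proof (rule stably_polynomial.intro)
    show "noetherian_ring (class_ring :: 'r ring)" using noetherian by (simp add: R_def)
  qed (use rational subE tr T F_in_A const in auto)
  have D: "D = S.D" unfolding D_def S.D_def N ..
  let ?I = "genideal RX ((\<lambda>i. pderivative i F) ` {..<n + 2}) = carrier RX"
    and ?II = "residual_coordinate R mpol_const AR F"
    and ?III = "\<exists>G \<in> A. poly_algebra_in R mpol_const AR 2 ((!) [F, G])"
    and ?LND = "R_LND R mpol_const RX D"
    and ?VI = "genideal RX (minors (n + 1) (jacobian (n + 2) (F # map T [0..<n]))) = carrier RX"
  have I: "?I \<longleftrightarrow> (\<exists>a. (\<forall>k. a k \<in> ?B) \<and> (\<Sum>k<Suc (Suc n). a k * pderivative k F) = 1)"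
    unfolding RX N using S.unimodular_gradient_iff by simp
  have VI: "?VI \<longleftrightarrow> (\<exists>a. (\<forall>k. a k \<in> ?B) \<and> (\<Sum>k<Suc (Suc n). a k * S.\<kappa> k) = 1)"
    unfolding RX N using S.minors_iff by simp
  have III: "?III \<longleftrightarrow> (\<exists>G\<in>A. bij_betw (S.evFG G) (mpolys 2) A)"
    unfolding R_def AR using S.coordinate_iff by blast
  have gen_mod: "\<exists>G. S.generates_mod P G" if "minimal_prime (class_ring :: 'r ring) P" for P
  proof -
    have P: "cprime P" using that by (simp add: minimal_prime_def primeideal_class_ring_iff)
    show ?thesis
      using S.poly_over_adjoined_generates_mod[OF P fractions_mod_quotient_field[OF P]]
        generic[of P] that by (simp add: R_def AR)
  qed
  have I_III: ?III if asm: ?I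
  proof -
    obtain a where a: "\<forall>k. a k \<in> ?B" "(\<Sum>k<Suc (Suc n). a k * pderivative k F) = 1" using asm I by blast
    interpret generic_coordinate n A T F a
      using a gen_mod by unfold_locales auto
    show ?thesis using coordinate unfolding III by blast
  qed
  have III_II: ?II if asm: ?III
  proof -
    obtain G where "G \<in> A" "bij_betw (S.evFG G) (mpolys 2) A" using asm III by blast
    then show ?thesis unfolding R_def AR by (rule S.residual_coordinateI)
  qed
  have II_I: ?I if ?II
  proof -
    have "\<exists>G. S.generates_mod P G" if "cprime P" for P
      using S.residual_coordinate_generates_mod[OF that] \<open>?II\<close> by (simp add: R_def AR)
    then show ?thesis unfolding I using S.unimodular_gradientI by metis
  qed
  have I_VI: ?VI if asm: ?I
  proof -
    obtain a where a: "\<forall>k. a k \<in> ?B" "(\<Sum>k<Suc (Suc n). a k * pderivative k F) = 1" using asm I by blast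
    interpret unimodular n A T F a using a by unfold_locales auto
    show ?thesis unfolding VI using sum_\<eta>_\<kappa> \<eta>_B by blast
  qed
  have VI_I: ?I if asm: ?VI
  proof -
    obtain a where a: "\<forall>k. a k \<in> ?B" "(\<Sum>k<Suc (Suc n). a k * S.\<kappa> k) = 1" using asm VI by blast
    have "(\<Sum>k<Suc (Suc n). a k * S.D (mvar k)) = 1"
      unfolding a(2)[symmetric] by (rule sum.cong) (auto simp: S.D_mvar simp del: sum.lessThan_Suc)
    moreover obtain b where "\<forall>k. b k \<in> ?B"
      "(\<Sum>k<Suc (Suc n). a k * S.D (mvar k)) = (\<Sum>k<Suc (Suc n). b k * pderivative k F)"
      using S.combination_D_unimodular[of "{..<Suc (Suc n)}" a mvar] a(1) mpolys_mvar by blast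
    ultimately show ?thesis unfolding I by (intro exI[of _ b]) (simp del: sum.lessThan_Suc)
  qed
  have IV: "?LND \<and> has_slice RX D" if asm: ?III
  proof -
    \<comment> \<open>Condition III returns to I through II, which supplies the combination
      \<open>a\<close> of derivatives from which the right inverse of the Jacobian matrix is
      built.\<close>
    have ?I using asm III_II II_I by blast
    then obtain a where a: "\<forall>k. a k \<in> ?B" "(\<Sum>k<Suc (Suc n). a k * pderivative k F) = 1" using I by blast
    obtain G where G: "G \<in> A" "A \<subseteq> S.evFG G ` mpolys 2" using asm unfolding III bij_betw_def by blast
    interpret unimodular n A T F a using a by unfold_locales auto
    have "\<forall>x\<in>?B. \<exists>m. (S.D ^^ m) x = 0"
      using D_nilpotent_mod[OF G cideal_zero] by simp
    moreover have "\<exists>s\<in>?B. S.D s = 1" by (rule D_slice[OF G])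
    ultimately show ?thesis
      using S.D_derivation by (simp add: R_LND_def has_slice_def D RX R_def)
  qed
  have DB: "S.D ` ?B \<subseteq> carrier (subring_record ?B)" using S.D_B by auto
  have slice_fpf: "fixed_point_free RX D" if asm: "has_slice RX D"
  proof -
    obtain s where "s \<in> ?B" "S.D s = 1" using asm by (auto simp: has_slice_def D RX)
    then have "1 \<in> genideal (subring_record ?B) (S.D ` ?B)" using B.genideal_self[OF DB] by force
    then show ?thesis
      using genideal_eq_carrier_iff[OF BI] DB by (simp add: fixed_point_free_def D RX)
  qed
  have fpf_I: ?I if "fixed_point_free RX D"
  proof -
    let ?G = "genideal (subring_record ?B) ((\<lambda>i. pderivative i F) ` {..<Suc (Suc n)})"
    have F': "pderivative k F \<in> ?B" for k by (rule mpolys_pderivative[OF S.A_B[OF F_in_A]])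
    have G: "?G = {\<Sum>k<Suc (Suc n). a k * pderivative k F | a. \<forall>k. a k \<in> ?B}"
      using BI F' by (rule genideal_image)
    have "ideal ?G (subring_record ?B)" using F' by (intro B.genideal_ideal) auto
    \<comment> \<open>Expansion along the row of F makes every value of \<open>D\<close> a
      combination of the derivatives of F.\<close>
    moreover have "S.D ` ?B \<subseteq> ?G"
    proof
      fix x assume "x \<in> S.D ` ?B"
      then obtain g where "g \<in> ?B" "x = S.D g" by blast
      then obtain c where "\<And>k. c k \<in> ?B" "x = (\<Sum>k<Suc (Suc n). pderivative k F * c k)"
        using S.D_gradient_F by metis
      then have "\<forall>k. c k \<in> ?B" "x = (\<Sum>k<Suc (Suc n). c k * pderivative k F)" by (simp_all add: mult.commute)
      then show "x \<in> ?G" unfolding G by blast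
    qed
    ultimately have "genideal (subring_record ?B) (S.D ` ?B) \<subseteq> ?G" by (rule B.genideal_minimal)
    moreover have "1 \<in> genideal (subring_record ?B) (S.D ` ?B)"
      using that by (simp add: fixed_point_free_def D RX mpolys_1)
    ultimately have "1 \<in> ?G" by blast
    then show ?thesis unfolding I G by auto
  qed
  \<comment> \<open>The implications close up as I to III to II to I, I to VI and back, and III to
    IV to V to I.\<close>
  show ?thesis
    unfolding Let_def
    using I_III III_II II_I I_VI VI_I IV slice_fpf fpf_I by blast
qed

end
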